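(* For all integers $m,p\ge 1$ and $l\ge 0$, $$(-1)^m \sum_{j=1}^p \alpha_{p-j}\,W_l(2j+2m+l-3,\,2m+l-1) =(-1)^p \sum_{j=1}^m \alpha_{m-j}\, W_l(2j+2p+l-3,\,2p+l-1),$$ where $\alpha_n=(-1)^n \pi^{2n}/(2n+1)!$ for $n\ge 0$.
   Context: For positive integers $k_1,\dots,k_r$ and signs $\sigma_1,\dots,\sigma_r\in\{\pm1\}$ with $(k_r,\sigma_r)\ne(1,1)$, define $$T(k_1,\dots,k_r;\sigma_1,\dots,\sigma_r):=2^r\sum_{0<n_1<\cdots<n_r}\frac{\sigma_1^{n_1}\sigma_2^{n_2}\cdots\sigma_r^{n_r}}{(2n_1-1)^{k_1}(2n_2-2)^{k_2}\cdots(2n_r-r)^{k_r}}$$ (conditionally convergent sums are limits as $N\to\infty$ of the sums over $n_r\le N$). The signs are indicated by placing a bar over $k_j$ exactly when $\sigma_j=-1$; e.g. $T(\bar2,3,\bar1)=T(2,3,1;-1,1,-1)$. For integers $0\le l\le r$, $r\ge1$, define $$W_l(k,r):=\sum_{\substack{k_1+\cdots+k_r=k\\ k_1,\dots,k_r\ge1}}T(k_1,\dots,k_{l-1},\overline{k_l},k_{l+1},\dots,k_{r-1},\overline{k_r}),$$ with bars at positions $l$ and $r$ if $1\le l<r$; if $l=0$ or $l=r$, only the last entry is barred, i.e. $W_0(k,r)=W_r(k,r)=\sum T(k_1,\dots,k_{r-1},\overline{k_r})$. *)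

theory Defs
  imports "HOL-Analysis.Analysis"
begin

text \<open>Indices \<open>k\<^sub>1,\<dots>,k\<^sub>r\<close> and signs \<open>\<sigma>\<^sub>1,\<dots>,\<sigma>\<^sub>r\<close> are lists of equal length \<open>r\<close>; list position \<open>i\<close>
  (counted from 0) holds the entry with mathematical index \<open>i + 1\<close>, whose denominator is
  \<open>2 n\<^sub>i\<^sub>+\<^sub>1 - (i + 1)\<close>.\<close>

definition T_partial :: "nat \<Rightarrow> nat list \<Rightarrow> real list \<Rightarrow> real" where
  "T_partial N ks sgs =
     2 ^ length ks *
     (\<Sum>ns \<in> {ns :: nat list. length ns = length ks \<and> sorted_wrt (<) ns \<and> set ns \<subseteq> {1..N}}.
        \<Prod>i<length ks. (sgs ! i) ^ (ns ! i) / (2 * real (ns ! i) - real (i + 1)) ^ (ks ! i))"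

text \<open>The truncation bounds only the largest summation variable, so the limit below is the
  prescribed summation of the conditionally convergent series; it is meaningful when the last
  entry of \<open>ks\<close> and of \<open>sgs\<close> are not both 1.\<close>

definition T_val :: "nat list \<Rightarrow> real list \<Rightarrow> real" where
  "T_val ks sgs = lim (\<lambda>N. T_partial N ks sgs)"

definition compositions :: "nat \<Rightarrow> nat \<Rightarrow> nat list set" where
  "compositions k r = {ks. length ks = r \<and> sum_list ks = k \<and> (\<forall>x \<in> set ks. 1 \<le> x)}"

text \<open>Positions in \<open>bar_signs\<close> are counted from 1, so \<open>l = 0\<close> and \<open>l = r\<close> both leave only the last
  entry barred.\<close>

definition bar_signs :: "nat \<Rightarrow> nat \<Rightarrow> real list" where
  "bar_signs l r = map (\<lambda>i. if i = l \<or> i = r then - 1 else 1) [1..<r + 1]"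

definition W :: "nat \<Rightarrow> nat \<Rightarrow> nat \<Rightarrow> real" where
  "W l k r = (\<Sum>ks \<in> compositions k r. T_val ks (bar_signs l r))"

definition \<alpha> :: "nat \<Rightarrow> real" where
  "\<alpha> n = (- 1) ^ n * pi ^ (2 * n) / fact (2 * n + 1)"

end

theory Submission
  imports Defs "HOL-Complex_Analysis.Complex_Analysis"
begin

text \<open>
  The identity says that, up to sign, an iterated integral is invariant under a quarter turn of the
  Riemann sphere.

  Summing \<open>T\<close> over all compositions turns the weight into a formal variable: \<open>W\<^sub>l(c + r, r)\<close> is the
  coefficient of \<open>x\<^sup>c\<close> in the sum of \<open>2\<^sup>r \<Prod> \<plusminus>1 / (N\<^sub>i - x)\<close> over increasing sequences of positive
  integers \<open>N\<^sub>i = 2 n\<^sub>i - i\<close>. The gaps \<open>N\<^sub>i - N\<^sub>i\<^sub>-\<^sub>1\<close> are odd, so in the variable \<open>w = ln t\<close> this is an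
  \<open>r\<close>-fold iterated integral over \<open>w < 0\<close> that starts from \<open>exp (- x w)\<close>, integrates \<open>l\<close> times against
  \<open>- dw / sinh w\<close> and then \<open>r - l\<close> times against \<open>- dw / cosh w = d\<theta>\<close>, where
  \<open>\<theta>(w) = \<pi>/2 - 2 arctan (exp w)\<close>. The bars at positions \<open>l\<close> and \<open>r\<close> are what makes the kernel change
  after step \<open>l\<close>.

  The \<open>\<alpha>\<^sub>n\<close> are the coefficients of \<open>sin (\<pi> x) / (\<pi> x)\<close>. Hence weighting by \<open>\<alpha>\<close> replaces the initial
  powers of \<open>w\<close> by \<open>Im (w + i \<pi>)\<^sup>2\<^sup>p\<^sup>-\<^sup>1 / (\<pi> (2 p - 1)!)\<close> (lemma \<open>alpha_prim_0\<close>), the imaginary part of a power of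
  the logarithm on the other side of its branch point. With \<open>r = l + 2 m - 1\<close> the last \<open>2 m - 1\<close> integrations produce
  \<open>\<theta>\<^sup>2\<^sup>m\<^sup>-\<^sup>1 / (2 m - 1)!\<close>. So \<open>\<pi>\<close> times the left-hand sum is, up to sign, the imaginary part of the
  iterated integral of
    \<open>z\<^sup>2\<^sup>p\<^sup>-\<^sup>1 / (2 p - 1)!\<close>, \<open>l\<close> factors \<open>- dz / sinh z\<close>, and \<open>d (\<beta>\<^sup>2\<^sup>m\<^sup>-\<^sup>1 / (2 m - 1)!)\<close> with \<open>\<beta>(z) = \<pi>/2 + 2 Arctan (exp z)\<close>
  along the upper edge \<open>Im z = \<pi>\<close> of the half-strip \<open>Re z < 0\<close>, \<open>0 < Im z < \<pi>\<close> (lemma \<open>primitive_top\<close>).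
  In the coordinate \<open>t = exp z\<close> the half-strip is the upper half of the unit disc.

  The lower edge contributes nothing to the imaginary part, because everything is real there, so by
  Cauchy's theorem the integral moves to the segment \<open>z = i \<phi>\<close>, \<open>0 \<le> \<phi> \<le> \<pi>\<close>, the unit circle. There the
  \<open>l\<close>-fold primitives are purely imaginary. For \<open>\<phi> > \<pi>/2\<close> so is \<open>\<beta>\<close>, and the integrand has no real part; for
  \<open>\<phi> = \<theta>(w) < \<pi>/2\<close> one has \<open>\<beta>(i \<theta>(w)) = - i (w + i \<pi>)\<close> (lemma \<open>rlog_first_quadrant\<close>). The quarter
  turn about \<open>\<plusminus>1\<close> thus exchanges \<open>log t\<close> with \<open>\<beta>\<close> and preserves \<open>dt / (1 - t\<^sup>2)\<close>, and what is left is an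
  integral of the same kind with \<open>p\<close> and \<open>m\<close> exchanged and the factors in the opposite order. Integrating
  by parts \<open>l\<close> times (lemma \<open>iterated_integration_by_parts\<close>) restores the order.

  The integrals from \<open>0\<close> in the \<open>t\<close>-plane must be compared with primitives that behave well at \<open>t = 1\<close>.
  The primitives \<open>cprim\<close> are normalised to vanish at \<open>z = 0\<close>, where the zero of \<open>z\<^sup>2\<^sup>p\<^sup>-\<^sup>1\<close> cancels the
  pole of \<open>1 / sinh\<close> at each step. A change of base point only adds functions that are real on both
  edges, so it does not affect imaginary parts (lemma \<open>cprim_top\<close>).
\<close>

section \<open>Truncated sums and their convergence\<close>

definition inc_lists :: "nat \<Rightarrow> nat \<Rightarrow> nat list set" where
  "inc_lists r N = {ns. length ns = r \<and> sorted_wrt (<) ns \<and> set ns \<subseteq> {1..N}}"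

lemma finite_inc_lists: "finite (inc_lists r N)"
proof (rule finite_subset)
  show "inc_lists r N \<subseteq> {ns. set ns \<subseteq> {1..N} \<and> length ns = r}"
    by (auto simp: inc_lists_def)
  show "finite {ns :: nat list. set ns \<subseteq> {1..N} \<and> length ns = r}"
    by (rule finite_lists_length_eq) simp
qed

lemma inc_lists_0: "inc_lists 0 N = {[]}"
  by (auto simp: inc_lists_def)

lemma inc_lists_Suc:
  "inc_lists (Suc r) N = (\<lambda>(n, ns). ns @ [n]) ` (SIGMA n:{1..N}. inc_lists r (n - 1))"
proof
  show "inc_lists (Suc r) N \<subseteq> (\<lambda>(n, ns). ns @ [n]) ` (SIGMA n:{1..N}. inc_lists r (n - 1))"
  proof
    fix xs assume xs: "xs \<in> inc_lists (Suc r) N"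
    then have "xs \<noteq> []" by (auto simp: inc_lists_def)
    then obtain ns n where eq: "xs = ns @ [n]" by (metis rev_exhaust)
    have "n \<in> {1..N}" "ns \<in> inc_lists r (n - 1)"
      using xs unfolding eq inc_lists_def by (fastforce simp: sorted_wrt_append)+
    then show "xs \<in> (\<lambda>(n, ns). ns @ [n]) ` (SIGMA n:{1..N}. inc_lists r (n - 1))"
      using eq by force
  qed
  show "(\<lambda>(n, ns). ns @ [n]) ` (SIGMA n:{1..N}. inc_lists r (n - 1)) \<subseteq> inc_lists (Suc r) N"
    by (fastforce simp: inc_lists_def sorted_wrt_append)
qed

lemma T_partial_Nil: "T_partial N [] [] = 1"
  using inc_lists_0[of N] by (simp add: T_partial_def inc_lists_def)

text \<open>Splitting off the largest summation variable; the remaining sum is again a truncated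
  sum, cut off just below that variable.\<close>

lemma T_partial_snoc:
  assumes "length sgs = length ks"
  shows "T_partial N (ks @ [k]) (sgs @ [s]) =
    (\<Sum>n = 1..N. 2 * s ^ n / (2 * real n - real (Suc (length ks))) ^ k * T_partial (n - 1) ks sgs)"
proof -
  define r where "r = length ks"
  define summand where "summand ks sgs ns =
    (\<Prod>i<length ks. (sgs ! i) ^ (ns ! i) / (2 * real (ns ! i) - real (i + 1)) ^ (ks ! i))"
    for ks sgs and ns :: "nat list"
  have T: "T_partial N ks sgs = 2 ^ length ks * (\<Sum>ns\<in>inc_lists (length ks) N. summand ks sgs ns)"
    for N ks sgs by (simp add: T_partial_def summand_def inc_lists_def)
  have split: "summand (ks @ [k]) (sgs @ [s]) (ns @ [n]) =
      summand ks sgs ns * (s ^ n / (2 * real n - real (Suc r)) ^ k)"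
    if "length ns = r" for ns n
  proof -
    have "(\<Prod>i<r. ((sgs @ [s]) ! i) ^ ((ns @ [n]) ! i) /
             (2 * real ((ns @ [n]) ! i) - real (i + 1)) ^ ((ks @ [k]) ! i)) =
          (\<Prod>i<r. (sgs ! i) ^ (ns ! i) / (2 * real (ns ! i) - real (i + 1)) ^ (ks ! i))"
      by (rule prod.cong) (use that assms in \<open>auto simp: nth_append r_def\<close>)
    then show ?thesis
      using that assms by (simp add: summand_def nth_append r_def)
  qed
  have inj: "inj_on (\<lambda>(n, ns). ns @ [n]) (SIGMA n:{1..N}. inc_lists r (n - 1))"
    by (auto simp: inj_on_def)
  have "(\<Sum>ns\<in>inc_lists (Suc r) N. summand (ks @ [k]) (sgs @ [s]) ns) =
      (\<Sum>(n, ns)\<in>(SIGMA n:{1..N}. inc_lists r (n - 1)). summand (ks @ [k]) (sgs @ [s]) (ns @ [n]))"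
    unfolding inc_lists_Suc by (subst sum.reindex[OF inj]) (auto simp: o_def case_prod_unfold)
  also have "\<dots> = (\<Sum>n = 1..N. \<Sum>ns\<in>inc_lists r (n - 1). summand (ks @ [k]) (sgs @ [s]) (ns @ [n]))"
    by (rule sum.Sigma[symmetric]) (auto simp: finite_inc_lists)
  also have "\<dots> = (\<Sum>n = 1..N. (s ^ n / (2 * real n - real (Suc r)) ^ k) * (\<Sum>ns\<in>inc_lists r (n - 1). summand ks sgs ns))"
    unfolding sum_distrib_left
    by (intro sum.cong refl) (auto simp: split inc_lists_def)
  finally show ?thesis
    by (simp add: T r_def sum_distrib_left mult_ac)
qed

lemma T_partial_eq_0: "N < length ks \<Longrightarrow> T_partial N ks sgs = 0"
proof -
  assume *: "N < length ks"
  have "inc_lists (length ks) N = {}"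
  proof -
    have False if "ns \<in> inc_lists (length ks) N" for ns
    proof -
      have "distinct ns" "set ns \<subseteq> {1..N}" "length ns = length ks"
        using that strict_sorted_iff[of ns] by (auto simp: inc_lists_def)
      then have "length ks \<le> card {1..N}"
        by (metis card_mono distinct_card finite_atLeastAtMost)
      then show False using * by simp
    qed
    then show ?thesis by blast
  qed
  then show ?thesis unfolding T_partial_def inc_lists_def[symmetric] by simp
qed

lemma sum_inverse_sqrt_le: "(\<Sum>n = 1..N. 1 / sqrt (real n)) \<le> 2 * sqrt (real N)"
proof (induction N)
  case (Suc N)
  define a b where "a = sqrt (real N)" and "b = sqrt (real (Suc N))"
  have ab: "b > 0" "a \<ge> 0" "b\<^sup>2 = a\<^sup>2 + 1" by (auto simp: a_def b_def)
  have "2 * a * b \<le> a\<^sup>2 + b\<^sup>2" using sum_squares_bound by blast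
  then have "1 / b \<le> 2 * (b - a)"
    using ab by (simp add: field_simps power2_eq_square)
  then show ?case using Suc by (simp add: a_def b_def)
qed simp

text \<open>If \<open>T\<close> grows like a square root, then the summand with largest index \<open>n\<close> is \<open>O(1 / sqrt n)\<close>:
  for \<open>n > r\<close> the base \<open>2 n - (r + 1)\<close> is at least \<open>n\<close>, and for smaller \<open>n\<close> the inner sum is empty.\<close>

lemma T_partial_term_bound:
  fixes T :: "nat \<Rightarrow> real"
  assumes bd: "\<And>n. \<bar>T n\<bar> \<le> C * sqrt (real n + 1)" and zero: "\<And>n. n < r \<Longrightarrow> T n = 0"
    and "n \<ge> 1" "k \<ge> 1" "\<bar>s\<bar> = (1::real)"
  shows "\<bar>2 * s ^ n / (2 * real n - real (Suc r)) ^ k * T (n - 1)\<bar> \<le> 2 * C / sqrt (real n)"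
proof (cases "n - 1 < r")
  case True
  have "C \<ge> 0" using bd[of 0] by simp
  with zero[OF True] show ?thesis by simp
next
  case False
  then have x: "2 * real n - real (Suc r) \<ge> real n" using \<open>n \<ge> 1\<close> by auto
  have "C \<ge> 0" using bd[of 0] by simp
  have n1: "real n \<ge> 1" using assms by simp
  have "real n \<le> real n ^ k" using self_le_power[OF n1] assms by simp
  also have "\<dots> \<le> (2 * real n - real (Suc r)) ^ k" using x by (intro power_mono) auto
  finally have xk: "real n \<le> (2 * real n - real (Suc r)) ^ k" .
  have "\<bar>2 * s ^ n / (2 * real n - real (Suc r)) ^ k * T (n - 1)\<bar> =
     2 / (2 * real n - real (Suc r)) ^ k * \<bar>T (n - 1)\<bar>"
    using assms x xk n1 by (simp add: abs_mult power_abs)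
  also have "\<dots> \<le> 2 / real n * (C * sqrt (real n))"
    using bd[of "n - 1"] n1 xk assms by (intro mult_mono divide_left_mono) (auto intro!: mult_pos_pos)
  also have "\<dots> = 2 * C / sqrt (real n)"
    using n1 by (simp add: field_simps)
  finally show ?thesis .
qed

text \<open>The true growth is a power of a logarithm. A square root is used because its exponent is
  stable under the recursion: summing \<open>O(1 / sqrt n)\<close> gives \<open>O(sqrt N)\<close> again.\<close>

lemma T_partial_bound:
  assumes "length sgs = length ks" "\<forall>k\<in>set ks. 1 \<le> k" "\<forall>s\<in>set sgs. \<bar>s\<bar> = 1"
  shows "\<exists>C. \<forall>N. \<bar>T_partial N ks sgs\<bar> \<le> C * sqrt (real N + 1)"
  using assms
proof (induction ks arbitrary: sgs rule: rev_induct)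
  case Nil
  then show ?case by (intro exI[of _ 1]) (auto simp: T_partial_Nil)
next
  case (snoc k ks)
  then have "sgs \<noteq> []" by auto
  then obtain sgs' s where sgs: "sgs = sgs' @ [s]" by (metis rev_exhaust)
  have "\<exists>C. \<forall>N. \<bar>T_partial N ks sgs'\<bar> \<le> C * sqrt (real N + 1)"
    by (rule snoc.IH) (use snoc.prems sgs in auto)
  then obtain C where C: "\<And>N. \<bar>T_partial N ks sgs'\<bar> \<le> C * sqrt (real N + 1)" by blast
  have C0: "C \<ge> 0" using C[of 0] by simp
  have len: "length sgs' = length ks" using snoc sgs by simp
  have "\<bar>T_partial N (ks @ [k]) sgs\<bar> \<le> 4 * C * sqrt (real N + 1)" for N
  proof -
    have "\<bar>T_partial N (ks @ [k]) sgs\<bar> \<le> (\<Sum>n = 1..N. 2 * C / sqrt (real n))"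
      unfolding sgs T_partial_snoc[OF len]
      by (rule order_trans[OF sum_abs sum_mono], rule T_partial_term_bound[OF C])
        (use snoc sgs in \<open>auto simp: T_partial_eq_0\<close>)
    also have "\<dots> = 2 * C * (\<Sum>n = 1..N. 1 / sqrt (real n))"
      by (simp add: sum_distrib_left)
    also have "\<dots> \<le> 2 * C * (2 * sqrt (real N))"
      using C0 sum_inverse_sqrt_le by (intro mult_left_mono) auto
    also have "\<dots> \<le> 4 * C * sqrt (real N + 1)"
      using C0 by (auto intro!: mult_left_mono)
    finally show ?thesis .
  qed
  then show ?case by blast
qed

lemma T_partial_increment_bound:
  assumes len: "length sgs = length ks" and ks: "\<forall>k\<in>set ks. 1 \<le> k" and sg: "\<forall>s\<in>set sgs. \<bar>s\<bar> = 1"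
  shows "\<exists>C. \<forall>n\<ge>1. \<bar>T_partial n ks sgs - T_partial (n - 1) ks sgs\<bar> \<le> C / sqrt (real n)"
proof (cases ks rule: rev_cases)
  case Nil
  then show ?thesis using len by (intro exI[of _ 0]) (simp add: T_partial_Nil)
next
  case (snoc ks' k')
  with len obtain sgs' s where sgs: "sgs = sgs' @ [s]" by (cases sgs rule: rev_cases) auto
  have len': "length sgs' = length ks'" using len snoc sgs by simp
  obtain C where C: "\<And>N. \<bar>T_partial N ks' sgs'\<bar> \<le> C * sqrt (real N + 1)"
    using T_partial_bound[OF len'] snoc sgs ks sg by auto
  have "\<bar>T_partial n ks sgs - T_partial (n - 1) ks sgs\<bar> \<le> 2 * C / sqrt (real n)" if n: "n \<ge> 1" for n
  proof -
    obtain n' where n': "n = Suc n'" using n by (cases n) auto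
    have "T_partial n ks sgs - T_partial (n - 1) ks sgs
        = 2 * s ^ n / (2 * real n - real (Suc (length ks'))) ^ k' * T_partial (n - 1) ks' sgs'"
      unfolding snoc sgs T_partial_snoc[OF len'] by (simp add: n')
    also have "\<bar>\<dots>\<bar> \<le> 2 * C / sqrt (real n)"
      by (rule T_partial_term_bound[OF C]) (use n snoc sgs ks sg in \<open>auto simp: T_partial_eq_0\<close>)
    finally show ?thesis .
  qed
  then show ?thesis by blast
qed

lemma alternating_sum_by_parts:
  fixes d :: "nat \<Rightarrow> real"
  shows "2 * (\<Sum>n<N. (-1) ^ n * d n) =
    d 0 - (-1) ^ N * d N + (\<Sum>n<N. (-1) ^ n * (d n - d (Suc n)))"
  by (induction N) (auto simp: algebra_simps)

text \<open>Dedekind's variant of Dirichlet's test, for an alternating sum.\<close>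

lemma alternating_bounded_variation_convergent:
  fixes d :: "nat \<Rightarrow> real"
  assumes lim: "d \<longlonglongrightarrow> 0" and sm: "summable (\<lambda>n. \<bar>d (Suc n) - d n\<bar>)"
  shows "convergent (\<lambda>N. \<Sum>n<N. (-1) ^ n * d n)"
proof -
  have "summable (\<lambda>n. (-1) ^ n * (d n - d (Suc n)))"
    by (rule summable_rabs_cancel) (use sm in \<open>simp add: abs_mult power_abs abs_minus_commute\<close>)
  then have "(\<lambda>N. \<Sum>n<N. (-1) ^ n * (d n - d (Suc n))) \<longlonglongrightarrow> (\<Sum>n. (-1) ^ n * (d n - d (Suc n)))"
    by (rule summable_LIMSEQ)
  moreover have "(\<lambda>N. (-1) ^ N * d N) \<longlonglongrightarrow> 0"
    by (rule tendsto_rabs_zero_cancel) (use lim in \<open>simp add: abs_mult power_abs tendsto_rabs_zero_iff\<close>)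
  ultimately have "(\<lambda>N. (d 0 - (-1) ^ N * d N + (\<Sum>n<N. (-1) ^ n * (d n - d (Suc n)))) / 2)
      \<longlonglongrightarrow> (d 0 - 0 + (\<Sum>n. (-1) ^ n * (d n - d (Suc n)))) / 2"
    by (intro tendsto_intros) auto
  then show ?thesis
    unfolding alternating_sum_by_parts[symmetric] by (auto simp: convergent_def)
qed

text \<open>Bernoulli's inequality applied to \<open>(x / (x + 2))\<^sup>k\<close>.\<close>

lemma inverse_power_diff_bound:
  fixes x :: real
  assumes "x \<ge> 1" "k \<ge> 1"
  shows "\<bar>1 / (x + 2) ^ k - 1 / x ^ k\<bar> \<le> 2 * real k / x\<^sup>2"
proof -
  have "1 + real k * (- (2 / (x + 2))) \<le> (1 + (- (2 / (x + 2)))) ^ k"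
    by (rule Bernoulli_inequality) (use assms in \<open>simp add: field_simps\<close>)
  also have "1 + (- (2 / (x + 2))) = x / (x + 2)" using assms by (simp add: field_simps)
  finally have B: "1 - (x / (x + 2)) ^ k \<le> 2 * real k / (x + 2)" by simp
  have pos: "x / (x+2) \<le> 1" "x / (x+2) \<ge> 0" using assms by auto
  have "1 / x ^ k - 1 / (x + 2) ^ k = (1 - (x / (x + 2)) ^ k) / x ^ k"
    using assms by (simp add: power_divide field_simps)
  moreover have "(1 - (x / (x + 2)) ^ k) / x ^ k \<ge> 0"
    using assms pos by (simp add: power_le_one)
  moreover have "(1 - (x / (x + 2)) ^ k) / x ^ k \<le> (2 * real k / (x + 2)) / x ^ k"
    using assms B by (intro divide_right_mono) auto
  moreover have "(2 * real k / (x + 2)) / x ^ k \<le> (2 * real k / x) / x"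
  proof (rule frac_le)
    show "x \<le> x ^ k" using self_le_power[of x k] assms by simp
    show "2 * real k / (x + 2) \<le> 2 * real k / x"
      using assms by (intro divide_left_mono) auto
  qed (use assms in auto)
  ultimately show ?thesis by (simp add: power2_eq_square)
qed

lemma summable_inverse_three_halves: "summable (\<lambda>n. 1 / (real n * sqrt (real n)))"
proof -
  have "summable (\<lambda>n. real n powr (- (3/2)))"
    by (simp add: summable_real_powr_iff)
  moreover have "real n powr (- (3/2)) = 1 / (real n * sqrt (real n))" for n
  proof (cases "n = 0")
    case False
    have "real n powr (- (3/2)) = 1 / (real n powr (1 + 1/2))"
      by (simp add: powr_minus_divide)
    also have "real n powr (1 + 1/2) = real n * sqrt (real n)"
      unfolding powr_add using False by (simp add: powr_half_sqrt)
    finally show ?thesis .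
  qed simp
  ultimately show ?thesis by simp
qed

text \<open>The last sign being \<open>-1\<close>, the truncated sums are alternating sums of terms that tend to \<open>0\<close>
  and have increments \<open>O(n\<^sup>-\<^sup>3\<^sup>/\<^sup>2)\<close>, hence bounded variation.\<close>

lemma T_partial_convergent:
  assumes len: "length sgs = length ks" and ks: "\<forall>k\<in>set ks. 1 \<le> k" and sg: "\<forall>s\<in>set sgs. \<bar>s\<bar> = 1"
    and k: "1 \<le> k"
  shows "convergent (\<lambda>N. T_partial N (ks @ [k]) (sgs @ [-1]))"
proof -
  define r where "r = length ks"
  define T where "T n = T_partial n ks sgs" for n
  define d where "d n = 2 / (2 * real (Suc n) - real (Suc r)) ^ k * T n" for n
  obtain C where C: "\<And>n. \<bar>T n\<bar> \<le> C * sqrt (real n + 1)"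
    using T_partial_bound[OF len ks sg] by (auto simp: T_def)
  have C0: "C \<ge> 0" using C[of 0] by simp
  have T0: "T n = 0" if "n < r" for n using that by (simp add: T_def r_def T_partial_eq_0)
  obtain C' where C': "\<And>n. n \<ge> 1 \<Longrightarrow> \<bar>T n - T (n - 1)\<bar> \<le> C' / sqrt (real n)"
    using T_partial_increment_bound[OF len ks sg] by (auto simp: T_def)
  have C'0: "C' \<ge> 0" using C'[of 1] by simp
  have d0: "\<bar>d n\<bar> \<le> 2 * C / sqrt (real (Suc n))" for n
  proof -
    have "\<bar>2 * 1 ^ Suc n / (2 * real (Suc n) - real (Suc r)) ^ k * T (Suc n - 1)\<bar> \<le> 2 * C / sqrt (real (Suc n))"
      by (rule T_partial_term_bound[OF C T0]) (use k in auto)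
    then show ?thesis by (simp add: d_def)
  qed
  have "d \<longlonglongrightarrow> 0"
  proof (rule Lim_null_comparison)
    show "\<forall>\<^sub>F n in sequentially. norm (d n) \<le> 2 * C / sqrt (real (Suc n))"
      using d0 by simp
    show "(\<lambda>n. 2 * C / sqrt (real (Suc n))) \<longlonglongrightarrow> 0" by real_asymp
  qed
  moreover have "summable (\<lambda>n. \<bar>d (Suc n) - d n\<bar>)"
  proof (rule summable_comparison_test_ev)
    show "summable (\<lambda>n. (2 * C' + 8 * C * real k) * (1 / (real n * sqrt (real n))))"
      by (intro summable_mult summable_inverse_three_halves)
    show "\<forall>\<^sub>F n in sequentially. norm \<bar>d (Suc n) - d n\<bar> \<le> (2 * C' + 8 * C * real k) * (1 / (real n * sqrt (real n)))"
      using eventually_ge_at_top[of "Suc r"]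
    proof eventually_elim
      case (elim n)
      define x where "x = 2 * real (Suc n) - real (Suc r)"
      have x: "x \<ge> real n" "x \<ge> 1" and n: "real n \<ge> 1" using elim by (auto simp: x_def)
      have x2: "2 * real (Suc (Suc n)) - real (Suc r) = x + 2" by (simp add: x_def)
      have eq: "d (Suc n) - d n = 2 * ((T (Suc n) - T n) * (1 / (x + 2) ^ k)) + 2 * (T n * (1 / (x + 2) ^ k - 1 / x ^ k))"
        unfolding d_def x2 x_def[symmetric] by (simp add: algebra_simps diff_divide_distrib)
      have "real n \<le> (x + 2) ^ k"
        using self_le_power[of "x + 2" k] k x by simp
      then have xk: "\<bar>1 / (x + 2) ^ k\<bar> \<le> 1 / real n"
        using x n by (auto intro!: divide_left_mono mult_pos_pos)
      have "\<bar>T (Suc n) - T n\<bar> \<le> C' / sqrt (real (Suc n))" using C'[of "Suc n"] by simp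
      also have "\<dots> \<le> C' / sqrt (real n)" using n C'0 by (intro divide_left_mono) (auto intro!: mult_pos_pos)
      finally have t1: "\<bar>(T (Suc n) - T n) * (1 / (x + 2) ^ k)\<bar> \<le> C' / sqrt (real n) * (1 / real n)"
        unfolding abs_mult using xk C'0 by (intro mult_mono) auto
      have "\<bar>T n\<bar> \<le> C * sqrt (real n + 1)" by (rule C)
      also have "\<dots> \<le> C * (2 * sqrt (real n))"
      proof -
        have "sqrt (real n + 1) \<le> sqrt (4 * real n)" using n by (intro real_sqrt_le_mono) simp
        then show ?thesis using C0 by (simp add: real_sqrt_mult mult_left_mono)
      qed
      finally have t2: "\<bar>T n\<bar> \<le> C * (2 * sqrt (real n))" .
      have "\<bar>1 / (x + 2) ^ k - 1 / x ^ k\<bar> \<le> 2 * real k / x\<^sup>2"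
        using inverse_power_diff_bound x k by blast
      also have "\<dots> \<le> 2 * real k / (real n)\<^sup>2"
        using x n by (intro divide_left_mono power_mono) (auto intro!: mult_pos_pos)
      finally have t3: "\<bar>T n * (1 / (x + 2) ^ k - 1 / x ^ k)\<bar> \<le> C * (2 * sqrt (real n)) * (2 * real k / (real n)\<^sup>2)"
        unfolding abs_mult using t2 C0 by (intro mult_mono) auto
      have eq3: "C * (2 * sqrt (real n)) * (2 * real k / (real n)\<^sup>2) = 4 * C * real k * (1 / (real n * sqrt (real n)))"
      proof -
        define u where "u = sqrt (real n)"
        have u: "u > 0" "real n = u\<^sup>2" using n by (auto simp: u_def)
        show ?thesis unfolding u_def[symmetric] using u by (simp add: field_simps power2_eq_square)
      qed
      have "\<bar>d (Suc n) - d n\<bar> \<le> 2 * (C' / sqrt (real n) * (1 / real n)) + 2 * (4 * C * real k * (1 / (real n * sqrt (real n))))"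
        unfolding eq using t1 t3 unfolding eq3 by linarith
      also have "\<dots> = (2 * C' + 8 * C * real k) * (1 / (real n * sqrt (real n)))"
        using n by (simp add: field_simps)
      finally show ?case by simp
    qed
  qed
  ultimately have conv: "convergent (\<lambda>N. \<Sum>n<N. (-1) ^ n * d n)"
    by (rule alternating_bounded_variation_convergent)
  have "T_partial N (ks @ [k]) (sgs @ [-1]) = - (\<Sum>n<N. (-1) ^ n * d n)" for N
    unfolding T_partial_snoc[OF len] d_def T_def r_def
    unfolding One_nat_def sum.atLeast1_atMost_eq by (simp add: sum_negf[symmetric] mult_ac)
  then show ?thesis using convergent_minus_iff[THEN iffD1, OF conv] by simp
qed

section \<open>Nested sums as coefficients of power series\<close>

lemma summable_bounded_coeffs:
  fixes a :: "nat \<Rightarrow> real"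
  assumes "\<And>n. \<bar>a n\<bar> \<le> B" "\<bar>q\<bar> < 1"
  shows "summable (\<lambda>n. \<bar>a n * q ^ n\<bar>)"
proof (rule summable_comparison_test')
  show "summable (\<lambda>n. B * \<bar>q\<bar> ^ n)" using assms by (intro summable_mult summable_geometric) auto
  show "norm \<bar>a n * q ^ n\<bar> \<le> B * \<bar>q\<bar> ^ n" if "n \<ge> 0" for n
    using assms(1)[of n] by (simp add: abs_mult power_abs mult_right_mono)
qed

text \<open>Abel's limit theorem. With \<open>d n\<close> the error of the \<open>n\<close>-th partial sum, summation by parts gives
  \<open>\<Sum> a n q\<^sup>n - S = (1 - q) \<Sum> d n q\<^sup>n\<close>, which is a weighted average of errors whose weight moves to
  infinity as \<open>q\<close> tends to \<open>1\<close>.\<close>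

lemma Abel_limit:
  fixes a :: "nat \<Rightarrow> real"
  assumes a: "a sums S"
  shows "((\<lambda>q. \<Sum>n. a n * q ^ n) \<longlongrightarrow> S) (at_left 1)"
proof -
  define d where "d n = (\<Sum>k\<le>n. a k) - S" for n
  have d0: "d \<longlonglongrightarrow> 0"
    using a unfolding d_def sums_def' by (simp add: LIM_zero atLeast0AtMost)
  obtain B where B: "\<And>n. \<bar>d n\<bar> \<le> B"
    using d0 convergent_imp_Bseq[of d] by (auto simp: convergent_def Bseq_def)
  note sm = summable_bounded_coeffs[OF B]
  have eq: "(\<Sum>n. a n * q ^ n) - S = (1 - q) * (\<Sum>n. d n * q ^ n)" if q: "0 < q" "q < 1" for q
  proof -
    have 1: "(\<lambda>n. d n * q ^ n) sums (\<Sum>n. d n * q ^ n)" by (intro summable_sums summable_rabs_cancel[OF sm]) (use q in auto)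
    from sums_mult[OF this, of q]
    have "(\<lambda>n. d n * q ^ Suc n) sums (q * (\<Sum>n. d n * q ^ n))" by (simp add: mult_ac)
    then have 2: "(\<lambda>n. case n of 0 \<Rightarrow> 0 | Suc k \<Rightarrow> d k * q ^ n) sums (q * (\<Sum>n. d n * q ^ n))"
      using sums_Suc_iff[of "\<lambda>n. case n of 0 \<Rightarrow> 0 | Suc k \<Rightarrow> d k * q ^ n" "q * (\<Sum>n. d n * q ^ n)"] by simp
    have 3: "(\<lambda>n. if n = 0 then S else 0) sums S" using sums_single[of 0 "\<lambda>_. S"] by simp
    have "(\<lambda>n. d n * q ^ n - (case n of 0 \<Rightarrow> 0 | Suc k \<Rightarrow> d k * q ^ n) + (if n = 0 then S else 0)) sums
        ((\<Sum>n. d n * q ^ n) - q * (\<Sum>n. d n * q ^ n) + S)"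
      by (intro sums_add sums_diff 1 2 3)
    also have "(\<lambda>n. d n * q ^ n - (case n of 0 \<Rightarrow> 0 | Suc k \<Rightarrow> d k * q ^ n) + (if n = 0 then S else 0)) = (\<lambda>n. a n * q ^ n)"
      by (rule ext) (auto simp: d_def algebra_simps split: nat.split)
    finally show ?thesis by (simp add: sums_iff algebra_simps)
  qed
  have "((\<lambda>q. (1 - q) * (\<Sum>n. d n * q ^ n)) \<longlongrightarrow> 0) (at_left 1)"
  proof (rule tendstoI)
    fix e :: real assume e: "e > 0"
    obtain M where M: "\<And>n. n \<ge> M \<Longrightarrow> \<bar>d n\<bar> < e / 2"
      using d0 e unfolding lim_sequentially dist_real_def by (metis diff_zero half_gt_zero)
    define C where "C = (\<Sum>n<M. \<bar>d n\<bar>)"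
    have lim: "((\<lambda>q. (1 - q) * C) \<longlongrightarrow> (1 - 1) * C) (at_left (1::real))"
      by (intro tendsto_intros)
    then have "\<forall>\<^sub>F q in at_left 1. (1 - q) * C < e / 2"
      using e by (intro order_tendstoD(2)[OF lim]) auto
    moreover have "\<forall>\<^sub>F q in at_left (1::real). 0 < q \<and> q < 1"
      using eventually_at_left_real[of 0 "1::real"] by (auto elim: eventually_mono)
    ultimately show "\<forall>\<^sub>F q in at_left 1. dist ((1 - q) * (\<Sum>n. d n * q ^ n)) 0 < e"
    proof eventually_elim
      case (elim q)
      then have q: "0 < q" "q < 1" by auto
      have smq: "summable (\<lambda>n. \<bar>d n * q ^ n\<bar>)" by (rule sm) (use q in auto)
      have sg: "summable (\<lambda>n. e / 2 * q ^ n)" using q by (intro summable_mult summable_geometric) auto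
      have fin: "summable (\<lambda>n. if n < M then \<bar>d n\<bar> else 0)"
        by (rule summable_finite[of "{..<M}"]) auto
      have finC: "(\<Sum>n. if n < M then \<bar>d n\<bar> else 0) = C"
        unfolding C_def by (subst suminf_finite[of "{..<M}"]) auto
      have "\<bar>\<Sum>n. d n * q ^ n\<bar> \<le> (\<Sum>n. \<bar>d n * q ^ n\<bar>)" by (rule summable_rabs[OF smq])
      also have "\<dots> \<le> (\<Sum>n. (if n < M then \<bar>d n\<bar> else 0) + e / 2 * q ^ n)"
      proof (rule suminf_le[OF _ smq summable_add[OF fin sg]])
        fix n
        have "q ^ n \<le> 1" using q by (simp add: power_le_one)
        then show "\<bar>d n * q ^ n\<bar> \<le> (if n < M then \<bar>d n\<bar> else 0) + e / 2 * q ^ n"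
          using M[of n] q e
          by (auto simp: abs_mult intro!: mult_right_mono add_increasing2 mult_left_le)
      qed
      also have "\<dots> = C + e / 2 * (1 / (1 - q))"
      proof -
        have "(\<Sum>n. e / 2 * q ^ n) = e / 2 * (1 / (1 - q))"
          using q suminf_mult[of "\<lambda>n. q ^ n" "e / 2"] by (simp only: summable_geometric suminf_geometric real_norm_def abs_of_pos)
        then show ?thesis by (simp only: suminf_add[OF fin sg, symmetric] finC)
      qed
      finally have "(1 - q) * \<bar>\<Sum>n. d n * q ^ n\<bar> \<le> (1 - q) * (C + e / 2 * (1 / (1 - q)))"
        using q by (intro mult_left_mono) auto
      also have "\<dots> = (1 - q) * C + e / 2" using q by (simp add: field_simps)
      also have "\<dots> < e" using elim by simp
      finally show ?case using q by (simp add: abs_mult)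
    qed
  qed
  then have "((\<lambda>q. (\<Sum>n. a n * q ^ n) - S) \<longlongrightarrow> 0) (at_left 1)"
  proof (rule Lim_transform_eventually)
    show "\<forall>\<^sub>F q in at_left 1. (1 - q) * (\<Sum>n. d n * q ^ n) = (\<Sum>n. a n * q ^ n) - S"
      using eventually_at_left_real[of 0 "1::real"] by (rule eventually_mono) (auto simp: eq)
  qed
  then show ?thesis by (simp add: LIM_zero_iff)
qed

text \<open>The Taylor coefficients of \<open>2 q / (1 - q\<^sup>2)\<close> and of \<open>- 2 q / (1 + q\<^sup>2)\<close>: the generating functions of
  the odd gaps \<open>N = 2 k - 1\<close>, carrying the signs \<open>1\<close> and \<open>(-1)\<^sup>k\<close>.\<close>

definition gap_coeff :: "bool \<Rightarrow> nat \<Rightarrow> real" where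
  "gap_coeff b N = (if odd N then (if b then 2 else 2 * (-1) ^ (Suc N div 2)) else 0)"

text \<open>The value at \<open>(l, i, c, N)\<close> collects all sequences \<open>N\<^sub>1 < \<dots> < N\<^sub>i = N\<close> with odd gaps (starting from
  \<open>N\<^sub>0 = 0\<close>): each has the product of its gap coefficients, the first \<open>l\<close> of them unsigned, times the
  coefficient of \<open>x\<^sup>c\<close> in \<open>\<Prod> 1 / (N\<^sub>j - x)\<close>. The recursion multiplies this product by \<open>N\<^sub>i - x\<close>, so that in terms of
  power series it is a differential equation.\<close>

fun nest_coeff :: "nat \<Rightarrow> nat \<Rightarrow> nat \<Rightarrow> nat \<Rightarrow> real" where
  "nest_coeff l 0 c N = (if c = 0 \<and> N = 0 then 1 else 0)"
| "nest_coeff l (Suc i) c N = (if N = 0 then 0 else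
     ((if c = 0 then 0 else nest_coeff l (Suc i) (c - 1) N) + (\<Sum>M<N. gap_coeff (Suc i \<le> l) (N - M) * nest_coeff l i c M)) / real N)"

declare nest_coeff.simps(2) [simp del]

lemma nest_coeff_at_0: "nest_coeff l (Suc i) c 0 = 0"
  by (subst nest_coeff.simps(2)) simp

lemma abs_gap_coeff_le: "\<bar>gap_coeff b N\<bar> \<le> 2"
  by (simp add: gap_coeff_def abs_mult power_abs)

text \<open>Boundedness in \<open>N\<close> is what makes the power series converge in the unit disc; division by
  \<open>N\<close> compensates the \<open>N\<close> terms of the convolution.\<close>

lemma abs_nest_coeff_le: "\<bar>nest_coeff l i c N\<bar> \<le> 3 ^ (i + c)"
proof (induction l i c N rule: nest_coeff.induct)
  case (1 l c N)
  have "(1::real) \<le> 3 ^ c" by (rule one_le_power) simp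
  then show ?case by simp
next
  case (2 l i c N)
  show ?case
  proof (cases "N = 0")
    case False
    have "\<bar>if c = 0 then 0 else nest_coeff l (Suc i) (c - 1) N\<bar> \<le> 3 ^ (i + c)"
      using 2(1) False by (cases c) auto
    moreover have "\<bar>\<Sum>M<N. gap_coeff (Suc i \<le> l) (N - M) * nest_coeff l i c M\<bar> \<le> (\<Sum>M<N. 2 * 3 ^ (i + c))"
      using 2(2) False
      by (intro order_trans[OF sum_abs] sum_mono) (auto simp: abs_mult intro!: mult_mono abs_gap_coeff_le)
    ultimately have "\<bar>(if c = 0 then 0 else nest_coeff l (Suc i) (c - 1) N) + (\<Sum>M<N. gap_coeff (Suc i \<le> l) (N - M) * nest_coeff l i c M)\<bar>
        \<le> 3 ^ (i + c) * (1 + 2 * real N)"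
      by (simp add: algebra_simps)
    also have "\<dots> \<le> 3 ^ (i + c) * (3 * real N)"
      using False by (intro mult_left_mono) auto
    finally show ?thesis
      using False by (subst nest_coeff.simps(2)) (simp add: divide_le_eq mult_ac)
  qed (simp add: nest_coeff_at_0)
qed

lemma nest_coeff_closed:
  assumes "N > 0"
  shows "nest_coeff l (Suc i) c N = (\<Sum>j\<le>c. (\<Sum>M<N. gap_coeff (Suc i \<le> l) (N - M) * nest_coeff l i (c - j) M) / real N ^ Suc j)"
proof (induction c)
  case 0
  then show ?case using assms by (subst nest_coeff.simps(2)) simp
next
  case (Suc c)
  have "nest_coeff l (Suc i) (Suc c) N = (\<Sum>M<N. gap_coeff (Suc i \<le> l) (N - M) * nest_coeff l i (Suc c) M) / real N + nest_coeff l (Suc i) c N / real N"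
    using assms by (subst nest_coeff.simps(2)) (simp add: add_divide_distrib)
  then show ?case unfolding Suc.IH
    by (simp only: sum.atMost_Suc_shift) (simp add: sum_divide_distrib mult_ac)
qed

lemma nest_coeff_eq_0: "N < i \<or> odd (N - i) \<Longrightarrow> nest_coeff l i c N = 0"
proof (induction i arbitrary: c N)
  case (Suc i)
  have *: "gap_coeff (Suc i \<le> l) (N - M) * nest_coeff l i c M = 0" if "M < N" for M c
  proof (cases "M < i \<or> odd (M - i)")
    case False
    then have "i \<le> M" "even (M - i)" by auto
    with that Suc.prems have "even (N - M)" by presburger
    then show ?thesis by (simp add: gap_coeff_def)
  qed (simp add: Suc.IH)
  show ?case
  proof (cases "N = 0")
    case False
    have "(\<Sum>M<N. gap_coeff (Suc i \<le> l) (N - M) * nest_coeff l i (c - j) M) = 0" for j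
      by (rule sum.neutral) (use * in auto)
    then show ?thesis using False by (simp add: nest_coeff_closed)
  qed (simp add: nest_coeff_at_0)
qed auto

text \<open>Signs \<open>\<sigma>\<^sub>j\<close> attached to the \<open>n\<^sub>j\<close> become signs \<open>\<tau>\<^sub>j = \<sigma>\<^sub>j \<sigma>\<^sub>j\<^sub>+\<^sub>1 \<dots>\<close> attached to the gaps
  \<open>n\<^sub>j - n\<^sub>j\<^sub>-\<^sub>1\<close>; conversely \<open>\<sigma>\<^sub>j = \<tau>\<^sub>j \<tau>\<^sub>j\<^sub>+\<^sub>1\<close>.\<close>

definition gap_signs :: "(nat \<Rightarrow> real) \<Rightarrow> nat \<Rightarrow> real list" where
  "gap_signs \<tau> i = map (\<lambda>j. \<tau> j * \<tau> (Suc j)) [1..<i + 1]"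

definition comp_sum :: "(nat \<Rightarrow> real) \<Rightarrow> nat \<Rightarrow> nat \<Rightarrow> nat \<Rightarrow> real" where
  "comp_sum \<tau> i c N = (\<Sum>ks\<in>compositions (c + i) i. T_partial N ks (gap_signs \<tau> i))"

lemma finite_compositions: "finite (compositions k r)"
proof (rule finite_subset)
  show "compositions k r \<subseteq> {ks. set ks \<subseteq> {..k} \<and> length ks = r}"
    using member_le_sum_list by (fastforce simp: compositions_def)
  show "finite {ks. set ks \<subseteq> {..k} \<and> length ks = r}"
    by (rule finite_lists_length_eq) simp
qed

lemma length_le_sum_list: "\<forall>x\<in>set ks. Suc 0 \<le> x \<Longrightarrow> length ks \<le> sum_list ks"
  by (induction ks) auto

lemma compositions_Suc:
  "compositions (c + Suc i) (Suc i) =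
     (\<lambda>(j, ks). ks @ [Suc j]) ` (SIGMA j:{..c}. compositions (c - j + i) i)"
proof
  show "compositions (c + Suc i) (Suc i) \<subseteq>
     (\<lambda>(j, ks). ks @ [Suc j]) ` (SIGMA j:{..c}. compositions (c - j + i) i)"
  proof
    fix xs assume xs: "xs \<in> compositions (c + Suc i) (Suc i)"
    then have "xs \<noteq> []" by (auto simp: compositions_def)
    then obtain ks k where eq: "xs = ks @ [k]" by (metis rev_exhaust)
    then obtain j where j: "k = Suc j" using xs by (cases k) (auto simp: compositions_def)
    have *: "length ks = i" "sum_list ks + j = c + i" "\<forall>x\<in>set ks. Suc 0 \<le> x"
      using xs unfolding eq j by (auto simp: compositions_def)
    then have "j \<le> c" using length_le_sum_list[of ks] by simp
    moreover have "ks \<in> compositions (c - j + i) i"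
      using * \<open>j \<le> c\<close> by (auto simp: compositions_def)
    ultimately show "xs \<in> (\<lambda>(j, ks). ks @ [Suc j]) ` (SIGMA j:{..c}. compositions (c - j + i) i)"
      unfolding eq j by force
  qed
  show "(\<lambda>(j, ks). ks @ [Suc j]) ` (SIGMA j:{..c}. compositions (c - j + i) i) \<subseteq> compositions (c + Suc i) (Suc i)"
    by (auto simp: compositions_def)
qed

lemma length_gap_signs [simp]: "length (gap_signs \<tau> i) = i"
  by (simp add: gap_signs_def)

lemma gap_signs_Suc: "gap_signs \<tau> (Suc i) = gap_signs \<tau> i @ [\<tau> (Suc i) * \<tau> (Suc (Suc i))]"
  by (simp add: gap_signs_def)

lemma comp_sum_0: "comp_sum \<tau> 0 c N = (if c = 0 then 1 else 0)"
proof -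
  have "compositions c 0 = (if c = 0 then {[]} else {})"
    by (auto simp: compositions_def)
  then show ?thesis by (simp add: comp_sum_def gap_signs_def T_partial_Nil)
qed

lemma comp_sum_Suc:
  "comp_sum \<tau> (Suc i) c N = (\<Sum>n = 1..N. 2 * (\<tau> (Suc i) * \<tau> (Suc (Suc i))) ^ n *
     (\<Sum>j\<le>c. comp_sum \<tau> i (c - j) (n - 1) / (2 * real n - real (Suc i)) ^ Suc j))"
proof -
  have inj: "inj_on (\<lambda>(j, ks). ks @ [Suc j]) (SIGMA j:{..c}. compositions (c - j + i) i)"
    by (auto simp: inj_on_def)
  have "comp_sum \<tau> (Suc i) c N = (\<Sum>(j, ks)\<in>(SIGMA j:{..c}. compositions (c - j + i) i).
      T_partial N (ks @ [Suc j]) (gap_signs \<tau> (Suc i)))"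
    unfolding comp_sum_def compositions_Suc by (subst sum.reindex[OF inj]) (auto simp: o_def case_prod_unfold)
  also have "\<dots> = (\<Sum>j\<le>c. \<Sum>ks\<in>compositions (c - j + i) i. T_partial N (ks @ [Suc j]) (gap_signs \<tau> (Suc i)))"
    by (rule sum.Sigma[symmetric]) (auto simp: finite_compositions)
  also have "\<dots> = (\<Sum>j\<le>c. \<Sum>ks\<in>compositions (c - j + i) i. \<Sum>n = 1..N.
      2 * (\<tau> (Suc i) * \<tau> (Suc (Suc i))) ^ n / (2 * real n - real (Suc i)) ^ Suc j * T_partial (n - 1) ks (gap_signs \<tau> i))"
    unfolding gap_signs_Suc
    by (intro sum.cong refl, subst T_partial_snoc) (auto simp: compositions_def)
  also have "\<dots> = (\<Sum>j\<le>c. \<Sum>n = 1..N. 2 * (\<tau> (Suc i) * \<tau> (Suc (Suc i))) ^ n / (2 * real n - real (Suc i)) ^ Suc j * comp_sum \<tau> i (c - j) (n - 1))"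
    unfolding comp_sum_def sum_distrib_left by (intro sum.cong refl sum.swap)
  also have "\<dots> = (\<Sum>n = 1..N. \<Sum>j\<le>c. 2 * (\<tau> (Suc i) * \<tau> (Suc (Suc i))) ^ n / (2 * real n - real (Suc i)) ^ Suc j * comp_sum \<tau> i (c - j) (n - 1))"
    by (rule sum.swap)
  finally show ?thesis by (simp add: sum_distrib_left mult_ac)
qed

lemma comp_sum_eq_0: "N < i \<Longrightarrow> comp_sum \<tau> i c N = 0"
  unfolding comp_sum_def by (rule sum.neutral) (auto simp: compositions_def T_partial_eq_0)

text \<open>Because \<open>\<sigma>\<^sub>1, \<dots>, \<sigma>\<^sub>i\<close> involve \<open>\<tau>\<^sub>i\<^sub>+\<^sub>1\<close>, a prefix of the index list differs from the product of its
  gap signs by the factor \<open>\<tau>\<^sub>i\<^sub>+\<^sub>1\<close> to the power \<open>n\<^sub>i\<close>. The gap signs are \<open>1\<close> up to position \<open>l\<close> and \<open>-1\<close> after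
  it.\<close>

lemma comp_sum_eq_sum_nest_coeff:
  assumes \<tau>: "\<And>i. \<tau> (Suc i) = (if Suc i \<le> l then 1 else - 1) \<or> Suc i > r" and "i \<le> r"
  shows "comp_sum \<tau> i c N = (\<Sum>n\<le>N. \<tau> (Suc i) ^ n * nest_coeff l i c (2 * n - i))"
  using \<open>i \<le> r\<close>
proof (induction i arbitrary: c N)
  case 0
  have "(\<Sum>n\<le>N. \<tau> (Suc 0) ^ n * nest_coeff l 0 c (2 * n - 0)) = (\<Sum>n\<in>{0}. \<tau> (Suc 0) ^ n * nest_coeff l 0 c (2 * n - 0))"
    by (rule sum.mono_neutral_right) auto
  then show ?case by (simp add: comp_sum_0)
next
  case (Suc i)
  define t where "t = \<tau> (Suc i)"
  define u where "u = \<tau> (Suc (Suc i))"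
  have t: "t = (if Suc i \<le> l then 1 else -1)" using \<tau>[of i] Suc.prems by (auto simp: t_def)
  have kapt: "gap_coeff (Suc i \<le> l) (2 * m - 1) = 2 * t ^ m" if "m > 0" for m
    using that by (auto simp: gap_coeff_def t)
  have tt: "t ^ n * t ^ k = t ^ (n - k)" if "k \<le> n" for k n :: nat
  proof -
    have "t ^ n = t ^ (n - k) * t ^ k" using that by (simp flip: power_add)
    moreover have "t ^ k * t ^ k = 1" by (auto simp: t simp flip: power_mult_distrib)
    ultimately show ?thesis by (simp add: mult.assoc)
  qed
  \<comment> \<open>the substitution \<open>M = 2 k - i\<close> reaches every index at which the inner coefficient is nonzero\<close>
  have D: "(\<Sum>M<2 * n - Suc i. gap_coeff (Suc i \<le> l) (2 * n - Suc i - M) * nest_coeff l i c M) = 2 * t ^ n * comp_sum \<tau> i c (n - 1)"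
    if n: "n \<ge> Suc i" for n c
  proof -
    have "(\<Sum>M<2 * n - Suc i. gap_coeff (Suc i \<le> l) (2 * n - Suc i - M) * nest_coeff l i c M) =
        (\<Sum>M\<in>(\<lambda>k. 2 * k - i) ` {i..<n}. gap_coeff (Suc i \<le> l) (2 * n - Suc i - M) * nest_coeff l i c M)"
    proof (rule sum.mono_neutral_right)
      show "\<forall>M\<in>{..<2 * n - Suc i} - (\<lambda>k. 2 * k - i) ` {i..<n}. gap_coeff (Suc i \<le> l) (2 * n - Suc i - M) * nest_coeff l i c M = 0"
      proof
        fix M assume M: "M \<in> {..<2 * n - Suc i} - (\<lambda>k. 2 * k - i) ` {i..<n}"
        have "M < i \<or> odd (M - i)"
        proof (rule ccontr)
          assume "\<not> ?thesis"
          then have *: "i \<le> M" "even (M - i)" by auto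
          then obtain z where z: "M - i = 2 * z" by (elim evenE)
          with * M have "M = 2 * (z + i) - i" "z + i \<in> {i..<n}" by auto
          with M show False by blast
        qed
        then show "gap_coeff (Suc i \<le> l) (2 * n - Suc i - M) * nest_coeff l i c M = 0"
          by (simp add: nest_coeff_eq_0)
      qed
    qed auto
    also have "\<dots> = (\<Sum>k\<in>{i..<n}. gap_coeff (Suc i \<le> l) (2 * (n - k) - 1) * nest_coeff l i c (2 * k - i))"
      by (subst sum.reindex) (auto simp: inj_on_def diff_mult_distrib2 intro!: sum.cong arg_cong2[of _ _ _ _ "(*)"] arg_cong2[of _ _ _ _ gap_coeff])
    also have "\<dots> = (\<Sum>k\<in>{i..<n}. 2 * t ^ n * (t ^ k * nest_coeff l i c (2 * k - i)))"
    proof (rule sum.cong)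
      fix k assume k: "k \<in> {i..<n}"
      then show "gap_coeff (Suc i \<le> l) (2 * (n - k) - 1) * nest_coeff l i c (2 * k - i) = 2 * t ^ n * (t ^ k * nest_coeff l i c (2 * k - i))"
        using tt[of k n] by (subst kapt) (auto simp: mult.assoc)
    qed simp
    also have "\<dots> = 2 * t ^ n * (\<Sum>k\<in>{i..<n}. t ^ k * nest_coeff l i c (2 * k - i))"
      by (simp add: sum_distrib_left)
    also have "(\<Sum>k\<in>{i..<n}. t ^ k * nest_coeff l i c (2 * k - i)) = (\<Sum>k\<le>n - 1. t ^ k * nest_coeff l i c (2 * k - i))"
      by (rule sum.mono_neutral_left) (use n in \<open>auto simp: nest_coeff_eq_0\<close>)
    also have "\<dots> = comp_sum \<tau> i c (n - 1)" using Suc by (simp add: t_def)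
    finally show ?thesis .
  qed
  have key: "2 * (t * u) ^ n * (\<Sum>j\<le>c. comp_sum \<tau> i (c - j) (n - 1) / (2 * real n - real (Suc i)) ^ Suc j) =
      u ^ n * nest_coeff l (Suc i) c (2 * n - Suc i)" if "n \<ge> 1" for n
  proof (cases "n \<ge> Suc i")
    case True
    then have x: "2 * n - Suc i > 0" "real (2 * n - Suc i) = 2 * real n - real (Suc i)"
      by auto
    show ?thesis
      unfolding nest_coeff_closed[OF x(1)] D[OF True] x(2)
      by (simp add: sum_distrib_left power_mult_distrib mult_ac)
  next
    case False
    then show ?thesis
      using that nest_coeff_eq_0[of "2 * n - Suc i" "Suc i"] by (simp add: comp_sum_eq_0)
  qed
  have "comp_sum \<tau> (Suc i) c N = (\<Sum>n = 1..N. u ^ n * nest_coeff l (Suc i) c (2 * n - Suc i))"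
    unfolding comp_sum_Suc by (rule sum.cong) (use key in \<open>auto simp: t_def u_def\<close>)
  also have "\<dots> = (\<Sum>n\<le>N. u ^ n * nest_coeff l (Suc i) c (2 * n - Suc i))"
    by (rule sum.mono_neutral_left) (auto simp: nest_coeff_at_0 Suc_le_eq)
  finally show ?case by (simp add: u_def)
qed

text \<open>Bars at positions \<open>l\<close> and \<open>r\<close> are the two places where the gap signs change: from \<open>1\<close> to
  \<open>-1\<close> after \<open>l\<close>, and back to \<open>1\<close> after \<open>r\<close>. For \<open>l = 0\<close> only the second change is visible.\<close>

lemma W_eq_sum_nest_coeff:
  assumes "l < r"
  shows "nest_coeff l r c sums W l (c + r) r"
proof -
  define \<tau> :: "nat \<Rightarrow> real" where "\<tau> i = (if i \<le> l then 1 else if i \<le> r then -1 else 1)" for i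
  obtain r' where r': "r = Suc r'" using assms by (cases r) auto
  have bar: "bar_signs l r = gap_signs \<tau> r"
    unfolding bar_signs_def gap_signs_def \<tau>_def using assms by (auto intro!: map_cong)
  have last: "\<tau> r * \<tau> (Suc r) = - 1" using assms by (simp add: \<tau>_def)
  have conv: "(\<lambda>N. T_partial N ks (bar_signs l r)) \<longlonglongrightarrow> T_val ks (bar_signs l r)"
    if "ks \<in> compositions (c + r) r" for ks
  proof -
    have "ks \<noteq> []" using that r' by (auto simp: compositions_def)
    then obtain ks' k where ks: "ks = ks' @ [k]" by (metis rev_exhaust)
    have "convergent (\<lambda>N. T_partial N (ks' @ [k]) (gap_signs \<tau> r' @ [- 1]))"
      by (rule T_partial_convergent) (use that ks r' in \<open>auto simp: compositions_def gap_signs_def \<tau>_def\<close>)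
    then show ?thesis
      unfolding T_val_def bar unfolding ks r' gap_signs_Suc last[unfolded r'] by (simp add: convergent_LIMSEQ_iff)
  qed
  have "(\<lambda>N. comp_sum \<tau> r c N) \<longlonglongrightarrow> W l (c + r) r"
    unfolding comp_sum_def W_def bar[symmetric] by (intro tendsto_sum conv)
  then have "(\<lambda>n. comp_sum \<tau> r c (n + r)) \<longlonglongrightarrow> W l (c + r) r"
    by (rule LIMSEQ_ignore_initial_segment)
  moreover have "comp_sum \<tau> r c (n + r) = (\<Sum>k\<le>n. nest_coeff l r c (r + 2 * k))" for n
  proof -
    have "comp_sum \<tau> r c (n + r) = (\<Sum>k\<le>n + r. \<tau> (Suc r) ^ k * nest_coeff l r c (2 * k - r))"
      by (rule comp_sum_eq_sum_nest_coeff[of _ _ r]) (auto simp: \<tau>_def)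
    also have "\<dots> = (\<Sum>k\<in>{0 + r..n + r}. nest_coeff l r c (2 * k - r))"
      by (rule sum.mono_neutral_cong_right) (use assms in \<open>auto simp: nest_coeff_eq_0 \<tau>_def\<close>)
    also have "\<dots> = (\<Sum>k\<in>{0..n}. nest_coeff l r c (r + 2 * k))"
      by (subst sum.shift_bounds_cl_nat_ivl) (simp add: algebra_simps)
    finally show ?thesis by (simp add: atLeast0AtMost)
  qed
  ultimately have "(\<lambda>k. nest_coeff l r c (r + 2 * k)) sums W l (c + r) r"
    by (simp add: sums_def_le)
  then show ?thesis
  proof (subst (asm) sums_mono_reindex)
    show "nest_coeff l r c n = 0" if "n \<notin> range (\<lambda>k. r + 2 * k)" for n
    proof -
      have "n < r \<or> odd (n - r)"
      proof (rule ccontr)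
        assume "\<not> ?thesis"
        then have "r \<le> n" "even (n - r)" by auto
        then obtain k where "n - r = 2 * k" by (elim evenE)
        then have "n = r + 2 * k" using \<open>r \<le> n\<close> by simp
        with that show False by blast
      qed
      then show ?thesis by (rule nest_coeff_eq_0)
    qed
  qed (auto simp: strict_mono_def)
qed

section \<open>Iterated primitives on the negative half-line\<close>

definition nest_series :: "nat \<Rightarrow> nat \<Rightarrow> nat \<Rightarrow> real \<Rightarrow> real" where
  "nest_series l i c q = (\<Sum>N. nest_coeff l i c N * q ^ N)"

text \<open>The coefficient of \<open>x\<^sup>c\<close> in \<open>exp (- x w) \<Sum> N. e(x, N) exp (N w)\<close>, where \<open>e(x, N)\<close> is the generating
  function of \<open>nest_coeff\<close> in its weight argument. The factor \<open>exp (- x w)\<close> turns the differential equation of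
  the series into a pure integration.\<close>

definition iter_prim :: "nat \<Rightarrow> nat \<Rightarrow> nat \<Rightarrow> real \<Rightarrow> real" where
  "iter_prim l i c w = (\<Sum>j\<le>c. (- w) ^ j / fact j * nest_series l i (c - j) (exp w))"

definition gap_kernel :: "bool \<Rightarrow> real \<Rightarrow> real" where
  "gap_kernel b w = (if b then - 1 / sinh w else - 1 / cosh w)"

text \<open>Only odd indices contribute, which leaves a geometric series in \<open>\<plusminus> q\<^sup>2\<close>.\<close>

lemma gap_coeff_sums:
  assumes "\<bar>q\<bar> < 1"
  shows "(\<lambda>N. gap_coeff b N * q ^ N) sums (if b then 2 * q / (1 - q\<^sup>2) else - 2 * q / (1 + q\<^sup>2))"
proof -
  define s :: real where "s = (if b then 1 else - 1)"
  have sq: "\<bar>s * q\<^sup>2\<bar> < 1"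
    using assms by (auto simp: s_def abs_mult power2_eq_square abs_square_less_1[unfolded power2_eq_square])
  have "(\<lambda>k. 2 * s * q * (s * q\<^sup>2) ^ k) sums (2 * s * q * (1 / (1 - s * q\<^sup>2)))"
    using sq by (intro sums_mult geometric_sums) auto
  also have "(\<lambda>k. 2 * s * q * (s * q\<^sup>2) ^ k) = (\<lambda>k. gap_coeff b (2 * k + 1) * q ^ (2 * k + 1))"
  proof
    fix k
    have "gap_coeff b (2 * k + 1) = 2 * s ^ Suc k" by (simp add: gap_coeff_def s_def)
    then show "2 * s * q * (s * q\<^sup>2) ^ k = gap_coeff b (2 * k + 1) * q ^ (2 * k + 1)"
      by (simp add: power_mult_distrib power_mult)
  qed
  finally have "(\<lambda>N. gap_coeff b N * q ^ N) sums (2 * s * q * (1 / (1 - s * q\<^sup>2)))"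
  proof (subst (asm) sums_mono_reindex)
    show "gap_coeff b n * q ^ n = 0" if "n \<notin> range (\<lambda>k. 2 * k + 1)" for n
      using that by (auto simp: gap_coeff_def elim!: oddE)
  qed (auto simp: strict_mono_def)
  then show ?thesis by (cases b) (simp_all add: s_def)
qed

text \<open>Multiplying the \<open>N\<close>-th coefficient by \<open>N\<close> is \<open>q d/dq\<close>, and the convolution in the recursion is a
  Cauchy product with the gap series.\<close>

lemma nest_series_has_derivative:
  assumes q: "\<bar>q\<bar> < 1" "q \<noteq> 0"
  shows "(nest_series l (Suc i) c has_real_derivative
    ((if c = 0 then 0 else nest_series l (Suc i) (c - 1) q) + (if Suc i \<le> l then 2 * q / (1 - q\<^sup>2) else - 2 * q / (1 + q\<^sup>2)) * nest_series l i c q) / q) (at q)"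
proof -
  define b where "b = (Suc i \<le> l)"
  define K where "K = (if b then 2 * q / (1 - q\<^sup>2) else - 2 * q / (1 + q\<^sup>2))"
  have sm: "summable (\<lambda>n. \<bar>nest_coeff l i c n * q ^ n\<bar>)" for l i c
    by (rule summable_bounded_coeffs[OF abs_nest_coeff_le q(1)])
  have sm': "summable (\<lambda>n. nest_coeff l i c n * q ^ n)" for l i c
    by (rule summable_rabs_cancel[OF sm])
  define x where "x = (1 + \<bar>q\<bar>) / 2"
  have x: "\<bar>q\<bar> < x" "\<bar>x\<bar> < 1" using q by (auto simp: x_def)
  have smx: "summable (\<lambda>n. nest_coeff l (Suc i) c n * x ^ n)"
    by (rule summable_rabs_cancel[OF summable_bounded_coeffs[OF abs_nest_coeff_le x(2)]])
  have D: "(nest_series l (Suc i) c has_real_derivative (\<Sum>n. diffs (nest_coeff l (Suc i) c) n * q ^ n)) (at q)"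
    unfolding nest_series_def by (rule termdiffs_strong[OF smx]) (use x in auto)
  have "(\<lambda>n. diffs (nest_coeff l (Suc i) c) n * q ^ n) sums (\<Sum>n. diffs (nest_coeff l (Suc i) c) n * q ^ n)"
    by (rule summable_sums, rule termdiff_converges[of q 1])
      (use q in \<open>auto intro!: summable_rabs_cancel[OF summable_bounded_coeffs[OF abs_nest_coeff_le]]\<close>)
  from sums_mult[OF this, of q]
  have "(\<lambda>n. real (Suc n) * nest_coeff l (Suc i) c (Suc n) * q ^ Suc n) sums (q * (\<Sum>n. diffs (nest_coeff l (Suc i) c) n * q ^ n))"
    by (simp add: diffs_def mult_ac)
  then have s1: "(\<lambda>n. real n * nest_coeff l (Suc i) c n * q ^ n) sums (q * (\<Sum>n. diffs (nest_coeff l (Suc i) c) n * q ^ n))"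
    by (subst (asm) sums_Suc_iff) simp
  have kabs: "summable (\<lambda>N. norm (gap_coeff b N * q ^ N))"
    unfolding real_norm_def by (rule summable_bounded_coeffs[OF abs_gap_coeff_le q(1)])
  have "(\<lambda>N. \<Sum>M\<le>N. (nest_coeff l i c M * q ^ M) * (gap_coeff b (N - M) * q ^ (N - M))) sums
      ((\<Sum>N. nest_coeff l i c N * q ^ N) * (\<Sum>N. gap_coeff b N * q ^ N))"
    by (rule Cauchy_product_sums) (use sm kabs in auto)
  also have "(\<Sum>N. gap_coeff b N * q ^ N) = K"
    unfolding K_def by (rule sums_unique[symmetric], rule gap_coeff_sums[OF q(1)])
  also have "(\<lambda>N. \<Sum>M\<le>N. (nest_coeff l i c M * q ^ M) * (gap_coeff b (N - M) * q ^ (N - M))) =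
      (\<lambda>N. (\<Sum>M<N. gap_coeff b (N - M) * nest_coeff l i c M) * q ^ N)"
  proof
    fix N
    have "(\<Sum>M\<le>N. (nest_coeff l i c M * q ^ M) * (gap_coeff b (N - M) * q ^ (N - M))) =
        (\<Sum>M\<le>N. gap_coeff b (N - M) * nest_coeff l i c M * q ^ N)"
      by (rule sum.cong) (auto simp: mult_ac simp flip: power_add)
    also have "\<dots> = (\<Sum>M<N. gap_coeff b (N - M) * nest_coeff l i c M * q ^ N)"
      by (simp add: lessThan_Suc_atMost[symmetric] gap_coeff_def)
    finally show "(\<Sum>M\<le>N. (nest_coeff l i c M * q ^ M) * (gap_coeff b (N - M) * q ^ (N - M))) =
        (\<Sum>M<N. gap_coeff b (N - M) * nest_coeff l i c M) * q ^ N"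
      by (simp add: sum_distrib_right)
  qed
  finally have s2: "(\<lambda>N. (\<Sum>M<N. gap_coeff b (N - M) * nest_coeff l i c M) * q ^ N) sums (nest_series l i c q * K)"
    by (simp add: nest_series_def)
  have s3: "(\<lambda>N. (if c = 0 then 0 else nest_coeff l (Suc i) (c - 1) N * q ^ N)) sums (if c = 0 then 0 else nest_series l (Suc i) (c - 1) q)"
    unfolding nest_series_def by (cases "c = 0") (auto intro!: summable_sums sm')
  have "real n * nest_coeff l (Suc i) c n =
      (if c = 0 then 0 else nest_coeff l (Suc i) (c - 1) n) + (\<Sum>M<n. gap_coeff b (n - M) * nest_coeff l i c M)" for n
    by (cases "n = 0") (simp_all add: nest_coeff_at_0 nest_coeff.simps(2)[of l i c n] b_def)
  then have "real n * nest_coeff l (Suc i) c n * q ^ n =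
      (if c = 0 then 0 else nest_coeff l (Suc i) (c - 1) n * q ^ n) + (\<Sum>M<n. gap_coeff b (n - M) * nest_coeff l i c M) * q ^ n" for n
    by (simp add: distrib_right)
  then have "q * (\<Sum>n. diffs (nest_coeff l (Suc i) c) n * q ^ n) = (if c = 0 then 0 else nest_series l (Suc i) (c - 1) q) + nest_series l i c q * K"
    using sums_unique2[OF s1] sums_add[OF s3 s2] by simp
  then have "(\<Sum>n. diffs (nest_coeff l (Suc i) c) n * q ^ n) = ((if c = 0 then 0 else nest_series l (Suc i) (c - 1) q) + K * nest_series l i c q) / q"
    using q by (simp add: field_simps)
  with D show ?thesis by (simp add: K_def b_def)
qed

lemma gap_kernel_exp:
  assumes "w < 0"
  shows "(if b then 2 * exp w / (1 - (exp w)\<^sup>2) else - 2 * exp w / (1 + (exp w)\<^sup>2)) = gap_kernel b w"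
proof -
  have "(exp w)\<^sup>2 < 1\<^sup>2" using assms by (intro power_strict_mono) auto
  then have "1 - (exp w)\<^sup>2 \<noteq> 0" "1 + (exp w)\<^sup>2 \<noteq> 0"
    by (auto simp: add_nonneg_eq_0_iff)
  moreover have "sinh w \<noteq> 0" "cosh w \<noteq> 0" using assms by auto
  moreover have "2 * exp w * sinh w = (exp w)\<^sup>2 - 1" "2 * exp w * cosh w = (exp w)\<^sup>2 + 1"
    by (simp_all add: sinh_def cosh_def algebra_simps power2_eq_square flip: exp_add)
  ultimately show ?thesis by (auto simp: gap_kernel_def field_simps)
qed

lemma iter_prim_0: "iter_prim l 0 c w = (- w) ^ c / fact c"
proof -
  have E: "nest_series l 0 c q = (if c = 0 then 1 else 0)" for c q
  proof -
    have "(\<lambda>N. nest_coeff l 0 c N * q ^ N) = (\<lambda>N. if N = 0 then if c = 0 then 1 else 0 else 0)"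
      by (rule ext) auto
    then show ?thesis unfolding nest_series_def by (simp only: suminf_eq_zero_iff) (subst suminf_finite[of "{0}"], auto)
  qed
  have "iter_prim l 0 c w = (\<Sum>j\<in>{c}. (- w) ^ j / fact j * nest_series l 0 (c - j) (exp w))"
    unfolding iter_prim_def by (rule sum.mono_neutral_right) (auto simp: E)
  then show ?thesis by (simp add: E)
qed

lemma neg_power_fact_has_derivative:
  assumes "(f has_real_derivative D) (at x)"
  shows "((\<lambda>x. (- f x) ^ j / fact j) has_real_derivative
    (if j = 0 then 0 else - D * ((- f x) ^ (j - 1) / fact (j - 1)))) (at x)"
proof (cases j)
  case (Suc i)
  have "((\<lambda>x. (- f x) ^ Suc i / fact (Suc i)) has_real_derivative real (Suc i) * (- D * (- f x) ^ i) / fact (Suc i)) (at x)"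
    by (rule DERIV_cdivide, rule DERIV_cong[OF DERIV_power_Suc[OF DERIV_minus[OF assms]]]) simp
  moreover have "real (Suc i) * (- D * (- f x) ^ i) / fact (Suc i) = - D * ((- f x) ^ i / fact i)"
    by (simp add: fact_Suc field_simps del: of_nat_Suc)
  ultimately show ?thesis using Suc by simp
qed simp

text \<open>The terms from differentiating the powers of \<open>w\<close> telescope against the terms of lower weight
  in the derivative of the series.\<close>

lemma iter_prim_has_derivative:
  assumes w: "w < 0"
  shows "(iter_prim l (Suc i) c has_real_derivative gap_kernel (Suc i \<le> l) w * iter_prim l i c w) (at w)"
proof -
  define F where "F c = nest_series l (Suc i) c (exp w)" for c
  define H where "H c = nest_series l i c (exp w)" for c
  define K where "K = gap_kernel (Suc i \<le> l) w"
  have dE: "((\<lambda>w. nest_series l (Suc i) c (exp w)) has_real_derivative ((if c = 0 then 0 else F (c - 1)) + K * H c)) (at w)" for c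
  proof -
    have "(nest_series l (Suc i) c has_real_derivative ((if c = 0 then 0 else F (c - 1)) + K * H c) / exp w) (at (exp w))"
      using nest_series_has_derivative[of "exp w" l i c] w unfolding gap_kernel_exp[OF w] F_def H_def K_def by simp
    from DERIV_chain2[OF this DERIV_exp] show ?thesis by simp
  qed
  define a where "a j = (- w) ^ j / fact j" for j
  have da: "((\<lambda>w. (- w) ^ j / fact j) has_real_derivative (if j = 0 then 0 else - a (j - 1))) (at w)" for j
    unfolding a_def by (rule DERIV_cong[OF neg_power_fact_has_derivative[OF DERIV_ident]]) simp
  have "(iter_prim l (Suc i) c has_real_derivative (\<Sum>j\<le>c. (if j = 0 then 0 else - a (j - 1)) * F (c - j) +
       ((if c - j = 0 then 0 else F (c - j - 1)) + K * H (c - j)) * a j)) (at w)"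
    unfolding iter_prim_def F_def[symmetric] a_def
    by (rule DERIV_sum, rule DERIV_cong[OF DERIV_mult[OF da dE]]) (simp add: F_def a_def)
  also have "(\<Sum>j\<le>c. (if j = 0 then 0 else - a (j - 1)) * F (c - j) +
       ((if c - j = 0 then 0 else F (c - j - 1)) + K * H (c - j)) * a j) =
     (\<Sum>j\<le>c. (if j = 0 then 0 else - a (j - 1)) * F (c - j)) + (\<Sum>j\<le>c. (if c - j = 0 then 0 else F (c - j - 1)) * a j)
      + (\<Sum>j\<le>c. K * (a j * H (c - j)))"
    by (simp add: sum.distrib algebra_simps)
  also have "(\<Sum>j\<le>c. (if j = 0 then 0 else - a (j - 1)) * F (c - j)) = (\<Sum>j<c. - a j * F (c - Suc j))"
    unfolding lessThan_Suc_atMost[symmetric] sum.lessThan_Suc_shift by simp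
  also have "(\<Sum>j\<le>c. (if c - j = 0 then 0 else F (c - j - 1)) * a j) = (\<Sum>j<c. a j * F (c - Suc j))"
    unfolding lessThan_Suc_atMost[symmetric] sum.lessThan_Suc by (auto intro!: sum.cong)
  also have "(\<Sum>j<c. - a j * F (c - Suc j)) + (\<Sum>j<c. a j * F (c - Suc j)) + (\<Sum>j\<le>c. K * (a j * H (c - j))) = K * iter_prim l i c w"
    by (simp add: sum_negf iter_prim_def a_def H_def sum_distrib_left)
  finally show ?thesis by (simp add: K_def)
qed

lemma iter_prim_tendsto_at_bot: "(iter_prim l (Suc i) c \<longlongrightarrow> 0) at_bot"
proof -
  have "((\<lambda>w. (- w) ^ j / fact j * nest_series l (Suc i) d (exp w)) \<longlongrightarrow> 0) at_bot" for j d
  proof (rule Lim_null_comparison)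
    define C :: real where "C = 3 ^ (Suc i + d)"
    show "\<forall>\<^sub>F w in at_bot. norm ((- w) ^ j / fact j * nest_series l (Suc i) d (exp w)) \<le> 2 * C / fact j * ((- w) ^ j / exp (- w))"
      using eventually_le_at_bot[of "- ln 2"]
    proof eventually_elim
      case (elim w)
      define q where "q = exp w"
      have "exp w \<le> exp (- ln 2)" using elim by simp
      then have q: "0 < q" "q \<le> 1 / 2" by (auto simp: q_def exp_minus)
      have "ln 2 > (0::real)" by simp
      with elim have w: "w < 0" by linarith
      have sm: "summable (\<lambda>n. \<bar>nest_coeff l (Suc i) d n * q ^ n\<bar>)"
        by (rule summable_bounded_coeffs[OF abs_nest_coeff_le]) (use q in auto)
      have "\<bar>nest_series l (Suc i) d q\<bar> \<le> (\<Sum>n. \<bar>nest_coeff l (Suc i) d n * q ^ n\<bar>)"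
        unfolding nest_series_def by (rule summable_rabs[OF sm])
      also have "\<dots> = (\<Sum>n. \<bar>nest_coeff l (Suc i) d (Suc n) * q ^ Suc n\<bar>)"
        using suminf_split_head[OF sm] by (simp add: nest_coeff_at_0)
      also have "\<dots> \<le> (\<Sum>n. C * q * (1 / 2) ^ n)"
      proof (rule suminf_le)
        show "summable (\<lambda>n. C * q * (1 / 2) ^ n)" by (intro summable_mult summable_geometric) simp
        show "summable (\<lambda>n. \<bar>nest_coeff l (Suc i) d (Suc n) * q ^ Suc n\<bar>)"
          using sm by (subst summable_Suc_iff)
        fix n
        have "q ^ Suc n \<le> q * (1 / 2) ^ n"
          using q by (simp add: power_mono)
        moreover have "\<bar>nest_coeff l (Suc i) d (Suc n)\<bar> \<le> C" unfolding C_def by (rule abs_nest_coeff_le)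
        ultimately show "\<bar>nest_coeff l (Suc i) d (Suc n) * q ^ Suc n\<bar> \<le> C * q * (1 / 2) ^ n"
          using q unfolding abs_mult mult.assoc[of C] by (intro mult_mono) (auto simp: abs_mult)
      qed
      also have "\<dots> = 2 * C * q"
        by (subst suminf_mult) (auto simp: suminf_geometric intro: summable_geometric)
      finally have E: "\<bar>nest_series l (Suc i) d q\<bar> \<le> 2 * C * q" .
      have "norm ((- w) ^ j / fact j * nest_series l (Suc i) d (exp w)) = (- w) ^ j / fact j * \<bar>nest_series l (Suc i) d q\<bar>"
        using w by (simp add: abs_mult power_abs q_def)
      also have "\<dots> \<le> (- w) ^ j / fact j * (2 * C * q)"
        using w E by (intro mult_left_mono) auto
      also have "\<dots> = 2 * C / fact j * ((- w) ^ j / exp (- w))"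
        by (simp add: q_def exp_minus field_simps)
      finally show ?case .
    qed
    have "((\<lambda>w. 2 * C / fact j * ((- w) ^ j / exp (- w))) \<longlongrightarrow> 2 * C / fact j * 0) at_bot"
      by (intro tendsto_mult tendsto_const filterlim_compose[OF tendsto_power_div_exp_0 filterlim_uminus_at_top_at_bot])
    then show "((\<lambda>w. 2 * C / fact j * ((- w) ^ j / exp (- w))) \<longlongrightarrow> 0) at_bot" by simp
  qed
  then have "((\<lambda>w. \<Sum>j\<le>c. (- w) ^ j / fact j * nest_series l (Suc i) (c - j) (exp w)) \<longlongrightarrow> (\<Sum>j\<le>c. 0)) at_bot"
    by (intro tendsto_sum)
  then show ?thesis by (simp add: iter_prim_def[abs_def])
qed

text \<open>At \<open>w = 0\<close> only the summand without a power of \<open>w\<close> survives, and Abel's theorem evaluates it.\<close>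

lemma iter_prim_tendsto_at_0:
  assumes "l < i"
  shows "(iter_prim l i c \<longlongrightarrow> W l (c + i) i) (at_left 0)"
proof -
  have ex: "filterlim exp (at_left 1) (at_left (0::real))"
  proof -
    have "((\<lambda>w. exp w) \<longlongrightarrow> exp 0) (at_left (0::real))" by (intro tendsto_intros)
    then show ?thesis
      unfolding filterlim_at using eventually_at_left_real[of "-1" "0::real"]
      by (auto elim: eventually_mono)
  qed
  have E: "((\<lambda>w. nest_series l i d (exp w)) \<longlongrightarrow> W l (d + i) i) (at_left 0)" for d
    unfolding nest_series_def by (rule filterlim_compose[OF Abel_limit[OF W_eq_sum_nest_coeff[OF assms]] ex])
  have "((\<lambda>w. \<Sum>j\<le>c. (- w) ^ j / fact j * nest_series l i (c - j) (exp w)) \<longlongrightarrow>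
      (\<Sum>j\<le>c. (- 0) ^ j / fact j * W l (c - j + i) i)) (at_left 0)"
    by (intro tendsto_intros E) auto
  also have "(\<Sum>j\<le>c. (- 0) ^ j / fact j * W l (c - j + i) i) = (\<Sum>j\<in>{0}. (- 0) ^ j / fact j * W l (c - j + i) i)"
    by (rule sum.mono_neutral_right) auto
  finally show ?thesis by (simp add: iter_prim_def[abs_def])
qed

definition alpha_prim :: "nat \<Rightarrow> nat \<Rightarrow> nat \<Rightarrow> real \<Rightarrow> real" where
  "alpha_prim l p i w = (\<Sum>j = 1..p. \<alpha> (p - j) * iter_prim l i (2 * j - 2) w)"

lemma alpha_prim_has_derivative:
  "w < 0 \<Longrightarrow> (alpha_prim l p (Suc i) has_real_derivative gap_kernel (Suc i \<le> l) w * alpha_prim l p i w) (at w)"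
  unfolding alpha_prim_def[abs_def]
  by (auto intro!: derivative_eq_intros iter_prim_has_derivative simp: sum_distrib_left mult_ac)

lemma alpha_prim_tendsto_at_bot: "(alpha_prim l p (Suc i) \<longlongrightarrow> 0) at_bot"
proof -
  have "((\<lambda>w. \<Sum>j = 1..p. \<alpha> (p - j) * iter_prim l (Suc i) (2 * j - 2) w) \<longlongrightarrow> (\<Sum>j = 1..p. \<alpha> (p - j) * 0)) at_bot"
    by (intro tendsto_intros iter_prim_tendsto_at_bot)
  then show ?thesis by (simp add: alpha_prim_def[abs_def])
qed

lemma alpha_prim_tendsto_at_0:
  "l < i \<Longrightarrow> (alpha_prim l p i \<longlongrightarrow> (\<Sum>j = 1..p. \<alpha> (p - j) * W l (2 * j - 2 + i) i)) (at_left 0)"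
  unfolding alpha_prim_def[abs_def] by (intro tendsto_intros iter_prim_tendsto_at_0)

text \<open>The binomial expansion of \<open>(w + i \<pi>)\<^sup>2\<^sup>p\<^sup>-\<^sup>1\<close>; its odd powers of \<open>i \<pi>\<close> give the coefficients \<open>\<alpha>\<close>.\<close>

lemma alpha_prim_0:
  assumes "p \<ge> 1"
  shows "alpha_prim l p 0 w = Im ((of_real w + \<i> * of_real pi) ^ (2 * p - 1) / fact (2 * p - 1)) / pi"
proof -
  define n where "n = 2 * p - 1"
  have n: "odd n" "n = Suc (2 * (p - 1))" using assms by (auto simp: n_def)
  have ipow: "Im (\<i> ^ (2 * s + 1)) = (-1) ^ s" "Im (\<i> ^ (2 * s)) = 0" for s
    by (simp_all add: power_mult)
  have summand: "Im (of_nat (n choose k) * (\<i> * of_real pi) ^ k * of_real w ^ (n - k)) =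
      real (n choose k) * pi ^ k * w ^ (n - k) * Im (\<i> ^ k)" for k
  proof -
    have "of_nat (n choose k) * (\<i> * of_real pi) ^ k * of_real w ^ (n - k) =
      complex_of_real (real (n choose k) * pi ^ k * w ^ (n - k)) * \<i> ^ k"
      by (simp add: power_mult_distrib mult_ac)
    then show ?thesis by (simp only: times_complex.sel Im_complex_of_real Re_complex_of_real mult_zero_left add_0_right)
  qed
  have "Im ((of_real w + \<i> * of_real pi) ^ n) = (\<Sum>k\<le>n. real (n choose k) * pi ^ k * w ^ (n - k) * Im (\<i> ^ k))"
    unfolding add.commute[of "of_real w"] binomial_ring Im_sum by (rule sum.cong) (simp_all only: summand)
  also have "\<dots> = (\<Sum>k\<in>(\<lambda>s. 2 * s + 1) ` {..p - 1}. real (n choose k) * pi ^ k * w ^ (n - k) * Im (\<i> ^ k))"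
  proof (rule sum.mono_neutral_right)
    show "(\<lambda>s. 2 * s + 1) ` {..p - 1} \<subseteq> {..n}" using n by auto
    show "\<forall>k\<in>{..n} - (\<lambda>s. 2 * s + 1) ` {..p - 1}. real (n choose k) * pi ^ k * w ^ (n - k) * Im (\<i> ^ k) = 0"
    proof
      fix k assume k: "k \<in> {..n} - (\<lambda>s. 2 * s + 1) ` {..p - 1}"
      have "even k"
      proof (rule ccontr)
        assume "odd k"
        then obtain s where "k = 2 * s + 1" by (elim oddE)
        with k n show False by auto
      qed
      then show "real (n choose k) * pi ^ k * w ^ (n - k) * Im (\<i> ^ k) = 0"
        by (auto elim!: evenE simp: ipow(2))
    qed
  qed auto
  also have "\<dots> = (\<Sum>s\<le>p - 1. real (n choose (2 * s + 1)) * pi ^ (2 * s + 1) * w ^ (n - (2 * s + 1)) * (-1) ^ s)"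
    by (subst sum.reindex) (auto simp: inj_on_def ipow(1)[simplified])
  finally have "Im ((of_real w + \<i> * of_real pi) ^ n) / fact n / pi =
      (\<Sum>s\<le>p - 1. real (n choose (2 * s + 1)) * pi ^ (2 * s + 1) * w ^ (n - (2 * s + 1)) * (-1) ^ s / fact n / pi)"
    by (simp add: sum_divide_distrib)
  also have "\<dots> = (\<Sum>s\<le>p - 1. \<alpha> s * (w ^ (2 * (p - s) - 2) / fact (2 * (p - s) - 2)))"
  proof (rule sum.cong)
    fix s assume s: "s \<in> {..p - 1}"
    then have eq: "n - (2 * s + 1) = 2 * (p - s) - 2" and le: "2 * s + 1 \<le> n" using n assms by auto
    have "real (n choose (2 * s + 1)) = fact n / (fact (2 * s + 1) * fact (2 * (p - s) - 2))"
      using binomial_fact[OF le, where ?'a = real] unfolding eq by simp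
    then show "real (n choose (2 * s + 1)) * pi ^ (2 * s + 1) * w ^ (n - (2 * s + 1)) * (-1) ^ s / fact n / pi =
        \<alpha> s * (w ^ (2 * (p - s) - 2) / fact (2 * (p - s) - 2))"
      unfolding eq by (simp only: \<alpha>_def) (simp add: field_simps del: fact_Suc)
  qed simp
  also have "\<dots> = (\<Sum>j = 1..p. \<alpha> (p - j) * (w ^ (2 * j - 2) / fact (2 * j - 2)))"
    by (rule sum.reindex_bij_witness[of _ "\<lambda>j. p - j" "\<lambda>s. p - s"]) (use assms in auto)
  also have "\<dots> = alpha_prim l p 0 w"
    unfolding alpha_prim_def iter_prim_0 by (intro sum.cong refl) (auto simp: power_minus_even)
  also have "Im ((of_real w + \<i> * of_real pi) ^ n) / fact n = Im ((of_real w + \<i> * of_real pi) ^ n / fact n)"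
    by (metis Im_divide_of_real of_real_fact)
  finally show ?thesis by (simp add: n_def)
qed

section \<open>The angle and integration by parts\<close>

text \<open>The negative of the Gudermannian function; it decreases from \<open>\<pi>/2\<close> at \<open>-\<infinity>\<close> to \<open>0\<close> at \<open>0\<close>, and the
  stereographic coordinate \<open>exp w\<close> equals \<open>tan (\<pi>/4 - angle w / 2)\<close>.\<close>

definition angle :: "real \<Rightarrow> real" where
  "angle w = pi / 2 - 2 * arctan (exp w)"

text \<open>The outcome of integrating by parts against \<open>angle\<close> until the last \<open>s\<close> integrations are replaced by one
  power of \<open>angle\<close>. The sum stops at \<open>s - 1\<close>: the summand \<open>j = s\<close> would not decay at \<open>-\<infinity>\<close> when \<open>l = 0\<close>.\<close>

definition angle_prim :: "nat \<Rightarrow> nat \<Rightarrow> nat \<Rightarrow> real \<Rightarrow> real" where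
  "angle_prim l p s w = (\<Sum>j<s. alpha_prim l p (l + s - j) w * ((- angle w) ^ j / fact j))"

text \<open>The inverse of \<open>angle\<close> on \<open>0 < \<phi> < \<pi>/2\<close>.\<close>

definition angle_inv :: "real \<Rightarrow> real" where
  "angle_inv \<phi> = ln ((1 - sin \<phi>) / cos \<phi>)"

text \<open>The sum on the left-hand side of the main identity, with its weight and depth written in terms of
  \<open>l + (2 m - 1)\<close>.\<close>

definition W_sum :: "nat \<Rightarrow> nat \<Rightarrow> nat \<Rightarrow> real" where
  "W_sum l p m = (\<Sum>j = 1..p. \<alpha> (p - j) * W l (2 * j - 2 + (l + (2 * m - 1))) (l + (2 * m - 1)))"

lemma angle_has_derivative: "(angle has_real_derivative gap_kernel False w) (at w)"
proof -
  have "2 * exp w * cosh w = (exp w)\<^sup>2 + 1"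
    by (simp add: cosh_def algebra_simps power2_eq_square flip: exp_add)
  moreover have "(exp w)\<^sup>2 + 1 \<noteq> 0" "cosh w \<noteq> 0" by (auto simp: add_nonneg_eq_0_iff)
  ultimately have eq: "- (2 * (inverse (1 + (exp w)\<^sup>2) * exp w)) = gap_kernel False w"
    by (simp add: gap_kernel_def field_simps)
  have "(angle has_real_derivative - (2 * (inverse (1 + (exp w)\<^sup>2) * exp w))) (at w)"
    unfolding angle_def[abs_def] by (auto intro!: derivative_eq_intros)
  then show ?thesis by (rule DERIV_cong) (rule eq)
qed

lemma angle_at_0: "(angle \<longlongrightarrow> 0) (at_left 0)"
proof -
  have "(angle \<longlongrightarrow> pi / 2 - 2 * arctan (exp 0)) (at_left 0)"
    unfolding angle_def[abs_def] by (intro tendsto_intros)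
  then show ?thesis by (simp add: arctan_one)
qed

lemma angle_at_bot: "(angle \<longlongrightarrow> pi / 2) at_bot"
proof -
  have "(angle \<longlongrightarrow> pi / 2 - 2 * arctan 0) at_bot"
    unfolding angle_def[abs_def] by (intro tendsto_intros exp_at_bot)
  then show ?thesis by simp
qed

text \<open>All summands cancel in pairs except the one that contains \<open>alpha_prim l p l\<close>, the last
  function obtained with the kernel \<open>- 1 / sinh\<close>.\<close>

lemma angle_prim_has_derivative:
  assumes w: "w < 0"
  shows "(angle_prim l p (Suc t) has_real_derivative gap_kernel False w * alpha_prim l p l w * ((- angle w) ^ t / fact t)) (at w)"
proof -
  define k where "k = gap_kernel False w"
  define a where "a j = (- angle w) ^ j / fact j" for j
  have da: "((\<lambda>w. (- angle w) ^ j / fact j) has_real_derivative (if j = 0 then 0 else - k * a (j - 1))) (at w)" for j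
    unfolding k_def a_def by (rule neg_power_fact_has_derivative[OF angle_has_derivative])
  have dY: "(alpha_prim l p (l + Suc t - j) has_real_derivative k * alpha_prim l p (l + t - j) w) (at w)" if "j < Suc t" for j
  proof -
    have "\<not> Suc (l + t - j) \<le> l" "l + Suc t - j = Suc (l + t - j)" using that by auto
    then show ?thesis using alpha_prim_has_derivative[OF w, of l p "l + t - j"] by (simp add: k_def)
  qed
  have "(angle_prim l p (Suc t) has_real_derivative (\<Sum>j<Suc t. k * alpha_prim l p (l + t - j) w * a j +
      (if j = 0 then 0 else - k * a (j - 1)) * alpha_prim l p (l + Suc t - j) w)) (at w)"
    unfolding angle_prim_def by (rule DERIV_sum, rule DERIV_cong[OF DERIV_mult[OF dY da]]) (auto simp: a_def)
  also have "(\<Sum>j<Suc t. k * alpha_prim l p (l + t - j) w * a j +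
      (if j = 0 then 0 else - k * a (j - 1)) * alpha_prim l p (l + Suc t - j) w) =
      (\<Sum>j<Suc t. k * alpha_prim l p (l + t - j) w * a j) + (\<Sum>j<Suc t. (if j = 0 then 0 else - k * a (j - 1)) * alpha_prim l p (l + Suc t - j) w)"
    by (rule sum.distrib)
  also have "(\<Sum>j<Suc t. (if j = 0 then 0 else - k * a (j - 1)) * alpha_prim l p (l + Suc t - j) w) = (\<Sum>j<t. - (k * alpha_prim l p (l + t - j) w * a j))"
    unfolding sum.lessThan_Suc_shift by (simp add: mult_ac)
  also have "(\<Sum>j<Suc t. k * alpha_prim l p (l + t - j) w * a j) + (\<Sum>j<t. - (k * alpha_prim l p (l + t - j) w * a j)) = k * alpha_prim l p l w * a t"
    by (simp add: sum_negf)
  finally show ?thesis by (simp add: k_def a_def)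
qed

lemma angle_prim_at_bot: "(angle_prim l p s \<longlongrightarrow> 0) at_bot"
proof -
  have "((\<lambda>w. alpha_prim l p (l + s - j) w * ((- angle w) ^ j / fact j)) \<longlongrightarrow> 0 * ((- (pi / 2)) ^ j / fact j)) at_bot" if "j < s" for j
  proof -
    have "l + s - j \<noteq> 0" using that by simp
    then obtain i where i: "l + s - j = Suc i" using not0_implies_Suc by blast
    show ?thesis unfolding i by (intro tendsto_intros alpha_prim_tendsto_at_bot angle_at_bot) auto
  qed
  then have "((\<lambda>w. \<Sum>j<s. alpha_prim l p (l + s - j) w * ((- angle w) ^ j / fact j)) \<longlongrightarrow> (\<Sum>j<s. 0 * ((- (pi / 2)) ^ j / fact j))) at_bot"
    by (intro tendsto_sum) auto
  then show ?thesis by (simp add: angle_prim_def[abs_def])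
qed

lemma angle_prim_at_0:
  assumes "m \<ge> 1"
  shows "(angle_prim l p (2 * m - 1) \<longlongrightarrow> W_sum l p m) (at_left 0)"
proof -
  define s where "s = 2 * m - 1"
  have s: "s > 0" using assms by (simp add: s_def)
  define y where "y i = (\<Sum>j = 1..p. \<alpha> (p - j) * W l (2 * j - 2 + i) i)" for i
  have "((\<lambda>w. alpha_prim l p (l + s - j) w * ((- angle w) ^ j / fact j)) \<longlongrightarrow> y (l + s - j) * ((- 0) ^ j / fact j)) (at_left 0)" if "j < s" for j
    unfolding y_def using that by (intro tendsto_intros alpha_prim_tendsto_at_0 angle_at_0) auto
  then have "(angle_prim l p s \<longlongrightarrow> (\<Sum>j<s. y (l + s - j) * ((- 0) ^ j / fact j))) (at_left 0)"
    unfolding angle_prim_def[abs_def] by (intro tendsto_sum) auto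
  also have "(\<Sum>j<s. y (l + s - j) * ((- 0) ^ j / fact j)) = (\<Sum>j\<in>{0}. y (l + s - j) * ((- 0) ^ j / fact j))"
    by (rule sum.mono_neutral_right) (use s in auto)
  finally show ?thesis by (simp add: y_def s_def W_sum_def)
qed

text \<open>A weak form of Jordan's inequality, from \<open>sin t = 2 sin (t/2) cos (t/2)\<close> and \<open>cos u \<ge> sqrt 2 / 2\<close> for
  \<open>u \<le> \<pi>/4\<close>.\<close>

lemma sin_ge_half:
  assumes "0 \<le> t" "t \<le> pi / 2"
  shows "t / 2 \<le> sin t"
proof -
  define u where "u = t / 2"
  have u: "0 \<le> u" "u \<le> pi / 4" using assms by (auto simp: u_def)
  have c: "sqrt 2 / 2 \<le> cos x" if "0 \<le> x" "x \<le> u" for x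
    using cos_monotone_0_pi_le[of x "pi / 4"] that u by (simp add: cos_45)
  have "u * (sqrt 2 / 2) \<le> sin u"
  proof (cases "u = 0")
    case False
    then have "0 < u" using u by simp
    have "\<exists>z. 0 < z \<and> z < u \<and> sin u - sin 0 = (u - 0) * cos z"
      by (rule MVT2[OF \<open>0 < u\<close>]) (auto intro: DERIV_sin)
    then obtain z where z: "0 < z" "z < u" "sin u = u * cos z" by auto
    then show ?thesis using c[of z] u by (auto intro!: mult_left_mono)
  qed simp
  then have "u * (sqrt 2 / 2) * (sqrt 2 / 2) \<le> sin u * cos u"
    using c[of u] u by (intro mult_mono) (auto intro: sin_ge_zero)
  moreover have "u * (sqrt 2 / 2) * (sqrt 2 / 2) = u / 2" by simp
  moreover have "sin t = 2 * (sin u * cos u)" using sin_double[of u] by (simp add: u_def)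
  moreover have "t = 2 * u" by (simp add: u_def)
  ultimately show ?thesis by linarith
qed

text \<open>The exponent \<open>-1/2\<close> is chosen so that a bound \<open>O(1 / sqrt t)\<close> is inherited by a primitive of
  \<open>g / t\<close>. Iterated integrals against kernels with a simple pole, which grow like powers of a logarithm, are
  controlled in this way by an integrable bound.\<close>

lemma inverse_sqrt_growth:
  fixes g :: "real \<Rightarrow> 'a::real_normed_vector"
  assumes t: "0 < t" "t \<le> T" and C: "C \<ge> 0"
    and deriv: "\<And>x. 0 < x \<Longrightarrow> x \<le> T \<Longrightarrow> (g has_vector_derivative g' x) (at x)"
    and bound: "\<And>x. 0 < x \<Longrightarrow> x < T \<Longrightarrow> norm (g' x) \<le> C / (x * sqrt x)"
  shows "norm (g t) \<le> norm (g T) + 2 * C / sqrt t"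
proof (cases "t = T")
  case False
  then have tT: "t < T" using t by simp
  have "norm (g T - g t) \<le> - 2 * C / sqrt T - (- 2 * C / sqrt t)"
  proof (rule differentiable_bound_general[OF tT])
    show "continuous_on {t..T} g"
      using t by (auto intro!: continuous_at_imp_continuous_on has_vector_derivative_continuous[OF deriv])
    show "continuous_on {t..T} (\<lambda>x. - 2 * C / sqrt x)"
      using t by (auto intro!: continuous_intros)
    fix x assume x: "t < x" "x < T"
    then show "(g has_vector_derivative g' x) (at x)" using t by (intro deriv) auto
    have "((\<lambda>x. - 2 * C / sqrt x) has_real_derivative C / (x * sqrt x)) (at x)"
      using x t by (auto intro!: derivative_eq_intros simp: field_simps)
    then show "((\<lambda>x. - 2 * C / sqrt x) has_vector_derivative C / (x * sqrt x)) (at x)"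
      by (rule has_real_derivative_iff_has_vector_derivative[THEN iffD1])
    show "norm (g' x) \<le> C / (x * sqrt x)" using x t by (intro bound) auto
  qed
  also have "\<dots> \<le> 2 * C / sqrt t" using C t by simp
  finally show ?thesis using norm_triangle_ineq2[of "g t" "g T"] by (simp add: norm_minus_commute)
qed (use t C in simp)

lemma inverse_sqrt_integrable:
  assumes "a \<le> b"
  shows "(\<lambda>x. 1 / sqrt \<bar>x - c\<bar>) integrable_on {a..b}"
proof -
  define F where "F x = (if x \<le> c then - 2 * sqrt (c - x) else 2 * sqrt (x - c))" for x
  have "((\<lambda>x. 1 / sqrt \<bar>x - c\<bar>) has_integral (F b - F a)) {a..b}"
  proof (rule fundamental_theorem_of_calculus_interior_strong[of "{c}"])
    have "continuous_on ({..c} \<union> {c..}) F"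
      unfolding F_def by (rule continuous_on_If) (auto intro!: continuous_intros)
    moreover have "{..c} \<union> {c..} = UNIV" by auto
    ultimately show "continuous_on {a..b} F"
      by (metis continuous_on_subset subset_UNIV)
    fix x assume "x \<in> {a<..<b} - {c}"
    then consider "x < c" | "x > c" by fastforce
    then show "(F has_vector_derivative 1 / sqrt \<bar>x - c\<bar>) (at x)"
    proof cases
      case 1
      have "((\<lambda>x. - 2 * sqrt (c - x)) has_real_derivative 1 / sqrt \<bar>x - c\<bar>) (at x)"
        using 1 by (auto intro!: derivative_eq_intros simp: field_simps)
      then have "(F has_real_derivative 1 / sqrt \<bar>x - c\<bar>) (at x)"
        by (rule has_field_derivative_transform_within_open[where S = "{..<c}"]) (use 1 in \<open>auto simp: F_def\<close>)
      then show ?thesis by (rule has_real_derivative_iff_has_vector_derivative[THEN iffD1])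
    next
      case 2
      have "((\<lambda>x. 2 * sqrt (x - c)) has_real_derivative 1 / sqrt \<bar>x - c\<bar>) (at x)"
        using 2 by (auto intro!: derivative_eq_intros simp: field_simps)
      then have "(F has_real_derivative 1 / sqrt \<bar>x - c\<bar>) (at x)"
        by (rule has_field_derivative_transform_within_open[where S = "{c<..}"]) (use 2 in \<open>auto simp: F_def\<close>)
      then show ?thesis by (rule has_real_derivative_iff_has_vector_derivative[THEN iffD1])
    qed
  qed (use assms in auto)
  then show ?thesis by blast
qed

lemma alpha_prim_0_continuous: "continuous_on A (alpha_prim l p 0)"
  unfolding alpha_prim_def iter_prim_0 by (intro continuous_intros) auto

text \<open>The kernel \<open>- 1 / sinh w\<close> is bounded by \<open>1 / \<bar>w\<bar>\<close>.\<close>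

lemma alpha_prim_growth:
  assumes "i \<le> l"
  shows "\<exists>C\<ge>0. \<forall>w. - 1 \<le> w \<and> w < 0 \<longrightarrow> \<bar>alpha_prim l p i w\<bar> \<le> C / sqrt (- w)"
  using assms
proof (induction i)
  case 0
  have "compact (alpha_prim l p 0 ` {-1..0})" by (intro compact_continuous_image alpha_prim_0_continuous) auto
  then obtain B where B: "\<And>w. w \<in> {-1..0} \<Longrightarrow> \<bar>alpha_prim l p 0 w\<bar> \<le> B"
    by (force dest!: compact_imp_bounded simp: bounded_iff)
  have B0: "B \<ge> 0" using B[of 0] by simp
  have "\<bar>alpha_prim l p 0 w\<bar> \<le> B / sqrt (- w)" if w: "- 1 \<le> w" "w < 0" for w
  proof -
    have "sqrt (- w) \<le> 1" "sqrt (- w) > 0" using w by auto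
    then have "B \<le> B / sqrt (- w)" using B0 by (simp add: pos_le_divide_eq mult_left_le)
    then show ?thesis using B[of w] w by simp
  qed
  with B0 show ?case by blast
next
  case (Suc i)
  then obtain C where C: "C \<ge> 0" "\<And>w. - 1 \<le> w \<Longrightarrow> w < 0 \<Longrightarrow> \<bar>alpha_prim l p i w\<bar> \<le> C / sqrt (- w)" by auto
  define g where "g t = alpha_prim l p (Suc i) (- t)" for t
  have "\<bar>g t\<bar> \<le> \<bar>g 1\<bar> + 2 * C / sqrt t" if t: "0 < t" "t \<le> 1" for t
    unfolding real_norm_def[symmetric]
  proof (rule inverse_sqrt_growth[OF t C(1), where g' = "\<lambda>t. - (gap_kernel True (- t) * alpha_prim l p i (- t))"])
    fix x :: real assume x: "0 < x" "x \<le> 1"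
    have "(alpha_prim l p (Suc i) has_real_derivative gap_kernel True (- x) * alpha_prim l p i (- x)) (at (- x))"
      using alpha_prim_has_derivative[of "- x" l p i] x Suc.prems by simp
    then have "(g has_real_derivative gap_kernel True (- x) * alpha_prim l p i (- x) * (- 1)) (at x)"
      unfolding g_def[abs_def] by (rule DERIV_chain2) (auto intro!: derivative_eq_intros)
    then show "(g has_vector_derivative - (gap_kernel True (- x) * alpha_prim l p i (- x))) (at x)"
      by (simp add: has_real_derivative_iff_has_vector_derivative[symmetric])
  next
    fix x :: real assume x: "0 < x" "x < 1"
    have "x \<le> sinh x" using real_le_x_sinh[of x] x by (simp add: sinh_field_def exp_minus)
    then have "\<bar>gap_kernel True (- x)\<bar> \<le> 1 / x" using x by (simp add: gap_kernel_def frac_le)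
    moreover have "\<bar>alpha_prim l p i (- x)\<bar> \<le> C / sqrt x" using C(2)[of "- x"] x by simp
    ultimately have "\<bar>gap_kernel True (- x)\<bar> * \<bar>alpha_prim l p i (- x)\<bar> \<le> 1 / x * (C / sqrt x)"
      using x by (intro mult_mono) auto
    then show "norm (- (gap_kernel True (- x) * alpha_prim l p i (- x))) \<le> C / (x * sqrt x)" by (simp add: abs_mult)
  qed
  then have "\<bar>alpha_prim l p (Suc i) w\<bar> \<le> (\<bar>g 1\<bar> + 2 * C) / sqrt (- w)" if w: "- 1 \<le> w" "w < 0" for w
  proof -
    have "sqrt (- w) \<le> 1" "sqrt (- w) > 0" using w by auto
    then have "\<bar>g 1\<bar> \<le> \<bar>g 1\<bar> / sqrt (- w)" by (simp add: pos_le_divide_eq mult_left_le)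
    moreover have "\<bar>alpha_prim l p (Suc i) w\<bar> \<le> \<bar>g 1\<bar> + 2 * C / sqrt (- w)"
      using w \<open>\<And>t. 0 < t \<Longrightarrow> t \<le> 1 \<Longrightarrow> \<bar>g t\<bar> \<le> \<bar>g 1\<bar> + 2 * C / sqrt t\<close>[of "- w"] by (simp add: g_def)
    ultimately show ?thesis by (simp add: add_divide_distrib)
  qed
  moreover have "\<bar>g 1\<bar> + 2 * C \<ge> 0" using C by simp
  ultimately show ?case by blast
qed

text \<open>The tangent half-angle substitution: with \<open>u = (1 - sin \<phi>) / cos \<phi> = tan (\<pi>/4 - \<phi>/2)\<close> one has
  \<open>1 / u = (1 + sin \<phi>) / cos \<phi>\<close>. The kernel \<open>- 1 / sinh w\<close> becomes \<open>- 1 / sin \<phi>\<close> after the substitution.\<close>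

lemma angle_inv_facts:
  assumes "0 < \<phi>" "\<phi> < pi / 2"
  shows "angle_inv \<phi> < 0" "sinh (angle_inv \<phi>) = - sin \<phi> / cos \<phi>" "cosh (angle_inv \<phi>) = 1 / cos \<phi>" "angle (angle_inv \<phi>) = \<phi>"
    "(angle_inv has_real_derivative - 1 / cos \<phi>) (at \<phi>)"
proof -
  define s c where "s = sin \<phi>" and "c = cos \<phi>"
  have pos: "0 < c" "0 < s" "s < 1" using assms unfolding s_def c_def
    by (auto intro: cos_gt_zero sin_gt_zero sin_monotone_2pi[of \<phi> "pi / 2", simplified])
  have sc: "s\<^sup>2 + c\<^sup>2 = 1" by (simp add: s_def c_def)
  then have cc: "c * c = (1 - s) * (1 + s)" by (simp add: power2_eq_square algebra_simps)
  define u where "u = (1 - s) / c"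
  have u: "u > 0" "exp (angle_inv \<phi>) = u" using pos by (auto simp: u_def angle_inv_def s_def c_def)
  have iu: "inverse u = (1 + s) / c"
    using pos cc by (simp add: u_def field_simps)
  show sinh: "sinh (angle_inv \<phi>) = - sin \<phi> / cos \<phi>"
    unfolding sinh_def exp_minus u iu using pos by (simp add: u_def s_def[symmetric] c_def[symmetric] field_simps)
  show "cosh (angle_inv \<phi>) = 1 / cos \<phi>"
    unfolding cosh_def exp_minus u iu using pos by (simp add: u_def s_def[symmetric] c_def[symmetric] field_simps)
  have "sinh (angle_inv \<phi>) < 0" using pos by (simp add: sinh s_def c_def)
  then show "angle_inv \<phi> < 0" by simp
  have "tan (pi / 4 - \<phi> / 2) = sin (pi / 2 - \<phi>) / (cos (pi / 2 - \<phi>) + 1)"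
    by (subst tan_half) (simp add: algebra_simps)
  also have "\<dots> = c / (s + 1)" by (simp add: s_def c_def sin_diff cos_diff)
  also have "\<dots> = u" using pos cc by (simp add: u_def field_simps)
  finally have "arctan u = pi / 4 - \<phi> / 2" using assms by (intro arctan_unique) auto
  then show "angle (angle_inv \<phi>) = \<phi>" by (simp add: angle_def u)
  have "((\<lambda>\<phi>. (1 - sin \<phi>) / cos \<phi>) has_real_derivative ((- c) * c - (1 - s) * (- s)) / (c * c)) (at \<phi>)"
    using pos by (auto intro!: derivative_eq_intros simp: s_def c_def)
  from DERIV_chain2[OF DERIV_ln[OF u(1)[unfolded u_def s_def c_def]] this]
  have "(angle_inv has_real_derivative inverse u * (((- c) * c - (1 - s) * (- s)) / (c * c))) (at \<phi>)"
    by (simp add: angle_inv_def[abs_def] u_def s_def c_def)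
  moreover have "inverse u * (((- c) * c - (1 - s) * (- s)) / (c * c)) = - 1 / c"
  proof -
    have "(- c) * c - (1 - s) * (- s) = - (1 - s)" using cc by (simp add: algebra_simps)
    then have "inverse u * (((- c) * c - (1 - s) * (- s)) / (c * c)) = - ((1 + s) * (1 - s)) / (c * (c * c))"
      by (simp only: iu times_divide_times_eq mult_minus_right)
    also have "\<dots> = - 1 / c" using pos unfolding cc by simp
    finally show ?thesis .
  qed
  ultimately show "(angle_inv has_real_derivative - 1 / cos \<phi>) (at \<phi>)" by (simp add: c_def)
qed

lemma angle_inv_at_0: "filterlim angle_inv (at_left 0) (at_right 0)"
proof -
  have "(angle_inv \<longlongrightarrow> ln ((1 - sin 0) / cos 0)) (at_right 0)"
    unfolding angle_inv_def[abs_def] by (intro tendsto_intros) auto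
  moreover have "\<forall>\<^sub>F \<phi> in at_right 0. angle_inv \<phi> < 0"
    by (rule eventually_mono[OF eventually_at_right_real[of 0 "pi / 2"]]) (auto intro: angle_inv_facts)
  ultimately show ?thesis unfolding filterlim_at by (auto elim: eventually_mono)
qed

lemma angle_inv_at_pi_half: "filterlim angle_inv at_bot (at_left (pi / 2))"
proof -
  have "((\<lambda>\<phi>. (1 - sin \<phi>) / cos \<phi>) \<longlongrightarrow> 0) (at_left (pi / 2))"
  proof (rule Lim_transform_eventually)
    have "((\<lambda>\<phi>. cos \<phi> / (1 + sin \<phi>)) \<longlongrightarrow> cos (pi / 2) / (1 + sin (pi / 2))) (at_left (pi / 2))"
      by (intro tendsto_intros) auto
    then show "((\<lambda>\<phi>. cos \<phi> / (1 + sin \<phi>)) \<longlongrightarrow> 0) (at_left (pi / 2))" by simp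
    have "cos \<phi> / (1 + sin \<phi>) = (1 - sin \<phi>) / cos \<phi>" if "\<phi> \<in> {0<..<pi / 2}" for \<phi>
    proof -
      have "cos \<phi> > 0" "sin \<phi> > 0" using that by (auto intro: cos_gt_zero sin_gt_zero)
      moreover have "cos \<phi> * cos \<phi> = (1 - sin \<phi>) * (1 + sin \<phi>)"
        using sin_cos_squared_add[of \<phi>] by (simp add: power2_eq_square algebra_simps)
      ultimately show ?thesis by (simp add: field_simps)
    qed
    then show "\<forall>\<^sub>F \<phi> in at_left (pi / 2). cos \<phi> / (1 + sin \<phi>) = (1 - sin \<phi>) / cos \<phi>"
      using eventually_at_left_real[of 0 "pi / 2"] by (auto elim: eventually_mono)
  qed
  moreover have "(1 - sin \<phi>) / cos \<phi> > 0" if "\<phi> \<in> {0<..<pi / 2}" for \<phi>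
    using that sin_monotone_2pi[of \<phi> "pi / 2", simplified] by (auto intro!: divide_pos_pos cos_gt_zero)
  then have "\<forall>\<^sub>F \<phi> in at_left (pi / 2). (1 - sin \<phi>) / cos \<phi> > 0"
    using eventually_at_left_real[of 0 "pi / 2"] by (auto elim: eventually_mono)
  ultimately have "filterlim (\<lambda>\<phi>. (1 - sin \<phi>) / cos \<phi>) (at_right 0) (at_left (pi / 2))"
    unfolding filterlim_at by (auto elim: eventually_mono)
  then show ?thesis unfolding angle_inv_def[abs_def] by (rule filterlim_compose[OF ln_at_0])
qed

text \<open>Here \<open>Z\<^sub>i\<close> is the \<open>i\<close>-fold iterated integral of a power of \<open>\<phi>\<close> from \<open>\<phi> = 0\<close>, and \<open>alpha_prim l m i\<close> that
  of a multiple of \<open>Im (w + i \<pi>)\<^sup>2\<^sup>m\<^sup>-\<^sup>1\<close> from \<open>\<phi> = \<pi>/2\<close>, both against \<open>- d\<phi> / sin \<phi>\<close>. Moving the integrations one at a time from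
  the first factor to the second ends with the derivative of \<open>angle_prim l m (2 p - 1)\<close>. All boundary terms
  vanish: the zero of \<open>Z\<close> at \<open>0\<close> outweighs growth of order \<open>1 / sqrt \<phi>\<close>, and the iterated integrals
  \<open>alpha_prim l m i\<close> with \<open>i \<ge> 1\<close> tend to \<open>0\<close> at \<open>\<pi>/2\<close>.\<close>

lemma iterated_integration_by_parts:
  fixes Z :: "nat \<Rightarrow> real \<Rightarrow> real"
  assumes Z0: "\<And>\<phi>. Z 0 \<phi> = (-1) ^ (p - 1) * \<phi> ^ (2 * p - 1) / fact (2 * p - 1)" and p: "p \<ge> 1"
    and Zd: "\<And>i \<phi>. 0 < \<phi> \<Longrightarrow> \<phi> < pi \<Longrightarrow> (Z (Suc i) has_real_derivative - Z i \<phi> / sin \<phi>) (at \<phi>)"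
    and Zc: "\<And>i. continuous (at (pi / 2)) (Z i)"
    and Z_0: "\<And>i. Z i 0 = 0" and Zd0: "\<And>i. \<exists>D. (Z i has_real_derivative D) (at 0)"
    and Zl: "\<And>\<phi>. 0 < \<phi> \<Longrightarrow> \<phi> < pi / 2 \<Longrightarrow> (Z l has_real_derivative z \<phi>) (at \<phi>)"
  shows "((\<lambda>\<phi>. z \<phi> * alpha_prim l m 0 (angle_inv \<phi>)) has_integral (-1) ^ (l + p) * W_sum l m p) {0..pi / 2}"
proof -
  define N where "N \<phi> = (\<Sum>i = 1..l. (-1) ^ i * Z (l - i) \<phi> * alpha_prim l m i (angle_inv \<phi>))" for \<phi>
  define e :: real where "e = (-1) ^ l * (-1) ^ (p - 1)"
  \<comment> \<open>\<open>V\<close> is a primitive of the integrand; \<open>N\<close> collects the boundary terms of the integrations by parts\<close>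
  define V where "V \<phi> = e * angle_prim l m (2 * p - 1) (angle_inv \<phi>) - N \<phi>" for \<phi>
  obtain t where t: "2 * p - 1 = Suc t" "even t" using p by (cases p) auto
  define dZ0 where "dZ0 \<phi> = (-1) ^ (p - 1) * \<phi> ^ t / fact t" for \<phi> :: real
  have dZ0: "(Z 0 has_real_derivative dZ0 \<phi>) (at \<phi>)" for \<phi>
  proof -
    have "(Z 0 has_real_derivative (-1) ^ (p - 1) * (real (Suc t) * \<phi> ^ t) / fact (Suc t)) (at \<phi>)"
      unfolding Z0[abs_def] t by (rule DERIV_cdivide, rule DERIV_cmult, rule DERIV_cong[OF DERIV_pow]) simp
    moreover have "(-1) ^ (p - 1) * (real (Suc t) * \<phi> ^ t) / fact (Suc t) = dZ0 \<phi>"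
      by (simp add: dZ0_def fact_Suc field_simps del: of_nat_Suc)
    ultimately show ?thesis by simp
  qed
  have dV: "(V has_real_derivative z \<phi> * alpha_prim l m 0 (angle_inv \<phi>)) (at \<phi>)" if \<phi>: "0 < \<phi>" "\<phi> < pi / 2" for \<phi>
  proof -
    note angle_inv = angle_inv_facts[OF \<phi>]
    have c: "cos \<phi> > 0" "sin \<phi> > 0" using \<phi> by (auto intro: cos_gt_zero sin_gt_zero)
    have kF: "gap_kernel False (angle_inv \<phi>) = - cos \<phi>" "gap_kernel True (angle_inv \<phi>) = cos \<phi> / sin \<phi>"
      using c by (auto simp: gap_kernel_def angle_inv)
    define y where "y i = alpha_prim l m i (angle_inv \<phi>)" for i
    define Q where "Q i = (if i = 0 then dZ0 \<phi> else - Z (i - 1) \<phi> / sin \<phi>)" for i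
    have ZQ: "(Z i has_real_derivative Q i) (at \<phi>)" for i
      using Zd[of \<phi> "i - 1"] dZ0[of \<phi>] \<phi> by (cases i) (auto simp: Q_def)
    have "((\<lambda>\<phi>. angle_prim l m (2 * p - 1) (angle_inv \<phi>)) has_real_derivative
        (gap_kernel False (angle_inv \<phi>) * y l * ((- angle (angle_inv \<phi>)) ^ t / fact t)) * (- 1 / cos \<phi>)) (at \<phi>)"
      unfolding t(1) y_def by (rule DERIV_chain2[OF angle_prim_has_derivative[OF angle_inv(1)] angle_inv(5)])
    then have dK: "((\<lambda>\<phi>. angle_prim l m (2 * p - 1) (angle_inv \<phi>)) has_real_derivative y l * (\<phi> ^ t / fact t)) (at \<phi>)"
      using c t(2) unfolding kF angle_inv by (simp add: power_minus_even)
    have dY: "((\<lambda>\<phi>. alpha_prim l m i (angle_inv \<phi>)) has_real_derivative - y (i - 1) / sin \<phi>) (at \<phi>)" if "i \<in> {1..l}" for i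
    proof -
      obtain j where j: "i = Suc j" "Suc j \<le> l" using \<open>i \<in> {1..l}\<close> by (cases i) auto
      have "((\<lambda>\<phi>. alpha_prim l m (Suc j) (angle_inv \<phi>)) has_real_derivative (gap_kernel (Suc j \<le> l) (angle_inv \<phi>) * alpha_prim l m j (angle_inv \<phi>)) * (- 1 / cos \<phi>)) (at \<phi>)"
        by (rule DERIV_chain2[OF alpha_prim_has_derivative[OF angle_inv(1)] angle_inv(5)])
      then show ?thesis using j c by (simp add: kF y_def)
    qed
    have dN: "(N has_real_derivative (\<Sum>i = 1..l. (-1) ^ i * (Q (l - i) * y i + (- y (i - 1) / sin \<phi>) * Z (l - i) \<phi>))) (at \<phi>)"
      unfolding N_def mult.assoc
      by (rule DERIV_sum, rule DERIV_cmult, rule DERIV_cong[OF DERIV_mult[OF ZQ dY]]) (auto simp: y_def)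
    \<comment> \<open>consecutive terms cancel, since \<open>Q\<close> reproduces the previous \<open>Z\<close>\<close>
    have tel: "(\<Sum>i = 1..n. (-1) ^ i * (Q (l - i) * y i + (- y (i - 1) / sin \<phi>) * Z (l - i) \<phi>)) =
        (-1) ^ n * Q (l - n) * y n - Q l * y 0" if "n \<le> l" for n
      using that
    proof (induction n)
      case (Suc n)
      have "Q (l - n) = - Z (l - Suc n) \<phi> / sin \<phi>" using Suc.prems by (simp add: Q_def)
      with Suc show ?case by (simp add: algebra_simps)
    qed simp
    have "(V has_real_derivative e * (y l * (\<phi> ^ t / fact t)) - ((-1) ^ l * Q (l - l) * y l - Q l * y 0)) (at \<phi>)"
      unfolding V_def[abs_def] tel[OF order_refl, symmetric] by (intro DERIV_diff DERIV_cmult dK dN)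
    also have "e * (y l * (\<phi> ^ t / fact t)) - ((-1) ^ l * Q (l - l) * y l - Q l * y 0) = Q l * y 0"
      by (simp add: Q_def dZ0_def e_def)
    also have "Q l = z \<phi>" using DERIV_unique[OF ZQ Zl[OF \<phi>]] .
    finally show ?thesis by (simp add: y_def)
  qed
  have V0: "(V \<longlongrightarrow> e * W_sum l m p) (at_right 0)"
  proof -
    have N0: "((\<lambda>\<phi>. Z j \<phi> * alpha_prim l m i (angle_inv \<phi>)) \<longlongrightarrow> 0) (at_right 0)" if i: "i \<le> l" for i j
    proof -
      obtain C where C: "C \<ge> 0" "\<And>w. - 1 \<le> w \<Longrightarrow> w < 0 \<Longrightarrow> \<bar>alpha_prim l m i w\<bar> \<le> C / sqrt (- w)"
        using alpha_prim_growth[OF i, of m] by blast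
      obtain D where "(Z j has_real_derivative D) (at 0)" using Zd0 by blast
      then have "((\<lambda>\<phi>. Z j \<phi> / \<phi>) \<longlongrightarrow> D) (at 0)"
        by (simp add: has_field_derivative_iff Z_0)
      then have l1: "((\<lambda>\<phi>. Z j \<phi> / \<phi>) \<longlongrightarrow> D) (at_right 0)"
        by (rule filterlim_mono) (auto simp: at_within_le_nhds at_le)
      have "((\<lambda>\<phi>. C * (\<phi> / sqrt (sin \<phi>))) \<longlongrightarrow> C * 0) (at_right 0)"
        by (intro tendsto_mult tendsto_const) real_asymp
      then have l2: "((\<lambda>\<phi>. C * (\<phi> / sqrt (sin \<phi>))) \<longlongrightarrow> 0) (at_right 0)" by simp
      have "((\<lambda>\<phi>. \<phi> * alpha_prim l m i (angle_inv \<phi>)) \<longlongrightarrow> 0) (at_right 0)"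
      proof (rule Lim_null_comparison[OF _ l2])
        have "\<forall>\<^sub>F w in at_left (0::real). w \<in> {-1<..<0}" by (rule eventually_at_left_real) simp
        then have "\<forall>\<^sub>F \<phi> in at_right 0. angle_inv \<phi> \<in> {-1<..<0}" using angle_inv_at_0 by (rule eventually_compose_filterlim)
        moreover have "\<forall>\<^sub>F \<phi> in at_right 0. \<phi> \<in> {0<..<pi / 2}" by (rule eventually_at_right_real) simp
        ultimately show "\<forall>\<^sub>F \<phi> in at_right 0. norm (\<phi> * alpha_prim l m i (angle_inv \<phi>)) \<le> C * (\<phi> / sqrt (sin \<phi>))"
        proof eventually_elim
          case (elim \<phi>)
          then have \<phi>: "0 < \<phi>" "\<phi> < pi / 2" by auto
          note angle_inv = angle_inv_facts[OF \<phi>]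
          have c: "cos \<phi> > 0" "sin \<phi> > 0" using \<phi> by (auto intro: cos_gt_zero sin_gt_zero)
          define x where "x = - angle_inv \<phi>"
          have x: "x > 0" using angle_inv by (simp add: x_def)
          have "sin \<phi> = sinh x / cosh x" using c by (simp add: x_def angle_inv)
          also have "\<dots> = tanh x" by (simp add: tanh_def)
          also have "\<dots> \<le> x"
          proof -
            have "\<exists>z. 0 < z \<and> z < x \<and> tanh x - tanh 0 = (x - 0) * (1 - (tanh z)\<^sup>2)"
              by (rule MVT2[OF x]) (auto intro!: derivative_eq_intros)
            then obtain z where "tanh x = x * (1 - (tanh z)\<^sup>2)" by auto
            then show ?thesis using x by (simp add: mult_left_le)
          qed
          finally have "sin \<phi> \<le> x" .
          then have "1 / sqrt x \<le> 1 / sqrt (sin \<phi>)" using c x by (intro divide_left_mono) auto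
          then have "C / sqrt x \<le> C / sqrt (sin \<phi>)" using C(1) mult_left_mono by fastforce
          moreover have "\<bar>alpha_prim l m i (angle_inv \<phi>)\<bar> \<le> C / sqrt x" using C(2)[of "angle_inv \<phi>"] elim by (simp add: x_def)
          ultimately have "\<bar>alpha_prim l m i (angle_inv \<phi>)\<bar> \<le> C / sqrt (sin \<phi>)" by linarith
          then have "\<phi> * \<bar>alpha_prim l m i (angle_inv \<phi>)\<bar> \<le> \<phi> * (C / sqrt (sin \<phi>))" using \<phi> by (intro mult_left_mono) auto
          then show ?case using \<phi> by (simp add: abs_mult mult_ac)
        qed
      qed
      from tendsto_mult[OF l1 this] have "((\<lambda>\<phi>. Z j \<phi> / \<phi> * (\<phi> * alpha_prim l m i (angle_inv \<phi>))) \<longlongrightarrow> 0) (at_right 0)" by simp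
      then show ?thesis
      proof (rule Lim_transform_eventually)
        have "\<forall>\<^sub>F \<phi> in at_right 0. \<phi> \<in> {0<..<pi / 2}" by (rule eventually_at_right_real) simp
        then show "\<forall>\<^sub>F \<phi> in at_right 0. Z j \<phi> / \<phi> * (\<phi> * alpha_prim l m i (angle_inv \<phi>)) = Z j \<phi> * alpha_prim l m i (angle_inv \<phi>)"
          by (rule eventually_mono) auto
      qed
    qed
    have "(V \<longlongrightarrow> e * W_sum l m p - (\<Sum>i = 1..l. (-1) ^ i * 0)) (at_right 0)"
      unfolding V_def[abs_def] N_def mult.assoc
      by (intro tendsto_intros N0 filterlim_compose[OF angle_prim_at_0[OF p] angle_inv_at_0]) auto
    then show ?thesis by simp
  qed
  have V1: "(V \<longlongrightarrow> 0) (at_left (pi / 2))"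
  proof -
    have Zl: "(Z j \<longlongrightarrow> Z j (pi / 2)) (at_left (pi / 2))" for j
      using Zc[of j] unfolding continuous_at by (rule filterlim_mono) (auto simp: at_le)
    have Yl: "((\<lambda>\<phi>. alpha_prim l m i (angle_inv \<phi>)) \<longlongrightarrow> 0) (at_left (pi / 2))" if "i \<in> {1..l}" for i
    proof -
      obtain j where "i = Suc j" using \<open>i \<in> {1..l}\<close> by (cases i) auto
      then show ?thesis using filterlim_compose[OF alpha_prim_tendsto_at_bot angle_inv_at_pi_half] by simp
    qed
    have "(V \<longlongrightarrow> e * 0 - (\<Sum>i = 1..l. (-1) ^ i * Z (l - i) (pi / 2) * 0)) (at_left (pi / 2))"
      unfolding V_def[abs_def] N_def
      by (intro tendsto_intros Zl Yl filterlim_compose[OF angle_prim_at_bot angle_inv_at_pi_half])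
    then show ?thesis by simp
  qed
  \<comment> \<open>the end points correspond to \<open>w = 0\<close> and \<open>w = -\<infinity>\<close>, so \<open>V\<close> is extended by its limits\<close>
  define F where "F \<phi> = (if \<phi> = 0 then e * W_sum l m p else if \<phi> = pi / 2 then 0 else V \<phi>)" for \<phi>
  have pi2: "0 < pi / 2" by simp
  have "((\<lambda>\<phi>. z \<phi> * alpha_prim l m 0 (angle_inv \<phi>)) has_integral (F (pi / 2) - F 0)) {0..pi / 2}"
  proof (rule fundamental_theorem_of_calculus_interior)
    fix \<phi> assume \<phi>: "\<phi> \<in> {0<..<pi / 2}"
    then have "(V has_real_derivative z \<phi> * alpha_prim l m 0 (angle_inv \<phi>)) (at \<phi>)" by (intro dV) auto
    then have "(F has_real_derivative z \<phi> * alpha_prim l m 0 (angle_inv \<phi>)) (at \<phi>)"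
      by (rule has_field_derivative_transform_within_open[where S = "{0<..<pi / 2}"]) (use \<phi> in \<open>auto simp: F_def\<close>)
    then show "(F has_vector_derivative z \<phi> * alpha_prim l m 0 (angle_inv \<phi>)) (at \<phi>)"
      by (rule has_real_derivative_iff_has_vector_derivative[THEN iffD1])
  next
    have ev: "\<forall>\<^sub>F \<phi> in at_right 0. V \<phi> = F \<phi>" "\<forall>\<^sub>F \<phi> in at_left (pi / 2). V \<phi> = F \<phi>"
      using eventually_at_right_real[OF pi2] eventually_at_left_real[OF pi2]
      by (auto elim!: eventually_mono simp: F_def)
    have F_ends: "F 0 = e * W_sum l m p" "F (pi / 2) = 0" by (simp_all add: F_def)
    show "continuous_on {0..pi / 2} F"
    proof (rule continuous_on_IccI)
      show "(F \<longlongrightarrow> F 0) (at_right 0)"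
        unfolding F_ends by (rule Lim_transform_eventually[OF V0 ev(1)])
      show "(F \<longlongrightarrow> F (pi / 2)) (at_left (pi / 2))"
        unfolding F_ends by (rule Lim_transform_eventually[OF V1 ev(2)])
      fix \<phi> assume \<phi>: "0 < \<phi>" "\<phi> < pi / 2"
      then have "(V has_real_derivative z \<phi> * alpha_prim l m 0 (angle_inv \<phi>)) (at \<phi>)" by (intro dV) auto
      then have "(F has_real_derivative z \<phi> * alpha_prim l m 0 (angle_inv \<phi>)) (at \<phi>)"
        by (rule has_field_derivative_transform_within_open[where S = "{0<..<pi / 2}"]) (use \<phi> in \<open>auto simp: F_def\<close>)
      then show "(F \<longlongrightarrow> F \<phi>) (at \<phi>)" by (metis DERIV_isCont isCont_def)
    qed simp
  qed simp
  also have "F (pi / 2) - F 0 = (-1) ^ (l + p) * W_sum l m p"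
    using p by (cases p) (auto simp: F_def e_def power_add)
  finally show ?thesis .
qed

section \<open>Iterated primitives in the slit plane\<close>

lemma Complex_0_eq: "Complex x 0 = of_real x"
  by (simp add: complex_eq_iff)

lemma sinh_Complex: "sinh (Complex x y) = Complex (sinh x * cos y) (cosh x * sin y)"
  by (simp add: complex_eq_iff sinh_field_def cosh_field_def Re_exp Im_exp field_simps)

lemma cosh_Complex: "cosh (Complex x y) = Complex (cosh x * cos y) (sinh x * sin y)"
  by (simp add: complex_eq_iff sinh_field_def cosh_field_def Re_exp Im_exp field_simps)

lemma norm_sinh_squared: "(norm (sinh z))\<^sup>2 = (sinh (Re z))\<^sup>2 + (sin (Im z))\<^sup>2"
proof -
  obtain x y where z: "z = Complex x y" by (cases z)
  have "(norm (sinh z))\<^sup>2 = (sinh x)\<^sup>2 * (cos y)\<^sup>2 + (cosh x)\<^sup>2 * (sin y)\<^sup>2"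
    by (simp add: z sinh_Complex cmod_power2 power_mult_distrib)
  also have "\<dots> = (sinh x)\<^sup>2 * ((cos y)\<^sup>2 + (sin y)\<^sup>2) + (sin y)\<^sup>2"
    by (simp only: cosh_square_eq distrib_left distrib_right mult_1 add.assoc)
  finally show ?thesis by (simp add: z)
qed

lemma norm_cosh_squared: "(norm (cosh z))\<^sup>2 = (sinh (Re z))\<^sup>2 + (cos (Im z))\<^sup>2"
proof -
  obtain x y where z: "z = Complex x y" by (cases z)
  have "(norm (cosh z))\<^sup>2 = (cosh x)\<^sup>2 * (cos y)\<^sup>2 + (sinh x)\<^sup>2 * (sin y)\<^sup>2"
    by (simp add: z cosh_Complex cmod_power2 power_mult_distrib)
  also have "\<dots> = (sinh x)\<^sup>2 * ((cos y)\<^sup>2 + (sin y)\<^sup>2) + (cos y)\<^sup>2"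
    by (simp only: cosh_square_eq distrib_left distrib_right mult_1 add.assoc)
  finally show ?thesis by (simp add: z)
qed

lemma norm_sinh_ge: "\<bar>sinh (Re z)\<bar> \<le> norm (sinh z)" "\<bar>sin (Im z)\<bar> \<le> norm (sinh z)"
  by (rule power2_le_imp_le; simp add: norm_sinh_squared)+

lemma norm_cosh_ge: "\<bar>sinh (Re z)\<bar> \<le> norm (cosh z)" "\<bar>cos (Im z)\<bar> \<le> norm (cosh z)"
  by (rule power2_le_imp_le; simp add: norm_cosh_squared)+

lemma abs_sinh_ge:
  fixes x :: real
  assumes "x \<le> - 1"
  shows "exp (- x) / 4 \<le> \<bar>sinh x\<bar>"
proof -
  have "(2 :: real) \<le> exp 2" using exp_ge_add_one_self[of 2] by linarith
  also have "\<dots> \<le> exp (- 2 * x)" using assms by simp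
  finally have "2 * exp x \<le> exp (- 2 * x) * exp x" by (intro mult_right_mono) auto
  also have "\<dots> = exp (- x)" by (simp flip: exp_add)
  finally have le: "2 * exp x \<le> exp (- x)" .
  have eq: "\<bar>sinh x\<bar> = (exp (- x) - exp x) / 2"
    using assms by (simp add: abs_of_neg sinh_field_def field_simps)
  show ?thesis unfolding eq using le by simp
qed

text \<open>In the strip, far to the left, the kernels \<open>1 / sinh\<close> and \<open>1 / cosh\<close> decay fast enough to turn
  growth \<open>exp (- x / 2)\<close> into decay \<open>exp (x / 2)\<close>.\<close>

lemma exp_quotient_bound:
  fixes a n C x :: real
  assumes "0 \<le> a" "a \<le> C * exp (- x / 2)" "exp (- x) / 4 \<le> n"
  shows "a / n \<le> 4 * C * exp (x / 2)"
proof -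
  have "a / n \<le> C * exp (- x / 2) / (exp (- x) / 4)"
    using assms by (intro frac_le) auto
  also have "\<dots> = 4 * C * (exp (- x / 2) * exp x)" by (simp add: exp_minus field_simps)
  also have "exp (- x / 2) * exp x = exp (x / 2)" by (simp flip: exp_add)
  finally show ?thesis .
qed

lemma power_le_fact_exp:
  fixes x :: real
  assumes "x \<ge> 0"
  shows "x ^ n \<le> fact n * exp x"
proof -
  have "x ^ n /\<^sub>R fact n \<le> exp x"
  proof -
    have "(\<Sum>k\<in>{n}. x ^ k /\<^sub>R fact k) \<le> (\<Sum>k. x ^ k /\<^sub>R fact k)"
      by (rule sum_le_suminf[OF summable_exp_generic]) (use assms in auto)
    then show ?thesis by (simp add: exp_def)
  qed
  then show ?thesis by (simp add: field_simps)
qed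

text \<open>The plane cut along \<open>{i t. \<bar>t\<bar> \<ge> \<pi>}\<close>. It is starlike about \<open>0\<close>, contains no zero of \<open>sinh\<close> other than
  \<open>0\<close>, and contains the half-plane \<open>Re z < 0\<close> as well as the segment \<open>i \<phi>\<close>, \<open>0 \<le> \<phi> < \<pi>\<close>.\<close>

definition slit :: "complex set" where
  "slit = {z. Re z \<noteq> 0 \<or> \<bar>Im z\<bar> < pi}"

lemma open_slit: "open slit"
proof -
  have eq: "slit = {z. Re z < 0} \<union> {z. Re z > 0} \<union> {z. \<bar>Im z\<bar> < pi}" by (auto simp: slit_def)
  show ?thesis unfolding eq by (intro open_Un open_Collect_less continuous_intros)
qed

lemma starlike_slit: "starlike slit"
  unfolding starlike_def
proof (intro bexI ballI subsetI)
  fix x y assume x: "x \<in> slit" and y: "y \<in> closed_segment 0 x"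
  then obtain u where u: "0 \<le> u" "u \<le> 1" "y = u *\<^sub>R x" by (auto simp: in_segment)
  show "y \<in> slit"
  proof (cases "u = 0 \<or> Re x \<noteq> 0")
    case True
    then show ?thesis using u by (auto simp: slit_def)
  next
    case False
    then have "\<bar>Im x\<bar> < pi" using x by (auto simp: slit_def)
    moreover have "\<bar>u * Im x\<bar> \<le> \<bar>Im x\<bar>" using u by (simp add: abs_mult mult_left_le_one_le)
    ultimately show ?thesis using u by (auto simp: slit_def)
  qed
qed (simp add: slit_def)

lemma sinh_nonzero_slit:
  assumes "z \<in> slit" "z \<noteq> 0"
  shows "sinh z \<noteq> 0"
proof
  assume "sinh z = 0"
  then have "(sinh (Re z))\<^sup>2 + (sin (Im z))\<^sup>2 = 0" using norm_sinh_squared[of z] by simp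
  then have *: "Re z = 0" "sin (Im z) = 0" by (simp_all add: sum_power2_eq_zero_iff)
  then have "\<bar>Im z\<bar> < pi" using assms by (simp add: slit_def)
  with * have "Im z = 0" using sin_eq_0_pi[of "Im z"] by auto
  with * assms show False by (simp add: complex_eq_iff)
qed

text \<open>The primitive of \<open>- f / sinh\<close> that vanishes at \<open>0\<close>; the value \<open>- f'(0)\<close> of the integrand at \<open>0\<close> removes its
  singularity when \<open>f 0 = 0\<close>.\<close>

definition csch_prim :: "(complex \<Rightarrow> complex) \<Rightarrow> complex \<Rightarrow> complex" where
  "csch_prim f = (SOME g. g 0 = 0 \<and>
     (\<forall>z\<in>slit. (g has_field_derivative (if z = 0 then - deriv f 0 else - f z / sinh z)) (at z)))"

text \<open>The integrand is continuous at \<open>0\<close> and holomorphic elsewhere, which is enough for a primitive to exist on a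
  starlike domain.\<close>

lemma csch_prim:
  assumes f: "f holomorphic_on slit" and f0: "f 0 = 0"
  shows "csch_prim f 0 = 0"
    and "z \<in> slit \<Longrightarrow> (csch_prim f has_field_derivative (if z = 0 then - deriv f 0 else - f z / sinh z)) (at z)"
proof -
  define h where "h z = (if z = 0 then - deriv f 0 else - f z / sinh z)" for z
  have 0: "0 \<in> slit" by (simp add: slit_def)
  have diff: "h field_differentiable at z" if z: "z \<in> slit - {0}" for z
  proof -
    have "(f has_field_derivative deriv f z) (at z)"
      using z by (intro holomorphic_derivI[OF f open_slit]) auto
    moreover have "(sinh has_field_derivative cosh z) (at z)" by (auto intro!: derivative_eq_intros)
    ultimately have "((\<lambda>z. - f z / sinh z) has_field_derivative
        (- deriv f z * sinh z - - f z * cosh z) / (sinh z * sinh z)) (at z)"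
      using z sinh_nonzero_slit[of z] by (intro DERIV_divide DERIV_minus) auto
    then have "(h has_field_derivative (- deriv f z * sinh z - - f z * cosh z) / (sinh z * sinh z)) (at z)"
      by (rule has_field_derivative_transform_within_open[where S = "slit - {0}"])
        (use z in \<open>auto simp: h_def open_slit open_delete\<close>)
    then show ?thesis by (auto simp: field_differentiable_def)
  qed
  have "(\<lambda>z. f z / z) \<midarrow>0\<rightarrow> deriv f 0"
    using holomorphic_derivI[OF f open_slit 0] by (simp add: has_field_derivative_iff f0)
  moreover have "(\<lambda>z::complex. sinh z / z) \<midarrow>0\<rightarrow> 1"
  proof -
    have "(sinh has_field_derivative cosh 0) (at (0 :: complex))" by (auto intro!: derivative_eq_intros)
    then show ?thesis by (simp add: has_field_derivative_iff)
  qed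
  ultimately have "(\<lambda>z. - ((f z / z) / (sinh z / z))) \<midarrow>0\<rightarrow> - (deriv f 0 / 1)"
    by (intro tendsto_intros) auto
  moreover have "\<forall>\<^sub>F z in at 0. - ((f z / z) / (sinh z / z)) = h z"
    by (auto simp: h_def eventually_at_filter)
  ultimately have "h \<midarrow>0\<rightarrow> - deriv f 0"
    using tendsto_cong[of "\<lambda>z. - ((f z / z) / (sinh z / z))" h "at 0"] by simp
  then have "isCont h 0" by (simp add: isCont_def h_def)
  then have "continuous_on slit h"
    using diff by (intro continuous_at_imp_continuous_on ballI)
      (metis DiffI field_differentiable_imp_continuous_at singletonD)
  then have "\<exists>g. \<forall>z\<in>slit. (g has_field_derivative h z) (at z)"
    by (rule holomorphic_starlike_primitive[OF _ starlike_slit open_slit, where k = "{0}"]) (use diff in auto)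
  then obtain g where g: "\<And>z. z \<in> slit \<Longrightarrow> (g has_field_derivative h z) (at z)" by blast
  have "\<exists>g. g 0 = 0 \<and> (\<forall>z\<in>slit. (g has_field_derivative (if z = 0 then - deriv f 0 else - f z / sinh z)) (at z))"
    by (rule exI[of _ "\<lambda>z. g z - g 0"]) (auto intro!: derivative_eq_intros g simp: h_def[symmetric])
  from someI_ex[OF this]
  show "csch_prim f 0 = 0"
    and "z \<in> slit \<Longrightarrow> (csch_prim f has_field_derivative (if z = 0 then - deriv f 0 else - f z / sinh z)) (at z)"
    unfolding csch_prim_def by auto
qed

primrec cprim :: "nat \<Rightarrow> nat \<Rightarrow> complex \<Rightarrow> complex" where
  "cprim p 0 = (\<lambda>z. z ^ (2 * p - 1) / fact (2 * p - 1))"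
| "cprim p (Suc i) = csch_prim (cprim p i)"

declare cprim.simps(2) [simp del]

lemma cprim_holomorphic_0:
  assumes "p \<ge> 1"
  shows "cprim p i holomorphic_on slit \<and> cprim p i 0 = 0"
proof (induction i)
  case 0
  then show ?case using assms by (auto intro!: holomorphic_intros)
next
  case (Suc i)
  then have hol: "cprim p i holomorphic_on slit" and zero: "cprim p i 0 = 0" by auto
  have "cprim p (Suc i) holomorphic_on slit"
    unfolding holomorphic_on_open[OF open_slit] cprim.simps using csch_prim(2)[OF hol zero] by blast
  then show ?case using csch_prim(1)[OF hol zero] by (simp add: cprim.simps(2))
qed

lemmas cprim_holomorphic = cprim_holomorphic_0[THEN conjunct1]
lemmas cprim_at_0 = cprim_holomorphic_0[THEN conjunct2]

lemma cprim_deriv: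
  "p \<ge> 1 \<Longrightarrow> z \<in> slit \<Longrightarrow> (cprim p i has_field_derivative deriv (cprim p i) z) (at z)"
  by (rule holomorphic_derivI[OF cprim_holomorphic open_slit])

lemma cprim_Suc_deriv:
  "p \<ge> 1 \<Longrightarrow> z \<in> slit \<Longrightarrow> z \<noteq> 0 \<Longrightarrow> (cprim p (Suc i) has_field_derivative - cprim p i z / sinh z) (at z)"
  using csch_prim(2)[of "cprim p i" z] cprim_holomorphic cprim_at_0 by (simp add: cprim.simps(2))

lemma horizontal_derivative:
  assumes "(F has_field_derivative D) (at (Complex x y))"
  shows "((\<lambda>x. F (Complex x y)) has_vector_derivative D) (at x)"
proof -
  have "((\<lambda>x. Complex x y) has_vector_derivative 1) (at x)"
    unfolding Complex_eq by (auto intro!: derivative_eq_intros)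
  from field_vector_diff_chain_at[OF this assms] show ?thesis by (simp add: o_def)
qed

lemma vertical_derivative:
  assumes "(F has_field_derivative D) (at (Complex x y))"
  shows "((\<lambda>y. F (Complex x y)) has_vector_derivative \<i> * D) (at y)"
proof -
  have "((\<lambda>y. Complex x y) has_vector_derivative \<i>) (at y)"
    unfolding Complex_eq by (auto intro!: derivative_eq_intros)
  from field_vector_diff_chain_at[OF this assms] show ?thesis by (simp add: o_def)
qed

lemma Re_derivative:
  "(F has_vector_derivative D) (at t) \<Longrightarrow> ((\<lambda>t. Re (F t)) has_real_derivative Re D) (at t)"
  unfolding has_real_derivative_iff_has_vector_derivative
  by (rule bounded_linear.has_vector_derivative[OF bounded_linear_Re])

lemma Im_derivative:
  "(F has_vector_derivative D) (at t) \<Longrightarrow> ((\<lambda>t. Im (F t)) has_real_derivative Im D) (at t)"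
  unfolding has_real_derivative_iff_has_vector_derivative
  by (rule bounded_linear.has_vector_derivative[OF bounded_linear_Im])

text \<open>On the real axis the equation for the imaginary part is homogeneous, with zero initial value at
  \<open>0\<close>. Likewise for the real part on the imaginary axis below.\<close>

lemma cprim_real:
  assumes p: "p \<ge> 1" and x: "x \<le> 0"
  shows "Im (cprim p i (Complex x 0)) = 0"
  using x
proof (induction i arbitrary: x)
  case 0
  have "cprim p 0 (Complex x 0) = of_real (x ^ (2 * p - 1) / fact (2 * p - 1))"
    by (simp add: Complex_0_eq)
  then show ?case by (simp only: Im_complex_of_real)
next
  case (Suc i)
  show ?case
  proof (cases "x = 0")
    case False
    have slit: "Complex t 0 \<in> slit" for t by (simp add: slit_def)
    have "Im (cprim p (Suc i) (Complex 0 0)) = Im (cprim p (Suc i) (Complex x 0))"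
    proof (rule DERIV_isconst_end[where f = "\<lambda>t. Im (cprim p (Suc i) (Complex t 0))"])
      show "continuous_on {x..0} (\<lambda>t. Im (cprim p (Suc i) (Complex t 0)))"
        by (intro DERIV_continuous_on[OF DERIV_subset[OF Im_derivative[OF horizontal_derivative[OF cprim_deriv[OF p slit]]]]]) auto
      fix t assume t: "x < t" "t < 0"
      then have "(cprim p (Suc i) has_field_derivative - cprim p i (Complex t 0) / sinh (Complex t 0)) (at (Complex t 0))"
        using cprim_Suc_deriv[OF p slit] by (simp add: complex_eq_iff)
      from Im_derivative[OF horizontal_derivative[OF this]]
      have "((\<lambda>t. Im (cprim p (Suc i) (Complex t 0))) has_real_derivative Im (- cprim p i (Complex t 0) / sinh (Complex t 0))) (at t)" .
      moreover have "Im (- cprim p i (Complex t 0) / sinh (Complex t 0)) = 0"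
        using Suc.IH[of t] t by (simp add: sinh_Complex Im_divide)
      ultimately show "((\<lambda>t. Im (cprim p (Suc i) (Complex t 0))) has_real_derivative 0) (at t)" by simp
    qed (use Suc.prems False in auto)
    moreover have "Complex 0 0 = 0" by (simp add: complex_eq_iff)
    ultimately show ?thesis using cprim_at_0[OF p, of "Suc i"] by simp
  qed (use cprim_at_0[OF p, of "Suc i"] in \<open>simp add: Complex_0_eq\<close>)
qed

lemma odd_power_ii: "Re ((Complex 0 \<phi>) ^ (2 * n + 1)) = 0" "Im ((Complex 0 \<phi>) ^ (2 * n + 1)) = (-1) ^ n * \<phi> ^ (2 * n + 1)"
proof -
  have "(Complex 0 \<phi>)\<^sup>2 = of_real (- (\<phi>\<^sup>2))" by (simp add: complex_eq_iff power2_eq_square)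
  then have "(Complex 0 \<phi>) ^ (2 * n + 1) = of_real ((- (\<phi>\<^sup>2)) ^ n) * Complex 0 \<phi>"
    by (simp add: power_mult)
  also have "(- (\<phi>\<^sup>2)) ^ n = (-1) ^ n * \<phi> ^ (2 * n)" by (simp add: power_mult power_minus[of "\<phi>\<^sup>2"])
  finally have "(Complex 0 \<phi>) ^ (2 * n + 1) = of_real ((-1) ^ n * \<phi> ^ (2 * n)) * Complex 0 \<phi>" .
  then show "Re ((Complex 0 \<phi>) ^ (2 * n + 1)) = 0" "Im ((Complex 0 \<phi>) ^ (2 * n + 1)) = (-1) ^ n * \<phi> ^ (2 * n + 1)"
    by (simp_all only: Re_complex_of_real Im_complex_of_real times_complex.sel complex.sel) simp_all
qed

text \<open>Along \<open>z = i t\<close> the form \<open>- dz / sinh z\<close> equals the real form \<open>- dt / sin t\<close>.\<close>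

lemma csch_on_imaginary_axis: "\<i> * (- a / sinh (Complex 0 t)) = - a / of_real (sin t)"
proof -
  have "sinh (Complex 0 t) = \<i> * of_real (sin t)" by (simp add: sinh_Complex complex_eq_iff)
  then show ?thesis by simp
qed

lemma cprim_imaginary:
  assumes p: "p \<ge> 1" and \<phi>: "0 \<le> \<phi>" "\<phi> < pi"
  shows "Re (cprim p i (Complex 0 \<phi>)) = 0"
  using \<phi>
proof (induction i arbitrary: \<phi>)
  case 0
  have "2 * p - 1 = 2 * (p - 1) + 1" using p by simp
  then show ?case using odd_power_ii(1)[of \<phi> "p - 1"] by (simp only: cprim.simps) (metis Re_divide_of_real div_0 of_real_fact)
next
  case (Suc i)
  show ?case
  proof (cases "\<phi> = 0")
    case False
    have slit: "Complex 0 t \<in> slit" if "0 \<le> t" "t \<le> \<phi>" for t using that Suc.prems by (simp add: slit_def)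
    have "Re (cprim p (Suc i) (Complex 0 \<phi>)) = Re (cprim p (Suc i) (Complex 0 0))"
    proof (rule DERIV_isconst_end[where f = "\<lambda>t. Re (cprim p (Suc i) (Complex 0 t))"])
      show "continuous_on {0..\<phi>} (\<lambda>t. Re (cprim p (Suc i) (Complex 0 t)))"
        by (intro DERIV_continuous_on[OF DERIV_subset[OF Re_derivative[OF vertical_derivative[OF cprim_deriv[OF p slit]]]]]) auto
      fix t assume t: "0 < t" "t < \<phi>"
      then have "(cprim p (Suc i) has_field_derivative - cprim p i (Complex 0 t) / sinh (Complex 0 t)) (at (Complex 0 t))"
        using cprim_Suc_deriv[OF p slit[of t]] by (simp add: complex_eq_iff)
      from Re_derivative[OF vertical_derivative[OF this]]
      have "((\<lambda>t. Re (cprim p (Suc i) (Complex 0 t))) has_real_derivative Re (\<i> * (- cprim p i (Complex 0 t) / sinh (Complex 0 t)))) (at t)" .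
      moreover have "Re (\<i> * (- cprim p i (Complex 0 t) / sinh (Complex 0 t))) = 0"
        unfolding csch_on_imaginary_axis Re_divide_of_real using Suc.IH[of t] t Suc.prems by simp
      ultimately show "((\<lambda>t. Re (cprim p (Suc i) (Complex 0 t))) has_real_derivative 0) (at t)" by simp
    qed (use Suc.prems False in auto)
    moreover have "Complex 0 0 = 0" by (simp add: complex_eq_iff)
    ultimately show ?thesis using cprim_at_0[OF p, of "Suc i"] by simp
  qed (use cprim_at_0[OF p, of "Suc i"] in \<open>simp add: Complex_0_eq\<close>)
qed

lemma continuous_bounded_on_compact:
  fixes f :: "'a::topological_space \<Rightarrow> 'b::real_normed_vector"
  assumes "compact S" "continuous_on S f"
  shows "\<exists>B\<ge>0. \<forall>z\<in>S. norm (f z) \<le> B"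
proof -
  have "bounded (f ` S)" using assms by (intro compact_imp_bounded compact_continuous_image)
  then obtain B where "\<forall>z\<in>S. norm (f z) \<le> B" by (auto simp: bounded_iff)
  then show ?thesis by (intro exI[of _ "max B 0"]) (auto intro: max.coboundedI1)
qed

lemma cprim_continuous_on: "p \<ge> 1 \<Longrightarrow> B \<subseteq> slit \<Longrightarrow> continuous_on B (cprim p i)"
  using cprim_holomorphic holomorphic_on_imp_continuous_on continuous_on_subset by blast

lemma cprim_isCont: "p \<ge> 1 \<Longrightarrow> z \<in> slit \<Longrightarrow> isCont (cprim p i) z"
  by (rule DERIV_isCont[OF cprim_deriv])

text \<open>The factor \<open>exp (- x / 2)\<close> is a crude substitute for polynomial growth that absorbs every power of \<open>z\<close>.\<close>

lemma cprim_strip_bound: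
  assumes p: "p \<ge> 1"
  shows "\<exists>C\<ge>0. \<forall>x y. x \<le> - 1 \<and> 0 \<le> y \<and> y \<le> pi \<longrightarrow> norm (cprim p i (Complex x y)) \<le> C * exp (- x / 2)"
proof (induction i)
  case 0
  define n where "n = 2 * p - 1"
  have "norm (cprim p 0 (Complex x y)) \<le> 2 ^ n * exp (pi / 2) * exp (- x / 2)"
    if "x \<le> - 1" "0 \<le> y" "y \<le> pi" for x y
  proof -
    define r where "r = norm (Complex x y)"
    have "r \<le> - x + pi" using cmod_le[of "Complex x y"] that by (simp add: r_def)
    have "(r / 2) ^ n \<le> fact n * exp (r / 2)" by (rule power_le_fact_exp) (simp add: r_def)
    also have "\<dots> \<le> fact n * exp ((- x + pi) / 2)" using \<open>r \<le> - x + pi\<close> by simp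
    also have "exp ((- x + pi) / 2) = exp (pi / 2) * exp (- x / 2)" by (simp add: add_divide_distrib exp_add[symmetric] add.commute)
    finally have "r ^ n / 2 ^ n \<le> fact n * (exp (pi / 2) * exp (- x / 2))" by (simp add: power_divide)
    then show ?thesis
      unfolding cprim.simps n_def[symmetric] norm_divide norm_power r_def[symmetric] by (simp add: field_simps)
  qed
  then show ?case by (intro exI[of _ "2 ^ n * exp (pi / 2)"]) auto
next
  case (Suc i)
  then obtain C where C: "C \<ge> 0" "\<And>x y. x \<le> - 1 \<Longrightarrow> 0 \<le> y \<Longrightarrow> y \<le> pi \<Longrightarrow> norm (cprim p i (Complex x y)) \<le> C * exp (- x / 2)"
    by blast
  have slit: "Complex x y \<in> slit" if "x \<le> - 1" for x y using that by (simp add: slit_def)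
  obtain B where B: "B \<ge> 0" "\<And>z. z \<in> cbox (Complex (-1) 0) (Complex (-1) pi) \<Longrightarrow> norm (cprim p (Suc i) z) \<le> B"
    using continuous_bounded_on_compact[OF compact_cbox cprim_continuous_on[OF p], of "Complex (-1) 0" "Complex (-1) pi" "Suc i"]
    by (auto simp: in_cbox_complex_iff slit_def subset_iff)
  have "norm (cprim p (Suc i) (Complex x y)) \<le> (B + 8 * C) * exp (- x / 2)"
    if xy: "x \<le> - 1" "0 \<le> y" "y \<le> pi" for x y
  proof -
    have b: "norm (cprim p (Suc i) (Complex (-1) y)) \<le> B" using B(2) xy by (simp add: in_cbox_complex_iff)
    have e1: "1 \<le> exp (- x / 2)" using xy by simp
    have "norm (cprim p (Suc i) (Complex (-1) y) - cprim p (Suc i) (Complex x y)) \<le> 8 * C"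
    proof (cases "x = - 1")
      case False
      then have x: "x < - 1" using xy by simp
      have d: "((\<lambda>t. cprim p (Suc i) (Complex t y)) has_vector_derivative - cprim p i (Complex t y) / sinh (Complex t y)) (at t)"
        if "t \<le> - 1" for t
        by (intro horizontal_derivative cprim_Suc_deriv p slit that) (use that in \<open>auto simp: complex_eq_iff\<close>)
      have "norm (cprim p (Suc i) (Complex (-1) y) - cprim p (Suc i) (Complex x y)) \<le> 8 * C * exp (- 1 / 2) - 8 * C * exp (x / 2)"
      proof (rule differentiable_bound_general[OF x])
        show "continuous_on {x..-1} (\<lambda>t. cprim p (Suc i) (Complex t y))"
          by (auto intro!: continuous_at_imp_continuous_on has_vector_derivative_continuous[OF d])
        show "continuous_on {x..-1} (\<lambda>t. 8 * C * exp (t / 2))" by (intro continuous_intros) auto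
        fix t assume t: "x < t" "t < - 1"
        then show "((\<lambda>t. cprim p (Suc i) (Complex t y)) has_vector_derivative - cprim p i (Complex t y) / sinh (Complex t y)) (at t)"
          by (intro d) auto
        have "((\<lambda>t. 8 * C * exp (t / 2)) has_real_derivative 4 * C * exp (t / 2)) (at t)"
          by (auto intro!: derivative_eq_intros)
        then show "((\<lambda>t. 8 * C * exp (t / 2)) has_vector_derivative 4 * C * exp (t / 2)) (at t)"
          by (simp add: has_real_derivative_iff_has_vector_derivative)
        have "exp (- t) / 4 \<le> norm (sinh (Complex t y))"
          using abs_sinh_ge[of t] norm_sinh_ge(1)[of "Complex t y"] t by simp
        then show "norm (- cprim p i (Complex t y) / sinh (Complex t y)) \<le> 4 * C * exp (t / 2)"
          unfolding norm_divide norm_minus_cancel using C t xy by (intro exp_quotient_bound) auto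
      qed
      also have "\<dots> \<le> 8 * C * 1 - 0" using C(1) by (intro diff_mono mult_left_mono) auto
      finally show ?thesis by simp
    qed (use C in auto)
    then have "norm (cprim p (Suc i) (Complex x y)) \<le> B + 8 * C"
      using b norm_triangle_ineq2[of "cprim p (Suc i) (Complex x y)" "cprim p (Suc i) (Complex (-1) y)"]
      by (simp add: norm_minus_commute)
    also have "\<dots> \<le> (B + 8 * C) * exp (- x / 2)" using e1 B C mult_left_mono[of 1 "exp (- x / 2)" "B + 8 * C"] by simp
    finally show ?thesis .
  qed
  moreover have "B + 8 * C \<ge> 0" using B C by simp
  ultimately show ?case by blast
qed

text \<open>The two edges of the strip are joined by vertical segments of length \<open>\<pi>\<close>, along which \<open>F\<close> changes by an
  exponentially small amount.\<close>

lemma strip_decay: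
  assumes d: "\<And>z. Re z < 0 \<Longrightarrow> (F has_field_derivative F' z) (at z)"
    and bound: "\<And>x y. x \<le> - 1 \<Longrightarrow> 0 \<le> y \<Longrightarrow> y \<le> pi \<Longrightarrow> norm (F' (Complex x y)) \<le> C * exp (x / 2)"
    and real: "\<And>x. x < 0 \<Longrightarrow> Im (F (Complex x 0)) = 0"
  shows "((\<lambda>x. Im (F (Complex x pi))) \<longlongrightarrow> 0) at_bot"
proof (rule Lim_null_comparison)
  show "\<forall>\<^sub>F x in at_bot. norm (Im (F (Complex x pi))) \<le> C * pi * exp (x / 2)"
    using eventually_le_at_bot[of "- 1"]
  proof eventually_elim
    case (elim x)
    have d': "((\<lambda>y. F (Complex x y)) has_vector_derivative \<i> * F' (Complex x y)) (at y)" for y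
      by (rule vertical_derivative[OF d]) (use elim in auto)
    have "norm (F (Complex x pi) - F (Complex x 0)) \<le> C * exp (x / 2) * pi - C * exp (x / 2) * 0"
    proof (rule differentiable_bound_general[OF pi_gt_zero])
      show "continuous_on {0..pi} (\<lambda>y. F (Complex x y))"
        by (auto intro!: continuous_at_imp_continuous_on has_vector_derivative_continuous[OF d'])
      show "continuous_on {0..pi} (\<lambda>y. C * exp (x / 2) * y)" by (intro continuous_intros)
      fix y assume y: "0 < y" "y < pi"
      show "((\<lambda>y. F (Complex x y)) has_vector_derivative \<i> * F' (Complex x y)) (at y)" by (rule d')
      show "((\<lambda>y. C * exp (x / 2) * y) has_vector_derivative C * exp (x / 2)) (at y)"
        by (auto intro!: derivative_eq_intros)
      show "norm (\<i> * F' (Complex x y)) \<le> C * exp (x / 2)"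
        using bound[of x y] elim y by (simp add: norm_mult)
    qed
    moreover have "\<bar>Im (F (Complex x pi))\<bar> \<le> norm (F (Complex x pi) - F (Complex x 0))"
      using abs_Im_le_cmod[of "F (Complex x pi) - F (Complex x 0)"] real[of x] elim by simp
    ultimately show ?case by (simp add: mult_ac)
  qed
  have "((\<lambda>x::real. exp (x / 2)) \<longlongrightarrow> 0) at_bot" by real_asymp
  then have "((\<lambda>x. C * pi * exp (x / 2)) \<longlongrightarrow> C * pi * 0) at_bot" by (intro tendsto_intros)
  then show "((\<lambda>x. C * pi * exp (x / 2)) \<longlongrightarrow> 0) at_bot" by simp
qed

lemma real_function_eq_0:
  fixes D :: "real \<Rightarrow> real"
  assumes d: "\<And>w. w < 0 \<Longrightarrow> (D has_real_derivative 0) (at w)" and lim: "(D \<longlongrightarrow> 0) at_bot" and w: "w < 0"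
  shows "D w = 0"
proof -
  have "D v = D w" if "v < 0" for v
    by (rule DERIV_isconst3[of "min v w - 1" 0]) (use that w d in auto)
  then have ev: "\<forall>\<^sub>F v in at_bot. D v = D w"
    by (intro eventually_mono[OF eventually_le_at_bot[of "- 1"]]) auto
  show ?thesis using lim tendsto_cong[OF ev, of 0] by (simp add: tendsto_const_iff)
qed

text \<open>Both sides satisfy the same differential equation in \<open>w\<close>, because \<open>sinh (w + i \<pi>) = - sinh w\<close>, and for
  \<open>i \<ge> 1\<close> both tend to \<open>0\<close> at \<open>-\<infinity>\<close>, although \<open>cprim\<close> itself is based at \<open>0\<close>: on the lower edge it is real, and its
  values on the two edges differ by an exponentially small amount.\<close>

lemma cprim_top:
  assumes p: "p \<ge> 1" and "i \<le> l" "w < 0"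
  shows "Im (cprim p i (Complex w pi)) = (-1) ^ i * pi * alpha_prim l p i w"
  using \<open>i \<le> l\<close> \<open>w < 0\<close>
proof (induction i arbitrary: w)
  case 0
  then show ?case using alpha_prim_0[OF p, of l w] by (simp add: Complex_eq)
next
  case (Suc i)
  define D where "D w = Im (cprim p (Suc i) (Complex w pi)) - (-1) ^ Suc i * pi * alpha_prim l p (Suc i) w" for w
  have slit: "Complex w y \<in> slit" "Complex w y \<noteq> 0" if "w < 0" for w y
    using that by (auto simp: slit_def complex_eq_iff)
  have dA: "(cprim p (Suc i) has_field_derivative - cprim p i z / sinh z) (at z)" if "Re z < 0" for z
    by (rule cprim_Suc_deriv[OF p]) (use that in \<open>auto simp: slit_def\<close>)
  have "D w = 0"
  proof (rule real_function_eq_0[OF _ _ Suc.prems(2)])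
    fix w :: real assume w: "w < 0"
    have "((\<lambda>w. Im (cprim p (Suc i) (Complex w pi))) has_real_derivative Im (- cprim p i (Complex w pi) / sinh (Complex w pi))) (at w)"
      by (rule Im_derivative[OF horizontal_derivative[OF dA]]) (use w in auto)
    moreover have "(alpha_prim l p (Suc i) has_real_derivative - 1 / sinh w * alpha_prim l p i w) (at w)"
      using alpha_prim_has_derivative[OF w, of l p i] Suc.prems by (simp add: gap_kernel_def)
    ultimately have "(D has_real_derivative Im (- cprim p i (Complex w pi) / sinh (Complex w pi)) - (-1) ^ Suc i * pi * (- 1 / sinh w * alpha_prim l p i w)) (at w)"
      unfolding D_def[abs_def] by (intro DERIV_diff DERIV_cmult)
    moreover have "sinh (Complex w pi) = of_real (- sinh w)"
      by (simp add: sinh_Complex complex_eq_iff)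
    then have "Im (- cprim p i (Complex w pi) / sinh (Complex w pi)) = Im (cprim p i (Complex w pi)) / sinh w"
      by (simp only: Im_divide_of_real) simp
    ultimately show "(D has_real_derivative 0) (at w)"
      using Suc.IH[OF _ w] Suc.prems by simp
  next
    obtain C where C: "C \<ge> 0" "\<And>x y. x \<le> - 1 \<Longrightarrow> 0 \<le> y \<Longrightarrow> y \<le> pi \<Longrightarrow> norm (cprim p i (Complex x y)) \<le> C * exp (- x / 2)"
      using cprim_strip_bound[OF p, of i] by blast
    have "((\<lambda>x. Im (cprim p (Suc i) (Complex x pi))) \<longlongrightarrow> 0) at_bot"
    proof (rule strip_decay[OF dA])
      fix x y :: real assume xy: "x \<le> - 1" "0 \<le> y" "y \<le> pi"
      have "exp (- x) / 4 \<le> norm (sinh (Complex x y))"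
        using abs_sinh_ge[of x] norm_sinh_ge(1)[of "Complex x y"] xy by simp
      then show "norm (- cprim p i (Complex x y) / sinh (Complex x y)) \<le> 4 * C * exp (x / 2)"
        unfolding norm_divide norm_minus_cancel using C xy by (intro exp_quotient_bound) auto
    qed (use cprim_real[OF p, of _ "Suc i"] in auto)
    then have "(D \<longlongrightarrow> 0 - (-1) ^ Suc i * pi * 0) at_bot"
      unfolding D_def[abs_def] by (intro tendsto_intros alpha_prim_tendsto_at_bot)
    then show "(D \<longlongrightarrow> 0) at_bot" by simp
  qed
  then show ?case by (simp add: D_def)
qed

text \<open>Near the corner \<open>i \<pi>\<close> the functions have logarithmic singularities. A bound in terms of \<open>\<pi> - \<phi>\<close> alone,
  uniform in \<open>w\<close>, serves as the majorant when \<open>w\<close> tends to \<open>0\<close>.\<close>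

lemma cprim_growth:
  assumes p: "p \<ge> 1"
  shows "\<exists>C\<ge>0. \<forall>w \<phi>. - 1 \<le> w \<and> w < 0 \<and> pi / 2 \<le> \<phi> \<and> \<phi> < pi \<longrightarrow> norm (cprim p i (Complex w \<phi>)) \<le> C / sqrt (pi - \<phi>)"
proof -
  have weaken: "B \<le> 2 * B / sqrt (pi - \<phi>)" if "B \<ge> 0" "pi / 2 \<le> \<phi>" "\<phi> < pi" for B \<phi>
  proof -
    have "sqrt (pi - \<phi>) \<le> sqrt 4" using that pi_less_4 by (intro real_sqrt_le_mono) auto
    then have "B * sqrt (pi - \<phi>) \<le> B * 2" using that by (intro mult_left_mono) auto
    then show ?thesis using that by (simp add: pos_le_divide_eq)
  qed
  show ?thesis
  proof (induction i)
    case 0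
    have "continuous_on (cbox (Complex (-1) 0) (Complex 0 pi)) (cprim p 0)"
      by (auto intro!: continuous_intros)
    then obtain B where B: "B \<ge> 0" "\<And>z. z \<in> cbox (Complex (-1) 0) (Complex 0 pi) \<Longrightarrow> norm (cprim p 0 z) \<le> B"
      using continuous_bounded_on_compact[OF compact_cbox] by blast
    have "norm (cprim p 0 (Complex w \<phi>)) \<le> 2 * B / sqrt (pi - \<phi>)"
      if "- 1 \<le> w" "w < 0" "pi / 2 \<le> \<phi>" "\<phi> < pi" for w \<phi>
    proof -
      have "B \<le> 2 * B / sqrt (pi - \<phi>)" using that B(1) by (intro weaken) auto
      moreover have "norm (cprim p 0 (Complex w \<phi>)) \<le> B" using that by (intro B(2)) (auto simp: in_cbox_complex_iff)
      ultimately show ?thesis by linarith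
    qed
    then show ?case using B(1) by (intro exI[of _ "2 * B"]) auto
  next
    case (Suc i)
    then obtain C where C: "C \<ge> 0" "\<And>w \<phi>. - 1 \<le> w \<Longrightarrow> w < 0 \<Longrightarrow> pi / 2 \<le> \<phi> \<Longrightarrow> \<phi> < pi \<Longrightarrow> norm (cprim p i (Complex w \<phi>)) \<le> C / sqrt (pi - \<phi>)"
      by blast
    have "cbox (Complex (-1) (pi / 2)) (Complex 0 (pi / 2)) \<subseteq> slit"
    proof
      fix z assume "z \<in> cbox (Complex (-1) (pi / 2)) (Complex 0 (pi / 2))"
      then have "Im z = pi / 2" by (auto simp: in_cbox_complex_iff)
      then have "\<bar>Im z\<bar> < pi" using pi_gt_zero by linarith
      then show "z \<in> slit" by (simp add: slit_def)
    qed
    then have "continuous_on (cbox (Complex (-1) (pi / 2)) (Complex 0 (pi / 2))) (cprim p (Suc i))"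
      by (rule cprim_continuous_on[OF p])
    then obtain B where B: "B \<ge> 0" "\<And>z. z \<in> cbox (Complex (-1) (pi / 2)) (Complex 0 (pi / 2)) \<Longrightarrow> norm (cprim p (Suc i) z) \<le> B"
      using continuous_bounded_on_compact[OF compact_cbox] by blast
    have "norm (cprim p (Suc i) (Complex w \<phi>)) \<le> (2 * B + 4 * C) / sqrt (pi - \<phi>)"
      if w: "- 1 \<le> w" "w < 0" and \<phi>: "pi / 2 \<le> \<phi>" "\<phi> < pi" for w \<phi>
    proof -
      define g where "g t = cprim p (Suc i) (Complex w (pi - t))" for t
      have dA: "(cprim p (Suc i) has_field_derivative - cprim p i (Complex w y) / sinh (Complex w y)) (at (Complex w y))" for y
        by (rule cprim_Suc_deriv[OF p]) (use w in \<open>auto simp: slit_def complex_eq_iff\<close>)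
      have "norm (g (pi - \<phi>)) \<le> norm (g (pi / 2)) + 2 * (2 * C) / sqrt (pi - \<phi>)"
      proof (rule inverse_sqrt_growth)
        show "0 < pi - \<phi>" "pi - \<phi> \<le> pi / 2" "0 \<le> 2 * C" using \<phi> C by auto
        fix x :: real
        have "(g has_vector_derivative - 1 *\<^sub>R (\<i> * (- cprim p i (Complex w (pi - x)) / sinh (Complex w (pi - x))))) (at x)"
          unfolding g_def[abs_def]
          by (rule vector_diff_chain_at[unfolded o_def, OF _ vertical_derivative[OF dA]])
            (auto intro!: derivative_eq_intros)
        then show "(g has_vector_derivative \<i> * (cprim p i (Complex w (pi - x)) / sinh (Complex w (pi - x)))) (at x)"
          by simp
        assume x: "0 < x" "x < pi / 2"
        have "x / 2 \<le> sin x" using sin_ge_half[of x] x by simp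
        also have "\<dots> \<le> norm (sinh (Complex w (pi - x)))"
          using norm_sinh_ge(2)[of "Complex w (pi - x)"] by simp
        finally have "norm (cprim p i (Complex w (pi - x)) / sinh (Complex w (pi - x))) \<le> (C / sqrt x) / (x / 2)"
          unfolding norm_divide using C(2)[of w "pi - x"] w x C(1) by (intro frac_le) auto
        then show "norm (\<i> * (cprim p i (Complex w (pi - x)) / sinh (Complex w (pi - x)))) \<le> 2 * C / (x * sqrt x)"
          by (simp add: norm_mult norm_divide mult_ac)
      qed
      moreover have "norm (g (pi / 2)) \<le> B" unfolding g_def using w by (intro B(2)) (auto simp: in_cbox_complex_iff)
      moreover have "B \<le> 2 * B / sqrt (pi - \<phi>)" using \<phi> B(1) by (intro weaken) auto
      ultimately show ?thesis by (simp add: g_def add_divide_distrib)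
    qed
    moreover have "2 * B + 4 * C \<ge> 0" using B C by simp
    ultimately show ?case by blast
  qed
qed

section \<open>The rotated logarithm\<close>

text \<open>The counterpart of \<open>z\<close> under the quarter turn: it vanishes at \<open>i \<pi>\<close>, restricts to \<open>angle\<close> on
  the upper edge of the strip, and has its logarithmic singularity at \<open>i \<pi>/2\<close>.\<close>

definition rlog :: "complex \<Rightarrow> complex" where
  "rlog z = of_real (pi / 2) + 2 * Arctan (exp z)"

definition rlog_pow :: "nat \<Rightarrow> complex \<Rightarrow> complex" where
  "rlog_pow n z = rlog z ^ n / fact n"

lemma rlog_has_derivative:
  assumes "Re z < 0 \<or> cos (Im z) \<noteq> 0"
  shows "(rlog has_field_derivative 1 / cosh z) (at z)"
proof -
  have cond: "Re (exp z) = 0 \<Longrightarrow> \<bar>Im (exp z)\<bar> < 1"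
  proof -
    assume "Re (exp z) = 0"
    then have "cos (Im z) = 0" by (simp add: Re_exp)
    then have "Re z < 0" using assms by simp
    moreover have "\<bar>Im (exp z)\<bar> \<le> norm (exp z)" by (rule abs_Im_le_cmod)
    ultimately show "\<bar>Im (exp z)\<bar> < 1" by (auto intro: le_less_trans)
  qed
  have "(rlog has_field_derivative 0 + 2 * (inverse (1 + (exp z)\<^sup>2) * exp z)) (at z)"
    unfolding rlog_def[abs_def]
    by (intro DERIV_add DERIV_const DERIV_cmult DERIV_chain2[OF has_field_derivative_Arctan[OF cond] DERIV_exp])
  moreover have "0 + 2 * (inverse (1 + (exp z)\<^sup>2) * exp z) = 1 / cosh z"
  proof -
    have eq: "2 * exp z * cosh z = 1 + (exp z)\<^sup>2"
      by (simp add: cosh_field_def exp_minus field_simps power2_eq_square)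
    show ?thesis
    proof (cases "cosh z = 0")
      case True
      then have "1 + (exp z)\<^sup>2 = 0" using eq by simp
      then show ?thesis using True by simp
    next
      case False
      then show ?thesis unfolding eq[symmetric] by (simp add: field_simps)
    qed
  qed
  ultimately show ?thesis by (simp only:)
qed

lemma rlog_pow_has_derivative:
  assumes "Re z < 0 \<or> cos (Im z) \<noteq> 0"
  shows "(rlog_pow (Suc n) has_field_derivative rlog_pow n z / cosh z) (at z)"
proof -
  have "((\<lambda>z. rlog z ^ Suc n / fact (Suc n)) has_field_derivative (1 + of_nat n) * (1 / cosh z * rlog z ^ n) / fact (Suc n)) (at z)"
    by (intro DERIV_cdivide DERIV_power_Suc rlog_has_derivative assms)
  moreover have "(1 + of_nat n) * (1 / cosh z * rlog z ^ n) / fact (Suc n) = rlog_pow n z / cosh z"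
  proof -
    have "(1 + of_nat n :: complex) \<noteq> 0" by (metis of_nat_Suc of_nat_neq_0)
    then show ?thesis by (simp add: rlog_pow_def fact_Suc)
  qed
  ultimately show ?thesis unfolding rlog_pow_def[abs_def] by (simp only:)
qed

lemma rlog_top: "rlog (Complex w pi) = of_real (angle w)"
proof -
  have "exp (Complex w pi) = of_real (- exp w)" by (simp add: complex_eq_iff Re_exp Im_exp)
  then show ?thesis by (simp add: rlog_def angle_def Arctan_of_real arctan_minus del: of_real_minus flip: of_real_exp)
qed

lemma rlog_real: "rlog (Complex w 0) = of_real (pi / 2 + 2 * arctan (exp w))"
proof -
  have "exp (Complex w 0) = of_real (exp w)" by (simp add: complex_eq_iff Re_exp Im_exp)
  then show ?thesis by (simp add: rlog_def Arctan_of_real flip: of_real_exp)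
qed

text \<open>For \<open>\<bar>q\<bar> \<le> 1\<close> the numbers \<open>1 \<plusminus> i q\<close> have absolute value at most \<open>2\<close>, and at least \<open>\<bar>cos \<phi>\<bar>\<close> with
  \<open>\<phi>\<close> the argument of \<open>q\<close>: after division by \<open>exp (i \<phi>)\<close> their real part is \<open>cos \<phi>\<close>.\<close>

lemma norm_rlog_le:
  assumes "Re z \<le> 0" "cos (Im z) \<noteq> 0"
  shows "norm (rlog z) \<le> 3 * pi / 2 + ln (2 / \<bar>cos (Im z)\<bar>)"
proof -
  define q where "q = exp z"
  define c where "c = \<bar>cos (Im z)\<bar>"
  have c: "c > 0" using assms by (simp add: c_def)
  have q1: "norm q \<le> 1" using assms by (simp add: q_def)
  have lower: "c \<le> norm (1 + s * (\<i> * q))" if s: "s = 1 \<or> s = - 1" for s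
  proof -
    \<comment> \<open>rotating by \<open>e\<close> makes \<open>e q\<close> real\<close>
    define e where "e = exp (Complex 0 (- Im z))"
    have e: "norm e = 1" by (simp add: e_def)
    have eq: "e * q = of_real (exp (Re z))"
    proof -
      have "e * q = exp (Complex 0 (- Im z) + z)" by (simp add: e_def q_def exp_add)
      also have "Complex 0 (- Im z) + z = of_real (Re z)" by (simp add: complex_eq_iff)
      finally show ?thesis by (simp flip: exp_of_real)
    qed
    have "e * (1 + s * (\<i> * q)) = e + s * (\<i> * of_real (exp (Re z)))"
      by (simp add: algebra_simps eq flip: eq)
    then have "Re (e * (1 + s * (\<i> * q))) = cos (Im z)"
      using s by (auto simp: e_def Re_exp)
    then have "c \<le> norm (e * (1 + s * (\<i> * q)))"
      unfolding c_def by (metis abs_Re_le_cmod)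
    then show ?thesis by (simp add: norm_mult e)
  qed
  have upper: "norm (1 + s * (\<i> * q)) \<le> 2" if s: "s = 1 \<or> s = - 1" for s
  proof -
    have "norm (1 + s * (\<i> * q)) \<le> norm (1::complex) + norm (s * (\<i> * q))" by (rule norm_triangle_ineq)
    also have "norm (s * (\<i> * q)) \<le> 1" using s q1 by (auto simp: norm_mult)
    finally show ?thesis by simp
  qed
  define M where "M = (1 - \<i> * q) / (1 + \<i> * q)"
  have nm: "norm M = norm (1 + (- 1) * (\<i> * q)) / norm (1 + 1 * (\<i> * q))"
    by (simp add: M_def norm_divide)
  have b1: "c / 2 \<le> norm M" unfolding nm
    using lower[of "- 1"] upper[of 1] lower[of 1] c by (intro frac_le) auto
  have b2: "norm M \<le> 2 / c" unfolding nm
    using lower[of 1] upper[of "- 1"] c by (intro frac_le) auto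
  have M0: "M \<noteq> 0" using b1 c by auto
  have "ln (norm M) \<le> ln (2 / c)" using b2 M0 c by (subst ln_le_cancel_iff) auto
  moreover have "ln (c / 2) \<le> ln (norm M)" using b1 M0 c by (subst ln_le_cancel_iff) auto
  moreover have "ln (c / 2) = - ln (2 / c)" using c by (simp add: ln_div)
  ultimately have "\<bar>ln (norm M)\<bar> \<le> ln (2 / c)" by linarith
  moreover have "\<bar>Im (Ln M)\<bar> \<le> pi" using mpi_less_Im_Ln[OF M0] Im_Ln_le_pi[OF M0] by linarith
  ultimately have "norm (Ln M) \<le> ln (2 / c) + pi"
    using cmod_le[of "Ln M"] M0 by simp
  moreover have "rlog z = of_real (pi / 2) + \<i> * Ln M"
    by (simp add: rlog_def Arctan_def M_def q_def)
  then have "norm (rlog z) \<le> pi / 2 + norm (Ln M)"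
    using norm_triangle_ineq[of "of_real (pi / 2)" "\<i> * Ln M"] by (simp add: norm_mult)
  ultimately show ?thesis by (simp add: c_def)
qed

text \<open>A power of a logarithm is absorbed by a square root through \<open>x\<^sup>n \<le> n! exp x\<close>.\<close>

lemma norm_rlog_pow_le:
  assumes "Re z \<le> 0" "cos (Im z) \<noteq> 0"
  shows "norm (rlog_pow n z) \<le> 2 ^ n * exp (3 * pi / 4) * sqrt (2 / \<bar>cos (Im z)\<bar>)"
proof -
  define y where "y = 2 / \<bar>cos (Im z)\<bar>"
  have y: "y > 0" using assms by (simp add: y_def)
  have "(norm (rlog z) / 2) ^ n \<le> fact n * exp (norm (rlog z) / 2)"
    by (rule power_le_fact_exp) simp
  also have "exp (norm (rlog z) / 2) \<le> exp (3 * pi / 4 + ln y / 2)"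
  proof -
    have "norm (rlog z) \<le> 3 * pi / 2 + ln y" using norm_rlog_le[OF assms] by (simp only: y_def)
    then have "norm (rlog z) / 2 \<le> 3 * pi / 4 + ln y / 2" by linarith
    then show ?thesis by (simp only: exp_le_cancel_iff mult_left_mono fact_ge_zero)
  qed
  also have "\<dots> = exp (3 * pi / 4) * sqrt y"
  proof -
    have "ln y / 2 = ln (sqrt y)" using y by (simp only: ln_sqrt)
    then have "exp (ln y / 2) = sqrt y" using y by simp
    then show ?thesis by (simp add: exp_add)
  qed
  finally have "(norm (rlog z) / 2) ^ n \<le> fact n * (exp (3 * pi / 4) * sqrt y)" by simp
  then show ?thesis by (simp add: rlog_pow_def norm_divide norm_power power_divide y_def[symmetric] field_simps)
qed

lemma abs_cos_ge:
  assumes "0 \<le> \<phi>" "\<phi> \<le> pi"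
  shows "\<bar>\<phi> - pi / 2\<bar> / 2 \<le> \<bar>cos \<phi>\<bar>"
proof -
  have "\<bar>\<phi> - pi / 2\<bar> / 2 \<le> sin \<bar>\<phi> - pi / 2\<bar>"
    using assms by (intro sin_ge_half) (auto simp: abs_if)
  also have "\<dots> \<le> \<bar>cos \<phi>\<bar>" by (auto simp: abs_if sin_diff)
  finally show ?thesis .
qed

lemma norm_rlog_pow_le':
  assumes "Re z \<le> 0" "0 \<le> Im z" "Im z \<le> pi" "Im z \<noteq> pi / 2"
  shows "norm (rlog_pow n z) \<le> 2 * 2 ^ n * exp (3 * pi / 4) * (1 / sqrt \<bar>Im z - pi / 2\<bar>)"
proof -
  define d where "d = \<bar>Im z - pi / 2\<bar>"
  have d: "d > 0" using assms by (simp add: d_def)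
  have c: "d / 2 \<le> \<bar>cos (Im z)\<bar>" unfolding d_def by (rule abs_cos_ge) (use assms in auto)
  then have "cos (Im z) \<noteq> 0" using d by auto
  have "2 / \<bar>cos (Im z)\<bar> \<le> 2 / (d / 2)" using c d by (intro divide_left_mono) auto
  then have "sqrt (2 / \<bar>cos (Im z)\<bar>) \<le> sqrt (4 / d)" by (intro real_sqrt_le_mono) simp
  also have "sqrt (4 / d) = 2 * (1 / sqrt d)" by (simp add: real_sqrt_divide)
  finally have "2 ^ n * exp (3 * pi / 4) * sqrt (2 / \<bar>cos (Im z)\<bar>) \<le> 2 ^ n * exp (3 * pi / 4) * (2 * (1 / sqrt d))"
    by (intro mult_left_mono) auto
  with norm_rlog_pow_le[OF assms(1) \<open>cos (Im z) \<noteq> 0\<close>, of n] show ?thesis by (simp add: d_def mult_ac)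
qed

lemma Arctan_argument_on_arc:
  assumes "sin \<phi> \<noteq> 1"
  shows "(1 - \<i> * exp (Complex 0 \<phi>)) / (1 + \<i> * exp (Complex 0 \<phi>)) = - \<i> * of_real (cos \<phi> / (1 - sin \<phi>))"
proof -
  define s c where "s = sin \<phi>" and "c = cos \<phi>"
  have s: "1 - s \<noteq> 0" using assms by (simp add: s_def)
  have cc: "c * c = (1 - s) * (1 + s)"
    using sin_cos_squared_add[of \<phi>] by (simp add: s_def c_def power2_eq_square algebra_simps)
  have q: "exp (Complex 0 \<phi>) = Complex c s" by (simp add: complex_eq_iff Re_exp Im_exp s_def c_def)
  have den: "1 + \<i> * Complex c s \<noteq> 0" using s by (simp add: complex_eq_iff)
  have "1 - \<i> * Complex c s = - \<i> * of_real (c / (1 - s)) * (1 + \<i> * Complex c s)"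
    using s cc by (simp add: complex_eq_iff field_simps)
  then show ?thesis unfolding q s_def[symmetric] c_def[symmetric] nonzero_divide_eq_eq[OF den] .
qed

text \<open>The quarter turn: on the arc from \<open>1\<close> to \<open>i\<close> the rotated logarithm is the logarithm of the upper edge, up to
  the factor \<open>- i\<close>.\<close>

lemma rlog_first_quadrant:
  assumes "0 \<le> \<phi>" "\<phi> < pi / 2"
  shows "rlog (Complex 0 \<phi>) = - \<i> * Complex (angle_inv \<phi>) pi"
proof -
  define x where "x = cos \<phi> / (1 - sin \<phi>)"
  have c: "cos \<phi> > 0" using assms by (intro cos_gt_zero_pi) auto
  have s: "sin \<phi> < 1" using sin_monotone_2pi[of \<phi> "pi / 2"] assms by simp
  have x: "x > 0" using c s by (simp add: x_def)
  have "Ln (of_real x * (- \<i>)) = ln x + Ln (- \<i>)" using Ln_times_of_real[OF x, of "- \<i>"] x by (simp add: Ln_of_real)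
  then have L: "Ln (- \<i> * of_real x) = ln x - \<i> * pi / 2" by (simp add: mult.commute)
  have "angle_inv \<phi> = - ln x"
    using c s by (simp add: angle_inv_def x_def ln_div)
  moreover have "rlog (Complex 0 \<phi>) = of_real (pi / 2) + \<i> * (ln x - \<i> * pi / 2)"
    unfolding rlog_def Arctan_def Arctan_argument_on_arc[OF less_imp_neq[OF s]] x_def[symmetric] L by simp
  ultimately show ?thesis by (simp add: complex_eq_iff)
qed

text \<open>On the arc from \<open>i\<close> to \<open>-1\<close> the argument of the logarithm lies on the other imaginary half-axis, and its
  constant \<open>i \<pi>/2\<close> cancels the \<open>\<pi>/2\<close> in the definition of \<open>rlog\<close>.\<close>

lemma rlog_second_quadrant:
  assumes "pi / 2 < \<phi>" "\<phi> \<le> pi"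
  shows "Re (rlog (Complex 0 \<phi>)) = 0"
proof -
  define x where "x = - (cos \<phi> / (1 - sin \<phi>))"
  have c: "cos \<phi> < 0" using assms cos_monotone_0_pi[of "pi / 2" \<phi>] by simp
  have s: "sin \<phi> < 1"
  proof -
    have "(sin \<phi>)\<^sup>2 < 1\<^sup>2" using c sin_cos_squared_add[of \<phi>] by (simp add: sin_squared_eq)
    then show ?thesis using power2_less_imp_less by fastforce
  qed
  have x: "x > 0" using c s by (simp add: x_def divide_neg_pos)
  have "Ln (of_real x * \<i>) = ln x + Ln \<i>" using Ln_times_of_real[OF x] x by (simp add: Ln_of_real)
  then have L: "Ln (- \<i> * of_real (- x)) = ln x + \<i> * pi / 2" by (simp add: mult.commute)
  have eq: "cos \<phi> / (1 - sin \<phi>) = - x" by (simp add: x_def)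
  have "rlog (Complex 0 \<phi>) = of_real (pi / 2) + \<i> * (ln x + \<i> * pi / 2)"
    unfolding rlog_def Arctan_def Arctan_argument_on_arc[OF less_imp_neq[OF s]] eq L by simp
  then show ?thesis by simp
qed

section \<open>Moving the integral to the unit circle\<close>

lemma Re_rlog_pow_first_quadrant:
  assumes m: "m \<ge> 1" and \<phi>: "0 \<le> \<phi>" "\<phi> < pi / 2"
  shows "Re (rlog_pow (2 * m - 1) (Complex 0 \<phi>)) = (-1) ^ (m + 1) * pi * alpha_prim l m 0 (angle_inv \<phi>)"
proof -
  define n where "n = 2 * m - 1"
  have n: "n = 2 * (m - 1) + 1" using m by (simp add: n_def)
  have "(- \<i>) ^ n = of_real ((-1) ^ m) * \<i>"
    unfolding n using m by (cases m) (auto simp: power_mult)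
  then have "rlog_pow n (Complex 0 \<phi>) = of_real ((-1) ^ m) * (\<i> * (Complex (angle_inv \<phi>) pi ^ n / fact n))"
    unfolding rlog_pow_def rlog_first_quadrant[OF \<phi>] power_mult_distrib
    by (simp only: mult.assoc times_divide_eq_right)
  then have "Re (rlog_pow n (Complex 0 \<phi>)) = (-1) ^ m * (- Im (Complex (angle_inv \<phi>) pi ^ n / fact n))"
    by (simp only: times_complex.sel Re_complex_of_real Im_complex_of_real) simp
  then show ?thesis using alpha_prim_0[OF m, of l "angle_inv \<phi>"] by (simp add: n_def Complex_eq)
qed

lemma imaginary_odd_power: "Re z = 0 \<Longrightarrow> odd n \<Longrightarrow> Re (z ^ n) = 0"
proof -
  assume "Re z = 0" "odd n"
  then have "z = Complex 0 (Im z)" by (simp add: complex_eq_iff)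
  then show ?thesis using odd_power_ii(1)[of "Im z"] \<open>odd n\<close> by (metis oddE)
qed

lemma imaginary_even_power: "Re z = 0 \<Longrightarrow> even n \<Longrightarrow> Im (z ^ n) = 0"
proof -
  assume "Re z = 0" "even n"
  then obtain k where k: "n = 2 * k" by (elim evenE)
  have "z\<^sup>2 = of_real (- ((Im z)\<^sup>2))" using \<open>Re z = 0\<close> by (simp add: complex_eq_iff power2_eq_square)
  then have "z ^ n = of_real ((- ((Im z)\<^sup>2)) ^ k)" unfolding k power_mult by simp
  then show ?thesis by (simp only: Im_complex_of_real)
qed

lemma deriv_cprim_real:
  assumes p: "p \<ge> 1" and \<phi>: "0 < \<phi>" "\<phi> < pi"
  shows "Im (deriv (cprim p i) (Complex 0 \<phi>)) = 0"
proof -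
  have slit: "Complex 0 \<phi> \<in> slit" using \<phi> by (simp add: slit_def)
  have "((\<lambda>t. Re (cprim p i (Complex 0 t))) has_real_derivative Re (\<i> * deriv (cprim p i) (Complex 0 \<phi>))) (at \<phi>)"
    by (rule Re_derivative[OF vertical_derivative[OF cprim_deriv[OF p slit]]])
  moreover have "((\<lambda>t. Re (cprim p i (Complex 0 t))) has_real_derivative 0) (at \<phi>)"
  proof (rule has_field_derivative_transform_within_open)
    show "((\<lambda>t::real. 0::real) has_real_derivative 0) (at \<phi>)" by simp
    show "0 = Re (cprim p i (Complex 0 t))" if "t \<in> {0<..<pi}" for t
      using cprim_imaginary[OF p, of t i] that by simp
  qed (use \<phi> in auto)
  ultimately have "Re (\<i> * deriv (cprim p i) (Complex 0 \<phi>)) = 0" by (rule DERIV_unique)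
  then show ?thesis by simp
qed

text \<open>On the arc from \<open>1\<close> to \<open>i\<close> the derivative of \<open>cprim p l\<close> is real, so the integrand is its product with the
  real part of \<open>rlog_pow\<close>, to which iterated integration by parts applies with \<open>Z\<^sub>i(\<phi>) = Im (cprim p i (i \<phi>))\<close>.\<close>

lemma integral_on_arc:
  assumes p: "p \<ge> 1" and m: "m \<ge> 1"
  shows "((\<lambda>\<phi>. Re (deriv (cprim p l) (Complex 0 \<phi>) * rlog_pow (2 * m - 1) (Complex 0 \<phi>))) has_integral
    (-1) ^ (m + 1) * pi * ((-1) ^ (l + p) * W_sum l m p)) {0..pi / 2}"
proof -
  define Z where "Z i \<phi> = Im (cprim p i (Complex 0 \<phi>))" for i \<phi>
  define z where "z \<phi> = Re (deriv (cprim p l) (Complex 0 \<phi>))" for \<phi>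
  have dZ: "(Z i has_real_derivative Re (deriv (cprim p i) (Complex 0 \<phi>))) (at \<phi>)" if "\<bar>\<phi>\<bar> < pi" for i \<phi>
  proof -
    have "Complex 0 \<phi> \<in> slit" using that by (simp add: slit_def)
    from Im_derivative[OF vertical_derivative[OF cprim_deriv[OF p this]], of i]
    show ?thesis by (simp add: Z_def[abs_def])
  qed
  have "((\<lambda>\<phi>. z \<phi> * alpha_prim l m 0 (angle_inv \<phi>)) has_integral (-1) ^ (l + p) * W_sum l m p) {0..pi / 2}"
  proof (rule iterated_integration_by_parts[OF _ p])
    show "Z 0 \<phi> = (-1) ^ (p - 1) * \<phi> ^ (2 * p - 1) / fact (2 * p - 1)" for \<phi>
    proof -
      have n: "2 * p - 1 = 2 * (p - 1) + 1" using p by simp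
      have "Z 0 \<phi> = Im (Complex 0 \<phi> ^ (2 * p - 1)) / fact (2 * p - 1)"
        unfolding Z_def cprim.simps by (metis Im_divide_of_real of_real_fact)
      also have "Im (Complex 0 \<phi> ^ (2 * p - 1)) = (-1) ^ (p - 1) * \<phi> ^ (2 * p - 1)"
        unfolding n by (rule odd_power_ii)
      finally show ?thesis .
    qed
    show "(Z (Suc i) has_real_derivative - Z i \<phi> / sin \<phi>) (at \<phi>)" if \<phi>: "0 < \<phi>" "\<phi> < pi" for i \<phi>
    proof -
      have "Complex 0 \<phi> \<in> slit" "Complex 0 \<phi> \<noteq> 0" using \<phi> by (auto simp: slit_def complex_eq_iff)
      from Im_derivative[OF vertical_derivative[OF cprim_Suc_deriv[OF p this]], of i]
      have "(Z (Suc i) has_real_derivative Im (- cprim p i (Complex 0 \<phi>) / of_real (sin \<phi>))) (at \<phi>)"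
        unfolding csch_on_imaginary_axis Z_def[abs_def] .
      then show ?thesis unfolding Im_divide_of_real by (simp add: Z_def)
    qed
    show "continuous (at (pi / 2)) (Z i)" for i
      by (rule DERIV_isCont[OF dZ]) (simp add: abs_of_pos)
    show "Z i 0 = 0" for i
      using cprim_at_0[OF p, of i] by (simp add: Z_def Complex_0_eq)
    show "\<exists>D. (Z i has_real_derivative D) (at 0)" for i
      using dZ[of 0 i] by auto
    show "(Z l has_real_derivative z \<phi>) (at \<phi>)" if "0 < \<phi>" "\<phi> < pi / 2" for \<phi>
      unfolding z_def by (rule dZ) (use that in auto)
  qed
  from has_integral_mult_right[OF this, of "(-1) ^ (m + 1) * pi"]
  show ?thesis
  proof (rule has_integral_spike_finite[of "{0, pi / 2}", rotated 2])
    fix \<phi> assume "\<phi> \<in> {0..pi / 2} - {0, pi / 2}"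
    then have \<phi>: "0 < \<phi>" "\<phi> < pi / 2" by auto
    have "Re (deriv (cprim p l) (Complex 0 \<phi>) * rlog_pow (2 * m - 1) (Complex 0 \<phi>)) = z \<phi> * Re (rlog_pow (2 * m - 1) (Complex 0 \<phi>))"
      using deriv_cprim_real[OF p, of \<phi> l] \<phi> by (simp add: z_def)
    then show "Re (deriv (cprim p l) (Complex 0 \<phi>) * rlog_pow (2 * m - 1) (Complex 0 \<phi>)) =
        (-1) ^ (m + 1) * pi * (z \<phi> * alpha_prim l m 0 (angle_inv \<phi>))"
      using Re_rlog_pow_first_quadrant[OF m, of \<phi> l] \<phi> by simp
  qed simp
qed

lemma left_half_plane_primitive:
  assumes p: "p \<ge> 1"
  obtains R where "\<And>z. Re z < 0 \<Longrightarrow> (R has_field_derivative cprim p l z * (rlog_pow t z / cosh z)) (at z)"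
    and "\<And>x. x < 0 \<Longrightarrow> Im (R (Complex x 0)) = 0"
proof -
  define H where "H = {z::complex. Re z < 0}"
  define h where "h z = cprim p l z * (rlog_pow t z / cosh z)" for z
  have H: "open H" "convex H" unfolding H_def by (auto intro: open_halfspace_Re_lt convex_halfspace_Re_lt)
  have "h holomorphic_on H"
  proof -
    have "H \<subseteq> slit" by (auto simp: H_def slit_def)
    then have "cprim p l holomorphic_on H" using cprim_holomorphic[OF p] holomorphic_on_subset by blast
    moreover have "rlog holomorphic_on H"
      unfolding holomorphic_on_open[OF H(1)] using rlog_has_derivative by (auto simp: H_def)
    then have "rlog_pow t holomorphic_on H"
      unfolding rlog_pow_def[abs_def] by (intro holomorphic_intros) auto
    moreover have "cosh holomorphic_on H"
      unfolding holomorphic_on_open[OF H(1)] by (auto intro!: exI derivative_eq_intros)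
    moreover have "cosh z \<noteq> 0" if "z \<in> H" for z
      using norm_cosh_ge(1)[of z] that by (auto simp: H_def)
    ultimately show ?thesis unfolding h_def[abs_def] by (intro holomorphic_intros) auto
  qed
  from holomorphic_convex_primitive'[OF H(2,1) this]
  obtain g where g: "\<And>z. z \<in> H \<Longrightarrow> (g has_field_derivative h z) (at z within H)" by blast
  \<comment> \<open>subtracting the value at a real point makes \<open>R\<close> real on the negative half-line\<close>
  define R where "R z = g z - g (-1)" for z
  have dR: "(R has_field_derivative h z) (at z)" if "Re z < 0" for z
  proof -
    have "(g has_field_derivative h z) (at z)"
      using g[of z] that at_within_open[OF _ H(1), of z] by (simp add: H_def)
    then show ?thesis unfolding R_def[abs_def] by (auto intro!: derivative_eq_intros)
  qed
  have real: "Im (R (Complex x 0)) = 0" if x: "x < 0" for x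
  proof -
    have "Im (R (Complex x 0)) = Im (R (Complex (-1) 0))"
    proof (rule DERIV_isconst3[of "min x (-1) - 1" 0 x "-1" "\<lambda>x. Im (R (Complex x 0))"])
      fix t assume t: "t \<in> {min x (-1) - 1<..<0}"
      have "((\<lambda>x. Im (R (Complex x 0))) has_real_derivative Im (h (Complex t 0))) (at t)"
        by (rule Im_derivative[OF horizontal_derivative[OF dR]]) (use t in auto)
      moreover have "Im (h (Complex t 0)) = 0"
      proof -
        have "cprim p l (Complex t 0) = of_real (Re (cprim p l (Complex t 0)))"
          using cprim_real[OF p, of t l] t by (simp add: complex_eq_iff)
        moreover have "rlog_pow n (Complex t 0) = of_real ((pi / 2 + 2 * arctan (exp t)) ^ n / fact n)" for n
          by (simp add: rlog_pow_def rlog_real)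
        moreover have "cosh (Complex t 0) = of_real (cosh t)" by (simp add: cosh_Complex complex_eq_iff)
        ultimately show ?thesis unfolding h_def
          by (metis Im_complex_of_real of_real_divide of_real_mult)
      qed
      ultimately show "((\<lambda>x. Im (R (Complex x 0))) has_real_derivative 0) (at t)" by simp
    qed (use x in auto)
    also have "Complex (-1) 0 = -1" by (simp add: complex_eq_iff)
    finally show ?thesis by (simp add: R_def)
  qed
  show ?thesis by (rule that[of R]) (use dR real in \<open>auto simp: h_def\<close>)
qed

text \<open>Same derivative in \<open>w\<close> and same limit at \<open>-\<infinity>\<close>, as for \<open>cprim_top\<close>.\<close>

lemma primitive_top:
  assumes p: "p \<ge> 1" and t: "even t" and w: "w < 0"
    and dR: "\<And>z. Re z < 0 \<Longrightarrow> (R has_field_derivative cprim p l z * (rlog_pow t z / cosh z)) (at z)"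
    and real: "\<And>x. x < 0 \<Longrightarrow> Im (R (Complex x 0)) = 0"
  shows "Im (R (Complex w pi)) = (-1) ^ l * pi * angle_prim l p (Suc t) w"
proof -
  define D where "D w = Im (R (Complex w pi)) - (-1) ^ l * pi * angle_prim l p (Suc t) w" for w
  have "D w = 0"
  proof (rule real_function_eq_0[OF _ _ w])
    fix w :: real assume w: "w < 0"
    have "((\<lambda>w. Im (R (Complex w pi))) has_real_derivative Im (cprim p l (Complex w pi) * (rlog_pow t (Complex w pi) / cosh (Complex w pi)))) (at w)"
      by (rule Im_derivative[OF horizontal_derivative[OF dR]]) (use w in auto)
    then have dD: "(D has_real_derivative Im (cprim p l (Complex w pi) * (rlog_pow t (Complex w pi) / cosh (Complex w pi)))
        - (-1) ^ l * pi * (gap_kernel False w * alpha_prim l p l w * ((- angle w) ^ t / fact t))) (at w)"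
      unfolding D_def[abs_def] by (intro DERIV_diff DERIV_cmult angle_prim_has_derivative w)
    have b: "rlog_pow t (Complex w pi) / cosh (Complex w pi) = of_real (angle w ^ t / fact t * gap_kernel False w)"
    proof -
      have "cosh (Complex w pi) = of_real (- cosh w)" by (simp add: cosh_Complex complex_eq_iff)
      then show ?thesis by (simp add: rlog_pow_def rlog_top gap_kernel_def)
    qed
    have Im_mult_of_real: "Im (a * of_real r) = Im a * r" for a r by simp
    have "Im (cprim p l (Complex w pi) * (rlog_pow t (Complex w pi) / cosh (Complex w pi))) =
        (-1) ^ l * pi * alpha_prim l p l w * (angle w ^ t / fact t * gap_kernel False w)"
      unfolding b Im_mult_of_real cprim_top[OF p order_refl w] by (simp only:)
    with dD show "(D has_real_derivative 0) (at w)"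
      using t by (simp add: power_minus_even mult_ac)
  next
    obtain C where C: "C \<ge> 0" "\<And>x y. x \<le> - 1 \<Longrightarrow> 0 \<le> y \<Longrightarrow> y \<le> pi \<Longrightarrow> norm (cprim p l (Complex x y)) \<le> C * exp (- x / 2)"
      using cprim_strip_bound[OF p, of l] by blast
    have "continuous_on (cball 0 (exp (-1))) Arctan"
    proof (rule continuous_on_Arctan)
      fix z :: complex assume "z \<in> cball 0 (exp (-1))"
      then have "norm z \<le> exp (-1)" by simp
      also have "\<dots> < exp (0::real)" by (subst exp_less_cancel_iff) simp
      finally have "norm z < 1" by simp
      then show "\<bar>Im z\<bar> < 1" using abs_Im_le_cmod[of z] by linarith
    qed
    then obtain B where B: "B \<ge> 0" "\<And>z. z \<in> cball 0 (exp (-1)) \<Longrightarrow> norm (Arctan z) \<le> B"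
      using continuous_bounded_on_compact[OF compact_cball] by blast
    define B' where "B' = (pi / 2 + 2 * B) ^ t / fact t"
    have B'0: "B' \<ge> 0" using B by (simp add: B'_def)
    have rlog_pow_le: "norm (rlog_pow t (Complex x y)) \<le> B'" if "x \<le> - 1" for x y
    proof -
      have "norm (rlog (Complex x y)) \<le> norm (of_real (pi / 2) :: complex) + norm (2 * Arctan (exp (Complex x y)))"
        unfolding rlog_def by (rule norm_triangle_ineq)
      also have "norm (2 * Arctan (exp (Complex x y))) \<le> 2 * B"
        using B(2)[of "exp (Complex x y)"] that by (simp add: norm_mult)
      finally have "norm (rlog (Complex x y)) \<le> pi / 2 + 2 * B" by simp
      then show ?thesis unfolding rlog_pow_def norm_divide norm_power B'_def
        by (simp add: divide_right_mono power_mono)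
    qed
    have "((\<lambda>x. Im (R (Complex x pi))) \<longlongrightarrow> 0) at_bot"
    proof (rule strip_decay[OF dR])
      fix x y :: real assume xy: "x \<le> - 1" "0 \<le> y" "y \<le> pi"
      have "exp (- x) / 4 \<le> norm (cosh (Complex x y))"
        using abs_sinh_ge[of x] norm_cosh_ge(1)[of "Complex x y"] xy by simp
      moreover have "norm (cprim p l (Complex x y)) * norm (rlog_pow t (Complex x y)) \<le> C * exp (- x / 2) * B'"
        using C xy rlog_pow_le by (intro mult_mono) auto
      ultimately have "(norm (cprim p l (Complex x y)) * norm (rlog_pow t (Complex x y))) / norm (cosh (Complex x y)) \<le> 4 * (C * B') * exp (x / 2)"
        by (intro exp_quotient_bound) (auto simp: mult_ac)
      then show "norm (cprim p l (Complex x y) * (rlog_pow t (Complex x y) / cosh (Complex x y))) \<le> 4 * (C * B') * exp (x / 2)"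
        by (simp add: norm_mult norm_divide)
    qed (use real in auto)
    then have "(D \<longlongrightarrow> 0 - (-1) ^ l * pi * 0) at_bot"
      unfolding D_def[abs_def] by (intro tendsto_intros angle_prim_at_bot)
    then show "(D \<longlongrightarrow> 0) at_bot" by simp
  qed
  then show ?thesis by (simp add: D_def)
qed

lemma Complex_tendsto: "w \<longlonglongrightarrow> 0 \<Longrightarrow> (\<lambda>n. Complex (w n) y) \<longlonglongrightarrow> Complex 0 y"
  by (intro tendsto_Complex tendsto_const)

text \<open>Let \<open>a = cprim p l\<close>, \<open>b = rlog_pow (2 m - 1)\<close>, and let \<open>R\<close> and \<open>P\<close> be primitives of \<open>a b'\<close> and of \<open>a' b\<close>,
  so that \<open>R + P = a b\<close>. On the vertical segment over \<open>w < 0\<close>, the value \<open>Im R(w + i \<pi>)\<close> is a boundary term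
  minus an integral of \<open>Re (a' b)\<close> up to height \<open>q = 3 \<pi>/4\<close> plus an integral of \<open>Re (a b')\<close> above it. The
  form of the integrand is changed at \<open>q\<close> because \<open>b'\<close> has a pole-like singularity at \<open>i \<pi>/2\<close> and, for \<open>l \<ge> 1\<close>,
  \<open>a'\<close> has one at \<open>i \<pi>\<close>. As \<open>w\<close> tends to \<open>0\<close>, dominated convergence moves both integrals to the imaginary axis.\<close>

lemma W_sum_symmetric:
  assumes p: "p \<ge> 1" and m: "m \<ge> 1"
  shows "W_sum l p m = (-1) ^ (m + p) * W_sum l m p"
proof -
  obtain t where t: "2 * m - 1 = Suc t" "even t" using m by (cases m) auto
  define f where "f z = deriv (cprim p l) z * rlog_pow (Suc t) z" for z
  define h where "h z = cprim p l z * (rlog_pow t z / cosh z)" for z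
  define q where "q = 3 * pi / 4"
  have q: "pi / 2 < q" "q < pi" "0 < q" by (auto simp: q_def)
  obtain R where dR: "\<And>z. Re z < 0 \<Longrightarrow> (R has_field_derivative h z) (at z)"
    and real: "\<And>x. x < 0 \<Longrightarrow> Im (R (Complex x 0)) = 0"
    using left_half_plane_primitive[OF p, of l t] unfolding h_def by blast
  define P where "P z = cprim p l z * rlog_pow (Suc t) z - R z" for z
  have dP: "(P has_field_derivative f z) (at z)" if "Re z < 0" for z
  proof -
    have "z \<in> slit" using that by (auto simp: slit_def)
    then have "(P has_field_derivative deriv (cprim p l) z * rlog_pow (Suc t) z + rlog_pow t z / cosh z * cprim p l z - h z) (at z)"
      unfolding P_def[abs_def] by (intro DERIV_diff DERIV_mult cprim_deriv[OF p] rlog_pow_has_derivative dR) (use that in auto)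
    then show ?thesis by (simp add: f_def h_def mult_ac)
  qed
  have P_real: "Im (P (Complex x 0)) = 0" if "x < 0" for x
  proof -
    have "rlog_pow (Suc t) (Complex x 0) = of_real ((pi / 2 + 2 * arctan (exp x)) ^ Suc t / fact (Suc t))"
      by (simp only: rlog_pow_def rlog_real of_real_divide of_real_power of_real_fact)
    then have "Im (rlog_pow (Suc t) (Complex x 0)) = 0" by (simp only: Im_complex_of_real)
    then show ?thesis using real[OF that] cprim_real[OF p, of x l] that by (simp add: P_def)
  qed
  define w where "w n = - 1 / (real n + 1)" for n
  have w: "- 1 \<le> w n" "w n < 0" for n by (auto simp: w_def field_simps)
  have w0: "w \<longlonglongrightarrow> 0" unfolding w_def[abs_def] by real_asymp
  have w0': "filterlim w (at_left 0) sequentially"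
    unfolding filterlim_at using w0 w(2) by (simp add: less_imp_neq)

  have I1: "((\<lambda>\<phi>. Re (f (Complex (w n) \<phi>))) has_integral Im (P (Complex (w n) q))) {0..q}" for n
  proof -
    have "((\<lambda>\<phi>. Re (f (Complex (w n) \<phi>))) has_integral Im (P (Complex (w n) q)) - Im (P (Complex (w n) 0))) {0..q}"
    proof (rule fundamental_theorem_of_calculus)
      fix \<phi>
      have "((\<lambda>y. Im (P (Complex (w n) y))) has_real_derivative Im (\<i> * f (Complex (w n) \<phi>))) (at \<phi>)"
        by (rule Im_derivative[OF vertical_derivative[OF dP]]) (use w in auto)
      then show "((\<lambda>y. Im (P (Complex (w n) y))) has_vector_derivative Re (f (Complex (w n) \<phi>))) (at \<phi> within {0..q})"
        by (simp add: has_real_derivative_iff_has_vector_derivative has_vector_derivative_at_within)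
    qed (use q in simp)
    then show ?thesis using P_real w by simp
  qed
  have I2: "((\<lambda>\<phi>. Re (h (Complex (w n) \<phi>))) has_integral Im (R (Complex (w n) pi)) - Im (R (Complex (w n) q))) {q..pi}" for n
  proof (rule fundamental_theorem_of_calculus)
    fix \<phi>
    have "((\<lambda>y. Im (R (Complex (w n) y))) has_real_derivative Im (\<i> * h (Complex (w n) \<phi>))) (at \<phi>)"
      by (rule Im_derivative[OF vertical_derivative[OF dR]]) (use w in auto)
    then show "((\<lambda>y. Im (R (Complex (w n) y))) has_vector_derivative Re (h (Complex (w n) \<phi>))) (at \<phi> within {q..pi})"
      by (simp add: has_real_derivative_iff_has_vector_derivative has_vector_derivative_at_within)
  qed (use q in simp)

  have cont_bpow: "isCont (rlog_pow (Suc n)) z" if "cos (Im z) \<noteq> 0" for n z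
    using rlog_pow_has_derivative[of z n] that by (intro DERIV_isCont) auto
  have cos_nz: "cos \<phi> \<noteq> 0" if "0 \<le> \<phi>" "\<phi> \<le> pi" "\<phi> \<noteq> pi / 2" for \<phi>
    using abs_cos_ge[of \<phi>] that by auto
  have cont_beta: "isCont rlog z" if "cos (Im z) \<noteq> 0" for z
    using rlog_has_derivative[of z] that by (intro DERIV_isCont) auto
  have cont_bpow0: "isCont (rlog_pow n) z" if "cos (Im z) \<noteq> 0" for n z
    unfolding rlog_pow_def[abs_def] by (intro continuous_intros cont_beta that) auto

  define X where "X = (-1) ^ (m + 1) * pi * ((-1) ^ (l + p) * W_sum l m p)"
  \<comment> \<open>the functions are set to \<open>0\<close> at \<open>\<pi>/2\<close>, where the majorant is infinite but evaluates to \<open>0\<close>\<close>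
  have L1: "(\<lambda>n. Im (P (Complex (w n) q))) \<longlonglongrightarrow> X"
  proof -
    define F where "F n \<phi> = (if \<phi> = pi / 2 then 0 else Re (f (Complex (w n) \<phi>)))" for n \<phi>
    define g where "g \<phi> = (if \<phi> = pi / 2 then 0 else Re (f (Complex 0 \<phi>)))" for \<phi>
    have F: "(F n has_integral Im (P (Complex (w n) q))) {0..q}" for n
      by (rule has_integral_spike_finite[OF _ _ I1, of "{pi / 2}"]) (auto simp: F_def)
    have sub: "cbox (Complex (-1) 0) (Complex 0 q) \<subseteq> slit"
    proof
      fix z assume "z \<in> cbox (Complex (-1) 0) (Complex 0 q)"
      then have "\<bar>Im z\<bar> < pi" using q by (auto simp: in_cbox_complex_iff)
      then show "z \<in> slit" by (simp add: slit_def)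
    qed
    have holo: "deriv (cprim p l) holomorphic_on slit" by (rule holomorphic_deriv[OF cprim_holomorphic[OF p] open_slit])
    then have "continuous_on (cbox (Complex (-1) 0) (Complex 0 q)) (deriv (cprim p l))"
      using holomorphic_on_imp_continuous_on continuous_on_subset sub by blast
    then obtain B where B: "B \<ge> 0" "\<And>z. z \<in> cbox (Complex (-1) 0) (Complex 0 q) \<Longrightarrow> norm (deriv (cprim p l) z) \<le> B"
      using continuous_bounded_on_compact[OF compact_cbox] by blast
    define C where "C = B * (2 * 2 ^ Suc t * exp (3 * pi / 4))"
    have "(\<lambda>n. integral {0..q} (F n)) \<longlonglongrightarrow> integral {0..q} g"
    proof (rule dominated_convergence(2))
      show "F n integrable_on {0..q}" for n using F by (auto simp: integrable_on_def)
      show "(\<lambda>\<phi>. C * (1 / sqrt \<bar>\<phi> - pi / 2\<bar>)) integrable_on {0..q}"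
        using integrable_on_cmult_left[OF inverse_sqrt_integrable[of 0 q "pi / 2"], of C] q by simp
      show "norm (F n \<phi>) \<le> C * (1 / sqrt \<bar>\<phi> - pi / 2\<bar>)" if \<phi>: "\<phi> \<in> {0..q}" for n \<phi>
      proof (cases "\<phi> = pi / 2")
        case False
        have "norm (F n \<phi>) \<le> norm (f (Complex (w n) \<phi>))"
          using False abs_Re_le_cmod by (simp add: F_def)
        also have "\<dots> \<le> B * (2 * 2 ^ Suc t * exp (3 * pi / 4) * (1 / sqrt \<bar>\<phi> - pi / 2\<bar>))"
          unfolding f_def norm_mult
        proof (rule mult_mono)
          show "norm (deriv (cprim p l) (Complex (w n) \<phi>)) \<le> B"
            using \<phi> w[of n] by (intro B(2)) (auto simp: in_cbox_complex_iff)
          show "norm (rlog_pow (Suc t) (Complex (w n) \<phi>)) \<le> 2 * 2 ^ Suc t * exp (3 * pi / 4) * (1 / sqrt \<bar>\<phi> - pi / 2\<bar>)"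
            using norm_rlog_pow_le'[of "Complex (w n) \<phi>" "Suc t"] False \<phi> q w[of n] by simp
        qed (use B in auto)
        finally show ?thesis by (simp add: C_def mult.assoc)
      next
        case True
        show ?thesis unfolding True F_def by simp
      qed
      show "(\<lambda>n. F n \<phi>) \<longlonglongrightarrow> g \<phi>" if \<phi>: "\<phi> \<in> {0..q}" for \<phi>
      proof (cases "\<phi> = pi / 2")
        case False
        have "Complex 0 \<phi> \<in> slit" using \<phi> q by (auto simp: slit_def)
        then have "isCont (deriv (cprim p l)) (Complex 0 \<phi>)"
          using holo holomorphic_on_imp_continuous_on continuous_on_eq_continuous_at[OF open_slit] by blast
        moreover have "cos (Im (Complex 0 \<phi>)) \<noteq> 0" using cos_nz[of \<phi>] \<phi> q False by simp
        ultimately have "isCont f (Complex 0 \<phi>)"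
          unfolding f_def[abs_def] by (intro continuous_intros cont_bpow)
        then have "(\<lambda>n. Re (f (Complex (w n) \<phi>))) \<longlonglongrightarrow> Re (f (Complex 0 \<phi>))"
          by (intro tendsto_Re isCont_tendsto_compose[OF _ Complex_tendsto[OF w0]])
        then show ?thesis using False by (simp add: F_def g_def)
      qed (simp add: F_def g_def)
    qed
    moreover have "integral {0..q} (F n) = Im (P (Complex (w n) q))" for n using F by (rule integral_unique)
    moreover have "(g has_integral X + 0) {0..q}"
    proof (rule has_integral_combine[of 0 "pi / 2"])
      show "(g has_integral X) {0..pi / 2}"
        by (rule has_integral_spike_finite[OF _ _ integral_on_arc[OF p m, of l, unfolded t(1), folded X_def], of "{pi / 2}"])
          (auto simp: g_def f_def)
      show "(g has_integral 0) {pi / 2..q}"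
      proof (rule has_integral_spike_finite[OF _ _ has_integral_0, of "{pi / 2}"])
        fix \<phi> assume "\<phi> \<in> {pi / 2..q} - {pi / 2}"
        then have \<phi>: "pi / 2 < \<phi>" "\<phi> < pi" using q by auto
        have "Re (rlog (Complex 0 \<phi>) ^ Suc t) = 0"
          using \<phi> t by (intro imaginary_odd_power rlog_second_quadrant) auto
        then have "Re (rlog_pow (Suc t) (Complex 0 \<phi>)) = 0"
          unfolding rlog_pow_def by (metis Re_divide_of_real div_0 of_real_fact)
        moreover have "Im (deriv (cprim p l) (Complex 0 \<phi>)) = 0" by (rule deriv_cprim_real[OF p]) (use \<phi> q pi_gt_zero in linarith)+
        ultimately show "g \<phi> = 0" by (simp add: g_def f_def)
      qed simp
    qed (use q in auto)
    then have "integral {0..q} g = X" by (simp add: integral_unique)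
    ultimately show ?thesis by simp
  qed

  \<comment> \<open>in the limit \<open>a\<close> is imaginary and \<open>b'\<close> is real here, so the limit integrand has no real part\<close>
  have L2: "(\<lambda>n. Im (R (Complex (w n) pi)) - Im (R (Complex (w n) q))) \<longlonglongrightarrow> 0"
  proof -
    define F where "F n \<phi> = (if \<phi> = pi then 0 else Re (h (Complex (w n) \<phi>)))" for n \<phi>
    have F: "(F n has_integral Im (R (Complex (w n) pi)) - Im (R (Complex (w n) q))) {q..pi}" for n
      by (rule has_integral_spike_finite[OF _ _ I2, of "{pi}"]) (auto simp: F_def)
    obtain C where C: "C \<ge> 0" "\<And>w \<phi>. - 1 \<le> w \<Longrightarrow> w < 0 \<Longrightarrow> pi / 2 \<le> \<phi> \<Longrightarrow> \<phi> < pi \<Longrightarrow> norm (cprim p l (Complex w \<phi>)) \<le> C / sqrt (pi - \<phi>)"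
      using cprim_growth[OF p, of l] by blast
    have cosq: "cos (Im z) \<noteq> 0" if "z \<in> cbox (Complex (-1) q) (Complex 0 pi)" for z
      using that q by (intro cos_nz) (auto simp: in_cbox_complex_iff)
    have coshq: "cosh z \<noteq> 0" if "cos (Im z) \<noteq> 0" for z
      using norm_cosh_ge(2)[of z] that by auto
    have "continuous_on (cbox (Complex (-1) q) (Complex 0 pi)) (\<lambda>z. rlog_pow t z / cosh z)"
      using cosq coshq cont_bpow0 by (intro continuous_at_imp_continuous_on ballI continuous_intros) auto
    then obtain B where B: "B \<ge> 0" "\<And>z. z \<in> cbox (Complex (-1) q) (Complex 0 pi) \<Longrightarrow> norm (rlog_pow t z / cosh z) \<le> B"
      using continuous_bounded_on_compact[OF compact_cbox] by blast
    have "(\<lambda>n. integral {q..pi} (F n)) \<longlonglongrightarrow> integral {q..pi} (\<lambda>_. 0)"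
    proof (rule dominated_convergence(2))
      show "F n integrable_on {q..pi}" for n using F by (auto simp: integrable_on_def)
      show "(\<lambda>\<phi>. C * B * (1 / sqrt \<bar>\<phi> - pi\<bar>)) integrable_on {q..pi}"
        using integrable_on_cmult_left[OF inverse_sqrt_integrable[of q pi pi], of "C * B"] q by simp
      show "norm (F n \<phi>) \<le> C * B * (1 / sqrt \<bar>\<phi> - pi\<bar>)" if \<phi>: "\<phi> \<in> {q..pi}" for n \<phi>
      proof (cases "\<phi> = pi")
        case False
        have "norm (F n \<phi>) \<le> norm (h (Complex (w n) \<phi>))"
          using False abs_Re_le_cmod by (simp add: F_def)
        also have "\<dots> \<le> C / sqrt (pi - \<phi>) * B"
          unfolding h_def norm_mult
        proof (rule mult_mono)
          show "norm (cprim p l (Complex (w n) \<phi>)) \<le> C / sqrt (pi - \<phi>)"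
            using \<phi> w[of n] q False by (intro C(2)) auto
          show "norm (rlog_pow t (Complex (w n) \<phi>) / cosh (Complex (w n) \<phi>)) \<le> B"
            using \<phi> w[of n] by (intro B(2)) (auto simp: in_cbox_complex_iff)
        qed (use C \<phi> in auto)
        moreover have "\<bar>\<phi> - pi\<bar> = pi - \<phi>" using \<phi> by simp
        ultimately show ?thesis by simp
      qed (simp add: F_def)
      show "(\<lambda>n. F n \<phi>) \<longlonglongrightarrow> 0" if \<phi>: "\<phi> \<in> {q..pi}" for \<phi>
      proof (cases "\<phi> = pi")
        case False
        have \<phi>': "pi / 2 < \<phi>" "\<phi> < pi" using \<phi> q False by auto
        have c: "cos (Im (Complex 0 \<phi>)) \<noteq> 0" using cos_nz[of \<phi>] \<phi>' by simp
        have "Complex 0 \<phi> \<in> slit" using \<phi>' by (auto simp: slit_def)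
        then have "isCont (cprim p l) (Complex 0 \<phi>)" by (rule cprim_isCont[OF p])
        then have "isCont h (Complex 0 \<phi>)"
          unfolding h_def[abs_def] using coshq[OF c] by (intro continuous_intros cont_bpow0[OF c]) auto
        then have "(\<lambda>n. Re (h (Complex (w n) \<phi>))) \<longlonglongrightarrow> Re (h (Complex 0 \<phi>))"
          by (intro tendsto_Re isCont_tendsto_compose[OF _ Complex_tendsto[OF w0]])
        moreover have "Re (h (Complex 0 \<phi>)) = 0"
        proof -
          have "Im (rlog (Complex 0 \<phi>) ^ t) = 0"
            using \<phi>' t by (intro imaginary_even_power rlog_second_quadrant) auto
          then have b: "Im (rlog_pow t (Complex 0 \<phi>)) = 0"
            unfolding rlog_pow_def by (metis Im_divide_of_real div_0 of_real_fact)
          have "cosh (Complex 0 \<phi>) = of_real (cos \<phi>)" by (simp add: cosh_Complex complex_eq_iff)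
          then have "Im (rlog_pow t (Complex 0 \<phi>) / cosh (Complex 0 \<phi>)) = 0"
            using b by (simp only: Im_divide_of_real)
          moreover have "Re (cprim p l (Complex 0 \<phi>)) = 0" using cprim_imaginary[OF p, of \<phi> l] \<phi>' by simp
          ultimately show ?thesis unfolding h_def times_complex.sel by simp
        qed
        ultimately show ?thesis using False by (simp add: F_def)
      qed (simp add: F_def)
    qed
    then show ?thesis using integral_unique[OF F] by simp
  qed

  \<comment> \<open>at \<open>i q\<close> both \<open>a\<close> and \<open>b\<close> are purely imaginary, so their product is real\<close>
  have L3: "(\<lambda>n. Im (cprim p l (Complex (w n) q) * rlog_pow (Suc t) (Complex (w n) q))) \<longlonglongrightarrow> 0"
  proof -
    have "Complex 0 q \<in> slit" using q by (auto simp: slit_def)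
    then have "isCont (cprim p l) (Complex 0 q)" by (rule cprim_isCont[OF p])
    moreover have "isCont (rlog_pow (Suc t)) (Complex 0 q)" using q cos_nz[of q] by (intro cont_bpow) auto
    ultimately have "(\<lambda>n. Im (cprim p l (Complex (w n) q) * rlog_pow (Suc t) (Complex (w n) q))) \<longlonglongrightarrow>
        Im (cprim p l (Complex 0 q) * rlog_pow (Suc t) (Complex 0 q))"
      by (intro tendsto_Im tendsto_mult isCont_tendsto_compose[OF _ Complex_tendsto[OF w0]])
    moreover have "Re (rlog (Complex 0 q) ^ Suc t) = 0"
      using q t by (intro imaginary_odd_power rlog_second_quadrant) auto
    then have "Re (rlog_pow (Suc t) (Complex 0 q)) = 0"
      unfolding rlog_pow_def by (metis Re_divide_of_real div_0 of_real_fact)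
    moreover have "Re (cprim p l (Complex 0 q)) = 0" using cprim_imaginary[OF p, of q l] q by simp
    ultimately show ?thesis by simp
  qed

  have "(Im (R (Complex (w n) pi)) - Im (R (Complex (w n) q)))
      + Im (cprim p l (Complex (w n) q) * rlog_pow (Suc t) (Complex (w n) q)) - Im (P (Complex (w n) q))
      = Im (R (Complex (w n) pi))" for n
    by (simp add: P_def)
  moreover have "(\<lambda>n. (Im (R (Complex (w n) pi)) - Im (R (Complex (w n) q)))
      + Im (cprim p l (Complex (w n) q) * rlog_pow (Suc t) (Complex (w n) q)) - Im (P (Complex (w n) q))) \<longlonglongrightarrow> 0 + 0 - X"
    by (intro tendsto_intros L1 L2 L3)
  ultimately have lim1: "(\<lambda>n. Im (R (Complex (w n) pi))) \<longlonglongrightarrow> - X" by (simp only: add_0 diff_0)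
  have lim2: "(\<lambda>n. (-1) ^ l * pi * angle_prim l p (Suc t) (w n)) \<longlonglongrightarrow> (-1) ^ l * pi * W_sum l p m"
    using filterlim_compose[OF angle_prim_at_0[OF m, of l p] w0'] unfolding t(1) by (intro tendsto_intros)
  have top: "Im (R (Complex (w n) pi)) = (-1) ^ l * pi * angle_prim l p (Suc t) (w n)" for n
    by (rule primitive_top[OF p t(2) w(2)]) (use dR real in \<open>auto simp: h_def\<close>)
  have "(-1) ^ l * pi * W_sum l p m = - X"
    by (rule LIMSEQ_unique[OF lim2 lim1[unfolded top]])
  then have "(-1) ^ l * W_sum l p m = (-1) ^ l * ((-1) ^ (m + p) * W_sum l m p)"
    by (simp add: X_def power_add mult_ac)
  then show ?thesis by simp
qed

theorem theorem1p2p2: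
  fixes m p l :: nat
  assumes "m \<ge> 1" and "p \<ge> 1"
  shows "(- 1) ^ m * (\<Sum>j = 1..p. \<alpha> (p - j) * W l (2 * j + 2 * m + l - 3) (2 * m + l - 1)) =
         (- 1) ^ p * (\<Sum>j = 1..m. \<alpha> (m - j) * W l (2 * j + 2 * p + l - 3) (2 * p + l - 1))"
proof -
  have eq: "(\<Sum>j = 1..p. \<alpha> (p - j) * W l (2 * j + 2 * m + l - 3) (2 * m + l - 1)) = W_sum l p m"
    if "m \<ge> 1" for m p
    unfolding W_sum_def
  proof (rule sum.cong)
    fix j assume "j \<in> {1..p}"
    then have "2 * j + 2 * m + l - 3 = 2 * j - 2 + (l + (2 * m - 1))" "2 * m + l - 1 = l + (2 * m - 1)"
      using that by auto
    then show "\<alpha> (p - j) * W l (2 * j + 2 * m + l - 3) (2 * m + l - 1) =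
        \<alpha> (p - j) * W l (2 * j - 2 + (l + (2 * m - 1))) (l + (2 * m - 1))" by simp
  qed simp
  have "(-1) ^ m * W_sum l p m = ((-1) ^ m * (-1) ^ m) * (-1) ^ p * W_sum l m p"
    by (simp add: W_sum_symmetric[OF assms(2,1)] power_add)
  also have "(-1) ^ m * (-1) ^ m = (1 :: real)" by (simp flip: power_mult_distrib)
  finally show ?thesis unfolding eq[OF assms(1)] eq[OF assms(2)] by simp
qed

end
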